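(* The correspondence $V\ni\alpha\mapsto\mathcal X_\alpha\in\Pi$ is a homeomorphism onto its image, where $V$ carries the topology of the $\ell_\infty$-norm and $\Pi$ the weak topology. In particular, the topological dimension of the space of non-trivial pyramids (as a subspace of $\Pi$) is infinite.
   Context: A pm-space is a triple $X=(X,d_X,m_X)$ with $(X,d_X)$ a complete separable metric space and $m_X$ a Borel probability measure. Two pm-spaces are isomorphic if there is an isometry $\operatorname{supp} m_X\to\operatorname{supp} m_Y$ pushing $m_X$ forward to $m_Y$; $\mathcal X$ is the set of isomorphism classes, and a class is always represented by a space with $\operatorname{supp}m_X=X$. Lipschitz order: $Y\prec X$ iff there is a $1$-Lipschitz map $\phi:X\to Y$ with $\phi_\#m_X=m_Y$. Box distance: a parameter of $X$ is a Borel map $a:[0,1]\to X$ with $a_\#\mathcal L^1=m_X$; $\square(X,Y)$ is the infimum of $\epsilon>0$ such that there are parameters $a$ of $X$, $b$ of $Y$ and a Borel set $I_0\subset[0,1]$ with $\mathcal L^1(I_0)\ge1-\epsilon$ and $|d_X(a(s),a(t))-d_Y(b(s),b(t))|\le\epsilon$ for all $s,t\in I_0$. A pyramid is a non-empty, $\square$-closed subset $P\subset\mathcal X$ that is downward-closed for $\prec$ and directed (any $X,Y\in P$ have some $Z\in P$ with $X,Y\prec Z$). $\Pi$ is the set of pyramids; $\mathcal PX=\{Y\in\mathcal X\mid Y\prec X\}\in\Pi$. Pyramids $P_n$ converge weakly to $P$ if (1) every $X\in P$ is a $\square$-limit of some $X_n\in P_n$, and (2) $\liminf_n\inf_{Y\in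 P_n}\square(X,Y)>0$ for every $X\notin P$; this is convergence for a compact metrizable topology on $\Pi$ (the weak topology). A pyramid is non-trivial if it is not of the form $\mathcal PX$ for a pm-space $X$ and is not the greatest pyramid $\mathcal X$. $V=\{\alpha=(\alpha_i)_{i\ge1}\in[0,\infty)^{\mathbb N}\mid\sum_i\alpha_i\le1,\ \alpha_i\ge\alpha_{i+1}\ \forall i\}$. For $\alpha\in V$, $\mathcal X_\alpha$ is the set of $X\in\mathcal X$ for which there is a map $f:\mathbb N\to X$ such that $m_X-\sum_{i=1}^\infty\alpha_i\delta_{f(i)}$ is a nonnegative measure ($\delta_x$ is the Dirac measure); it is a pyramid. *)

theory Defs
  imports "HOL-Probability.Probability"
begin

section \<open>pm-spaces and their isomorphism classes\<close>

text \<open>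
  A complete separable metric space has at most the cardinality of the continuum, so up to
  isomorphism every pm-space has a subset of the type \<^typ>\<open>real\<close> as its set of points. The metric
  on that subset is arbitrary and unrelated to the usual metric of the reals.
\<close>

type_synonym pm = "real metric \<times> real measure"

abbreviation pm_points :: "pm \<Rightarrow> real set"
  where "pm_points X \<equiv> mspace (fst X)"

abbreviation pm_dist :: "pm \<Rightarrow> real \<Rightarrow> real \<Rightarrow> real"
  where "pm_dist X \<equiv> mdist (fst X)"

abbreviation pm_topology :: "pm \<Rightarrow> real topology"
  where "pm_topology X \<equiv> mtopology_of (fst X)"

abbreviation pm_measure :: "pm \<Rightarrow> real measure"
  where "pm_measure X \<equiv> snd X"

definition pm_space :: "pm \<Rightarrow> bool" where
  "pm_space X \<longleftrightarrow>
     mcomplete_of (fst X) \<and> separable_space (pm_topology X) \<and>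
     space (pm_measure X) = pm_points X \<and>
     sets (pm_measure X) = sigma_sets (pm_points X) {U. openin (pm_topology X) U} \<and>
     prob_space (pm_measure X)"

definition pm_support :: "pm \<Rightarrow> real set" where
  "pm_support X =
     {x \<in> pm_points X. \<forall>U. openin (pm_topology X) U \<and> x \<in> U \<longrightarrow> 0 < measure (pm_measure X) U}"

definition pm_iso :: "(pm \<times> pm) set" where
  "pm_iso = {(X, Y). pm_space X \<and> pm_space Y \<and>
     (\<exists>\<phi>. \<phi> ` pm_support X = pm_support Y \<and>
          (\<forall>x\<in>pm_support X. \<forall>y\<in>pm_support X. pm_dist Y (\<phi> x) (\<phi> y) = pm_dist X x y) \<and>
          distr (restrict_space (pm_measure X) (pm_support X)) (pm_measure Y) \<phi> = pm_measure Y)}"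

definition pm_classes :: "pm set set" where
  "pm_classes = {X. pm_space X} // pm_iso"

text \<open>
  Every class contains a space whose measure has full support, unique up to an isometry
  preserving the measures; the notions below do not depend on the one that is chosen.
\<close>

definition pm_rep :: "pm set \<Rightarrow> pm" where
  "pm_rep X = (SOME x. x \<in> X \<and> pm_support x = pm_points x)"


section \<open>Lipschitz order and box distance\<close>

definition lipschitz_le :: "pm set \<Rightarrow> pm set \<Rightarrow> bool" where
  "lipschitz_le Y X \<longleftrightarrow>
     (\<exists>\<phi> \<in> pm_points (pm_rep X) \<rightarrow> pm_points (pm_rep Y).
        (\<forall>x\<in>pm_points (pm_rep X). \<forall>y\<in>pm_points (pm_rep X).
            pm_dist (pm_rep Y) (\<phi> x) (\<phi> y) \<le> pm_dist (pm_rep X) x y) \<and>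
        distr (pm_measure (pm_rep X)) (pm_measure (pm_rep Y)) \<phi> = pm_measure (pm_rep Y))"

definition pm_parameter :: "pm \<Rightarrow> (real \<Rightarrow> real) \<Rightarrow> bool" where
  "pm_parameter X a \<longleftrightarrow>
     a \<in> measurable (restrict_space lborel {0..1}) (pm_measure X) \<and>
     distr (restrict_space lborel {0..1}) (pm_measure X) a = pm_measure X"

definition box_dist :: "pm set \<Rightarrow> pm set \<Rightarrow> real" where
  "box_dist X Y = Inf {\<epsilon>. \<epsilon> > 0 \<and>
     (\<exists>a b I\<^sub>0. pm_parameter (pm_rep X) a \<and> pm_parameter (pm_rep Y) b \<and>
        I\<^sub>0 \<in> sets borel \<and> I\<^sub>0 \<subseteq> {0..1} \<and> measure lborel I\<^sub>0 \<ge> 1 - \<epsilon> \<and>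
        (\<forall>s\<in>I\<^sub>0. \<forall>t\<in>I\<^sub>0. \<bar>pm_dist (pm_rep X) (a s) (a t) - pm_dist (pm_rep Y) (b s) (b t)\<bar> \<le> \<epsilon>))}"


section \<open>Pyramids\<close>

definition box_closed :: "pm set set \<Rightarrow> bool" where
  "box_closed P \<longleftrightarrow> (\<forall>X\<in>pm_classes. (\<forall>\<epsilon>>0. \<exists>Y\<in>P. box_dist X Y < \<epsilon>) \<longrightarrow> X \<in> P)"

definition pyramid :: "pm set set \<Rightarrow> bool" where
  "pyramid P \<longleftrightarrow>
     P \<subseteq> pm_classes \<and> P \<noteq> {} \<and> box_closed P \<and>
     (\<forall>X\<in>P. \<forall>Y\<in>pm_classes. lipschitz_le Y X \<longrightarrow> Y \<in> P) \<and>
     (\<forall>X\<in>P. \<forall>Y\<in>P. \<exists>Z\<in>P. lipschitz_le X Z \<and> lipschitz_le Y Z)"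

definition pyramids :: "pm set set set" where
  "pyramids = {P. pyramid P}"

definition principal_pyramid :: "pm set \<Rightarrow> pm set set" where
  "principal_pyramid X = {Y \<in> pm_classes. lipschitz_le Y X}"

definition nontrivial_pyramids :: "pm set set set" where
  "nontrivial_pyramids =
     {P \<in> pyramids. (\<forall>X\<in>pm_classes. P \<noteq> principal_pyramid X) \<and> P \<noteq> pm_classes}"

definition weakly_converges :: "(nat \<Rightarrow> pm set set) \<Rightarrow> pm set set \<Rightarrow> bool" where
  "weakly_converges \<sigma> P \<longleftrightarrow>
     (\<forall>X\<in>P. \<exists>x. (\<forall>n. x n \<in> \<sigma> n) \<and> (\<lambda>n. box_dist X (x n)) \<longlonglongrightarrow> 0) \<and>
     (\<forall>X\<in>pm_classes - P. 0 < liminf (\<lambda>n. ereal (INF Y\<in>\<sigma> n. box_dist X Y)))"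

text \<open>
  The open sets are those that eventually contain every sequence converging weakly to one of
  their elements. A metrizable topology is determined by its convergent sequences, so this is the
  only candidate for a metrizable topology that induces weak convergence: see
  \<open>weak_topology_unique\<close> below.
\<close>

definition weak_open :: "pm set set set \<Rightarrow> bool" where
  "weak_open U \<longleftrightarrow> U \<subseteq> pyramids \<and>
     (\<forall>P\<in>U. \<forall>\<sigma>. (\<forall>n. \<sigma> n \<in> pyramids) \<and> weakly_converges \<sigma> P \<longrightarrow>
        (\<forall>\<^sub>F n in sequentially. \<sigma> n \<in> U))"

definition weak_topology :: "pm set set topology" where
  "weak_topology = topology weak_open"

lemma istopology_weak_open: "istopology weak_open"
  unfolding istopology_def
proof (intro conjI allI impI)
  fix S T assume "weak_open S" "weak_open T"
  then show "weak_open (S \<inter> T)"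
    unfolding weak_open_def by (auto intro: eventually_conj)
next
  fix K assume K: "\<forall>S\<in>K. weak_open S"
  show "weak_open (\<Union>K)"
    unfolding weak_open_def
  proof (intro conjI ballI allI impI)
    show "\<Union>K \<subseteq> pyramids" using K by (auto simp: weak_open_def)
    fix P \<sigma> assume "P \<in> \<Union>K" and \<sigma>: "(\<forall>n. \<sigma> n \<in> pyramids) \<and> weakly_converges \<sigma> P"
    then obtain S where S: "S \<in> K" "P \<in> S" by blast
    with K \<sigma> have "\<forall>\<^sub>F n in sequentially. \<sigma> n \<in> S" by (auto simp: weak_open_def)
    then show "\<forall>\<^sub>F n in sequentially. \<sigma> n \<in> \<Union>K"
      by (rule eventually_mono) (use S in blast)
  qed
qed

lemma openin_weak_topology: "openin weak_topology U \<longleftrightarrow> weak_open U"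
  by (simp add: weak_topology_def istopology_weak_open)

lemma topspace_weak_topology: "topspace weak_topology = pyramids"
proof -
  have "weak_open pyramids" by (auto simp: weak_open_def)
  then show ?thesis
    unfolding topspace_def openin_weak_topology by (auto simp: weak_open_def)
qed

lemma weak_topology_unique:
  assumes met: "metrizable_space T"
    and top: "topspace T = pyramids"
    and lim: "\<And>\<sigma> P. (\<And>n. \<sigma> n \<in> pyramids) \<Longrightarrow> P \<in> pyramids \<Longrightarrow>
                limitin T \<sigma> P sequentially \<longleftrightarrow> weakly_converges \<sigma> P"
  shows "T = weak_topology"
proof (rule topology_eq[THEN iffD2], intro allI iffI)
  fix U assume U: "openin T U"
  then have "U \<subseteq> pyramids" using openin_subset top by blast
  then show "openin weak_topology U"
    unfolding openin_weak_topology weak_open_def using U lim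
    by (metis limitin_def subsetD)
next
  fix U assume "openin weak_topology U"
  then have U: "weak_open U" by (simp add: openin_weak_topology)
  obtain M d where M: "Metric_space M d" "T = Metric_space.mtopology M d"
    using met by (auto simp: metrizable_space_def)
  interpret Metric_space M d by fact
  have MM: "M = pyramids" using top M(2) by simp
  have "\<exists>r>0. mball P r \<subseteq> U" if "P \<in> U" for P
  proof (rule ccontr)
    assume neg: "\<not> (\<exists>r>0. mball P r \<subseteq> U)"
    have "\<exists>Q. Q \<in> mball P (inverse (real (Suc n))) - U" for n
    proof -
      have "inverse (real (Suc n)) > 0" by simp
      with neg show ?thesis by blast
    qed
    then obtain \<sigma> where \<sigma>: "\<And>n. \<sigma> n \<in> mball P (inverse (real (Suc n))) - U" by metis
    have P: "P \<in> pyramids" using that U by (auto simp: weak_open_def)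
    have \<sigma>M: "\<sigma> n \<in> pyramids" for n using \<sigma>[of n] unfolding MM[symmetric] by (simp del: of_nat_Suc)
    have "(\<lambda>n. d (\<sigma> n) P) \<longlonglongrightarrow> 0"
    proof (rule tendsto_sandwich[of "\<lambda>_. 0" _ _ "\<lambda>n. inverse (real (Suc n))"])
      show "\<forall>\<^sub>F n in sequentially. d (\<sigma> n) P \<le> inverse (real (Suc n))"
        using \<sigma> by (intro always_eventually allI) (fastforce simp: commute intro: less_imp_le)
    qed (use LIMSEQ_inverse_real_of_nat in auto)
    then have "limitin T \<sigma> P sequentially"
      using \<sigma>M P MM unfolding M(2) limitin_metric_dist_null by auto
    then have "weakly_converges \<sigma> P" using lim \<sigma>M P by blast
    then have "\<forall>\<^sub>F n in sequentially. \<sigma> n \<in> U" using U that \<sigma>M by (auto simp: weak_open_def)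
    moreover have "\<forall>n. \<sigma> n \<notin> U" using \<sigma> by auto
    ultimately show False by simp
  qed
  then show "openin T U"
    using U MM unfolding M(2) openin_mtopology weak_open_def by blast
qed


section \<open>The pyramids of spaces with prescribed atoms\<close>

text \<open>
  Sequences are indexed from 0 instead of 1. As \<^typ>\<open>nat\<close> is discrete, \<^typ>\<open>nat \<Rightarrow>\<^sub>C real\<close> is the
  space of all bounded sequences, with the supremum norm.
\<close>

definition atom_weights :: "(nat \<Rightarrow>\<^sub>C real) set" where
  "atom_weights = {\<alpha>. (\<forall>i. 0 \<le> apply_bcontfun \<alpha> i) \<and>
     summable (apply_bcontfun \<alpha>) \<and> (\<Sum>i. apply_bcontfun \<alpha> i) \<le> 1 \<and>
     (\<forall>i. apply_bcontfun \<alpha> (Suc i) \<le> apply_bcontfun \<alpha> i)}"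

definition atom_pyramid :: "(nat \<Rightarrow>\<^sub>C real) \<Rightarrow> pm set set" where
  "atom_pyramid \<alpha> = {X \<in> pm_classes.
     \<exists>f :: nat \<Rightarrow> real. (\<forall>i. f i \<in> pm_points (pm_rep X)) \<and>
       (\<forall>A\<in>sets (pm_measure (pm_rep X)).
          0 \<le> measure (pm_measure (pm_rep X)) A
                - (\<Sum>i. apply_bcontfun \<alpha> i * measure (return (pm_measure (pm_rep X)) (f i)) A))}"


section \<open>Topological dimension\<close>

text \<open>Lebesgue covering dimension at most \<open>n\<close>.\<close>

definition covering_dim_le :: "'a topology \<Rightarrow> nat \<Rightarrow> bool" where
  "covering_dim_le T n \<longleftrightarrow>
     (\<forall>\<U>. finite \<U> \<and> (\<forall>U\<in>\<U>. openin T U) \<and> \<Union>\<U> = topspace T \<longrightarrow>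
        (\<exists>\<V>. (\<forall>V\<in>\<V>. openin T V) \<and> \<Union>\<V> = topspace T \<and> (\<forall>V\<in>\<V>. \<exists>U\<in>\<U>. V \<subseteq> U) \<and>
             (\<forall>x\<in>topspace T. finite {V\<in>\<V>. x \<in> V} \<and> card {V\<in>\<V>. x \<in> V} \<le> n + 1)))"

end

theory Submission
  imports Defs "HOL-Library.Diagonal_Subsequence"
begin

text \<open>
  Every pm-space has a parameter; moreover, if \<open>f\<close> exhibits atoms of weights \<open>\<alpha>\<close>, there is a
  parameter with value \<open>f i\<close> on the \<open>i\<close>-th of consecutive intervals of lengths \<open>\<alpha> 0, \<alpha> 1, \<dots>\<close>. Pairing
  such parameters of two spaces shows that \<open>atom_pyramid \<alpha>\<close> is directed. Replacing a parameter by constants on the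
  intervals of a nearby \<open>\<beta>\<close> shows that each member of \<open>atom_pyramid \<alpha>\<close> is box-close to
  members of \<open>atom_pyramid \<beta>\<close>. Conversely, in a box limit the atoms \<open>\<alpha> i > 0\<close> survive as limits of small balls of measure
  almost \<open>\<alpha> i\<close>. This gives continuity of \<open>atom_pyramid\<close>. As \<open>atom_weights\<close> is compact and
  weak limits are unique, the map is closed, hence an embedding once injective.

  If \<open>0 < \<alpha> 0 < 1\<close>, the pyramid is non-trivial. Hence simplices of every dimension embed as closed subsets into
  the space of non-trivial pyramids, and Lebesgue's covering argument, based on Brouwer's fixed point
  theorem, applies.
\<close>

section \<open>Borel structure of a pm-space\<close>

text \<open>Two difficulties shape the proof. Spaces at small box distance \<epsilon> agree only up
  to \<epsilon>, on a set of measure at least 1 - \<epsilon>. So an atom of one is seen in the other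
  as a small ball, and the balls of several atoms may shrink to the same point. Testing the atoms
  one by one would then lose their total mass; they are tested in finite groups, with one error term
  for the whole group, and the points carrying the atoms may coincide. Conversely, a bound on the
  sup norm says nothing about sums of infinitely many weights, so far out the intervals of \<alpha>
  and \<beta> may be displaced considerably against each other. But those intervals are short, and
  outside a small set a parameter hardly changes on short intervals, so it can be made constant on
  them wherever they lie. Only finitely many long intervals have to be aligned. In the dimension
  argument the cover must consist of open sets of the whole space of non-trivial pyramids. It is
  formed by the complements of the images of the faces of a simplex, which are closed because the
  map is closed on all of \<open>atom_weights\<close>.\<close>

locale pm =
  fixes X :: pm
  assumes pm_space: "pm_space X"
begin

sublocale met: Metric_space "pm_points X" "pm_dist X"
  by simp

sublocale prob_space "pm_measure X"
  using pm_space by (simp add: pm_space_def)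

lemma space_eq: "space (pm_measure X) = pm_points X"
  using pm_space by (simp add: pm_space_def)

lemma sets_eq: "sets (pm_measure X) = sigma_sets (pm_points X) {U. openin (pm_topology X) U}"
  using pm_space by (simp add: pm_space_def)

lemma topology_eq: "pm_topology X = met.mtopology"
  by (simp add: mtopology_of_def)

lemma open_sets: "openin (pm_topology X) U \<Longrightarrow> U \<in> sets (pm_measure X)"
  by (simp add: sets_eq sigma_sets.Basic)

lemma closed_sets: "closedin (pm_topology X) C \<Longrightarrow> C \<in> sets (pm_measure X)"
  using sets.compl_sets[OF open_sets, of "pm_points X - C"]
  by (auto simp: closedin_def space_eq double_diff)

lemma ball_sets: "met.mball x r \<in> sets (pm_measure X)"
  by (rule open_sets) (simp add: topology_eq)

lemma cball_sets: "met.mcball x r \<in> sets (pm_measure X)"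
  by (rule closed_sets) (simp add: topology_eq)

lemma singleton_sets: "x \<in> pm_points X \<Longrightarrow> {x} \<in> sets (pm_measure X)"
  using Hausdorff_imp_t1_space[OF met.Hausdorff_space_mtopology]
  by (intro closed_sets) (auto simp: topology_eq t1_space_closedin_singleton)

lemma finite_sets: "finite F \<Longrightarrow> F \<subseteq> pm_points X \<Longrightarrow> F \<in> sets (pm_measure X)"
  by (induction F rule: finite_induct) (auto intro: sets.Un[of "{_}", simplified] singleton_sets)

lemma points_nonempty: "pm_points X \<noteq> {}"
  using not_empty space_eq by simp

lemma mcomplete: "met.mcomplete"
  using pm_space by (simp add: pm_space_def mcomplete_of_def)

definition dense_seq :: "(nat \<Rightarrow> real) \<Rightarrow> bool" where
  "dense_seq q \<longleftrightarrow> (\<forall>n. q n \<in> pm_points X) \<and> (\<forall>x\<in>pm_points X. \<forall>e>0. \<exists>n. pm_dist X (q n) x < e)"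

lemma dense_seq_exists: "\<exists>q. dense_seq q"
proof -
  obtain C where C: "countable C" "C \<subseteq> pm_points X" "met.mtopology closure_of C = pm_points X"
    using pm_space by (auto simp: pm_space_def separable_space_def topology_eq)
  have dense: "\<exists>c\<in>C. pm_dist X c x < e" if "x \<in> pm_points X" "0 < e" for x e
    using that C(3) unfolding met.metric_closure_of by (fastforce simp: met.commute)
  have "C \<noteq> {}" using dense points_nonempty by (metis equals0I empty_iff zero_less_one)
  then have "range (from_nat_into C) = C" using C(1) by simp
  then show ?thesis
    using dense C(2) unfolding dense_seq_def
    by (intro exI[of _ "from_nat_into C"]) (metis (no_types, lifting) rangeI subsetD rangeE)
qed

lemma dist_measurable:
  assumes "z \<in> pm_points X"
  shows "(\<lambda>x. pm_dist X x z) \<in> borel_measurable (pm_measure X)"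
proof -
  have "{x \<in> space (pm_measure X). pm_dist X x z < r} = met.mball z r" for r
    using assms by (auto simp: space_eq met.commute)
  then show ?thesis
    using ball_sets by (intro borel_measurableI_less) auto
qed

lemma ball_base:
  assumes q: "dense_seq q" and U: "openin (pm_topology X) U" and x: "x \<in> U"
  shows "\<exists>n k. x \<in> met.mball (q n) (1 / Suc k) \<and> met.mball (q n) (1 / Suc k) \<subseteq> U"
proof -
  have q': "q n \<in> pm_points X" for n using q by (simp add: dense_seq_def)
  obtain r where r: "r > 0" "met.mball x r \<subseteq> U"
    using U x unfolding topology_eq met.openin_mtopology by blast
  have x: "x \<in> pm_points X" using x U by (auto simp: topology_eq met.openin_mtopology)
  obtain k where k: "1 / Suc k < r / 2"
    using r(1) by (metis half_gt_zero nat_approx_posE)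
  obtain n where n: "pm_dist X (q n) x < 1 / Suc k"
    using q x unfolding dense_seq_def by (metis of_nat_0_less_iff zero_less_Suc zero_less_divide_1_iff)
  have "met.mball (q n) (1 / Suc k) \<subseteq> met.mball x r"
    using n k x q'[of n] by (intro met.mball_subset) (auto simp: met.commute)
  then show ?thesis using n x q' r(2) by (intro exI[of _ n] exI[of _ k]) auto
qed

text \<open>Each open set is a countable union of balls around a dense sequence
  (\<open>ball_base\<close>), and the preimage of a ball is a sublevel set of a distance
  function.\<close>

lemma measurableI_dist:
  assumes g: "\<And>t. t \<in> space N \<Longrightarrow> g t \<in> pm_points X"
    and meas: "\<And>z. z \<in> pm_points X \<Longrightarrow> (\<lambda>t. pm_dist X (g t) z) \<in> borel_measurable N"
  shows "g \<in> measurable N (pm_measure X)"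
proof (rule measurable_sigma_sets[OF sets_eq])
  obtain q where q: "dense_seq q"
    using dense_seq_exists by blast
  fix U assume "U \<in> {U. openin (pm_topology X) U}"
  then have U: "openin (pm_topology X) U" by simp
  have ball: "g -` met.mball (q n) r \<inter> space N \<in> sets N" for n r
  proof -
    have "g -` met.mball (q n) r \<inter> space N = {t \<in> space N. pm_dist X (g t) (q n) < r}"
      using g q by (auto simp: met.commute dense_seq_def)
    then show ?thesis using meas[of "q n"] q by (simp add: dense_seq_def)
  qed
  have "g -` U \<inter> space N = (\<Union>(n, k)\<in>{(n, k :: nat). met.mball (q n) (1 / Suc k) \<subseteq> U}.
      g -` met.mball (q n) (1 / Suc k) \<inter> space N)"
    using ball_base[OF q U] by fast
  also have "\<dots> \<in> sets N"
    using ball by (intro sets.countable_UN') auto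
  finally show "g -` U \<inter> space N \<in> sets N" .
qed (use g openin_subset in \<open>fastforce+\<close>)

end

lemma pm_spaceI:
  fixes X :: pm
  assumes "mcomplete_of (fst X)" "countable C" "C \<subseteq> pm_points X"
    and dense: "\<And>x e. x \<in> pm_points X \<Longrightarrow> 0 < e \<Longrightarrow> \<exists>c\<in>C. pm_dist X x c < e"
    and "space (pm_measure X) = pm_points X"
    and "sets (pm_measure X) = sigma_sets (pm_points X) {U. openin (pm_topology X) U}"
    and "prob_space (pm_measure X)"
  shows "pm_space X"
proof -
  interpret Metric_space "pm_points X" "pm_dist X" by simp
  have "mtopology closure_of C = pm_points X"
    using assms(3) dense unfolding metric_closure_of by fastforce
  then have "separable_space (pm_topology X)"
    using assms(2,3) by (auto simp: separable_space_def mtopology_of_def)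
  then show ?thesis using assms by (simp add: pm_space_def)
qed

lemma pm_space_distr:
  assumes "pm_space X" "prob_space N" "a \<in> measurable N (pm_measure X)"
  shows "pm_space (fst X, distr N (pm_measure X) a)"
  using assms by (simp add: pm_space_def prob_space.prob_space_distr)

lemma lipschitz_measurable:
  assumes X: "pm_space X" and Y: "pm_space Y" and \<phi>: "\<phi> \<in> pm_points X \<rightarrow> pm_points Y"
    and lip: "\<And>x y. x \<in> pm_points X \<Longrightarrow> y \<in> pm_points X \<Longrightarrow> pm_dist Y (\<phi> x) (\<phi> y) \<le> pm_dist X x y"
  shows "\<phi> \<in> measurable (pm_measure X) (pm_measure Y)"
proof -
  interpret X: pm X by standard fact
  interpret Y: pm Y by standard fact
  show ?thesis
  proof (rule Y.measurableI_dist)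
    fix z assume z: "z \<in> pm_points Y"
    show "(\<lambda>t. pm_dist Y (\<phi> t) z) \<in> borel_measurable (pm_measure X)"
    proof (rule borel_measurableI_less)
      fix r
      have "openin (pm_topology X) {x \<in> pm_points X. pm_dist Y (\<phi> x) z < r}"
        unfolding X.topology_eq X.met.openin_mtopology
      proof (intro conjI allI impI)
        fix x assume x: "x \<in> {x \<in> pm_points X. pm_dist Y (\<phi> x) z < r}"
        have "pm_dist Y (\<phi> y) z < r" if "y \<in> X.met.mball x (r - pm_dist Y (\<phi> x) z)" for y
        proof -
          have "pm_dist Y (\<phi> y) z \<le> pm_dist Y (\<phi> y) (\<phi> x) + pm_dist Y (\<phi> x) z"
            using x z that \<phi> by (intro Y.met.triangle) auto
          then show ?thesis using lip[of y x] x that by (auto simp: X.met.commute)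
        qed
        then show "\<exists>s>0. X.met.mball x s \<subseteq> {x \<in> pm_points X. pm_dist Y (\<phi> x) z < r}"
          using x by (intro exI[of _ "r - pm_dist Y (\<phi> x) z"]) auto
      qed auto
      then show "{x \<in> space (pm_measure X). pm_dist Y (\<phi> x) z < r} \<in> sets (pm_measure X)"
        using X.open_sets by (simp add: X.space_eq)
    qed
  qed (use \<phi> in \<open>auto simp: X.space_eq\<close>)
qed


section \<open>Supports and representatives\<close>

context pm
begin

lemma support_subset: "pm_support X \<subseteq> pm_points X"
  by (auto simp: pm_support_def)

lemma support_null_nbhd:
  assumes "x \<in> pm_points X" "x \<notin> pm_support X"
  shows "\<exists>U. openin (pm_topology X) U \<and> x \<in> U \<and> U \<inter> pm_support X = {} \<and> prob U = 0"
proof -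
  obtain U where U: "openin (pm_topology X) U" "x \<in> U" "\<not> 0 < prob U"
    using assms by (auto simp: pm_support_def)
  then have "prob U = 0" using measure_nonneg[of "pm_measure X" U] by linarith
  moreover have "U \<inter> pm_support X = {}" using U by (auto simp: pm_support_def)
  ultimately show ?thesis using U by blast
qed

lemma closedin_support: "closedin (pm_topology X) (pm_support X)"
proof -
  have "openin (pm_topology X) (pm_points X - pm_support X)"
    using support_null_nbhd openin_subset[of "pm_topology X"]
    by (subst openin_subopen) (fastforce simp del: topspace_mtopology_of simp: topspace_mtopology_of[symmetric])
  then show ?thesis using support_subset by (simp add: closedin_def)
qed

lemma support_sets: "pm_support X \<in> sets (pm_measure X)"
  by (rule closed_sets[OF closedin_support])

text \<open>Separability enters here: the complement of the support is covered by those balls of a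
  countable base that are null.\<close>

lemma prob_support: "prob (pm_support X) = 1"
proof -
  obtain q where q: "dense_seq q" using dense_seq_exists by blast
  define B where "B = (\<lambda>(n, k). met.mball (q n) (1 / Suc k))"
  have "pm_points X - pm_support X \<subseteq> (\<Union>i\<in>{i. prob (B i) = 0}. B i)"
  proof
    fix x assume "x \<in> pm_points X - pm_support X"
    then obtain U where U: "openin (pm_topology X) U" "x \<in> U" "prob U = 0"
      using support_null_nbhd by blast
    then obtain n k where nk: "x \<in> B (n, k)" "B (n, k) \<subseteq> U"
      using ball_base[OF q U(1,2)] unfolding B_def by auto
    then have "prob (B (n, k)) \<le> prob U" by (intro finite_measure_mono open_sets U)
    then have "prob (B (n, k)) = 0" using U(3) measure_nonneg[of "pm_measure X" "B (n, k)"] by linarith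
    then show "x \<in> (\<Union>i\<in>{i. prob (B i) = 0}. B i)" using nk by blast
  qed
  moreover have "(\<Union>i\<in>{i. prob (B i) = 0}. B i) \<in> null_sets (pm_measure X)"
    by (intro null_sets_UN') (auto simp: B_def null_sets_def ball_sets emeasure_eq_measure split: prod.splits)
  moreover have "pm_points X - pm_support X \<in> sets (pm_measure X)"
    using sets.compl_sets[OF support_sets] by (simp add: space_eq)
  ultimately have "pm_points X - pm_support X \<in> null_sets (pm_measure X)"
    using null_sets_subset by blast
  then have "prob (space (pm_measure X) - pm_support X) = 0"
    by (simp add: null_sets_def emeasure_eq_measure space_eq)
  then show ?thesis using prob_compl[OF support_sets] by simp
qed

lemma AE_support: "AE x in pm_measure X. x \<in> pm_support X"
  using prob_support by (rule AE_prob_1)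

lemma emeasure_Int_support:
  assumes "A \<in> sets (pm_measure X)"
  shows "emeasure (pm_measure X) (A \<inter> pm_support X) = emeasure (pm_measure X) A"
  using AE_support assms support_sets by (intro emeasure_eq_AE) auto

end

text \<open>It shows that every class contains a space of full support, so that the choice in
  \<open>pm_rep\<close> is meaningful.\<close>

definition pm_restrict :: "pm \<Rightarrow> pm" where
  "pm_restrict X = (submetric (fst X) (pm_support X), restrict_space (pm_measure X) (pm_support X))"

context pm
begin

lemma points_restrict: "pm_points (pm_restrict X) = pm_support X"
  using support_subset by (auto simp: pm_restrict_def)

lemma dist_restrict: "pm_dist (pm_restrict X) = pm_dist X"
  by (simp add: pm_restrict_def)

lemma measure_restrict: "pm_measure (pm_restrict X) = restrict_space (pm_measure X) (pm_support X)"
  by (simp add: pm_restrict_def)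

lemma topology_restrict: "pm_topology (pm_restrict X) = subtopology (pm_topology X) (pm_support X)"
  by (simp add: pm_restrict_def mtopology_of_submetric)

text \<open>A dense sequence of the whole space may miss \<open>S\<close>. One point is chosen
  instead from each non-empty trace on \<open>S\<close> of a ball of a countable base.\<close>

lemma dense_subset:
  assumes "S \<subseteq> pm_points X"
  shows "\<exists>C. countable C \<and> C \<subseteq> S \<and> (\<forall>x\<in>S. \<forall>e>0. \<exists>c\<in>C. pm_dist X x c < e)"
proof -
  obtain q where q: "dense_seq q" using dense_seq_exists by blast
  define B where "B = (\<lambda>(n, k). S \<inter> met.mball (q n) (1 / Suc k))"
  define C where "C = (\<lambda>i. SOME x. x \<in> B i) ` {i. B i \<noteq> {}}"
  have "(SOME x. x \<in> B i) \<in> B i" if "B i \<noteq> {}" for i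
    using that by (simp add: some_in_eq)
  moreover have "B i \<subseteq> S" for i by (auto simp: B_def split: prod.splits)
  ultimately have "C \<subseteq> S" unfolding C_def by blast
  moreover have "\<exists>c\<in>C. pm_dist X x c < e" if x: "x \<in> S" and e: "e > 0" for x e
  proof -
    obtain k where k: "1 / Suc k < e / 2" using e by (metis half_gt_zero nat_approx_posE)
    obtain n where n: "pm_dist X (q n) x < 1 / Suc k"
      using q x assms unfolding dense_seq_def
      by (metis of_nat_0_less_iff zero_less_Suc zero_less_divide_1_iff subsetD)
    have qn: "q n \<in> pm_points X" using q by (simp add: dense_seq_def)
    have "x \<in> B (n, k)" using n x assms qn by (auto simp: B_def)
    then have "B (n, k) \<noteq> {}" by blast
    then obtain c where c: "c \<in> C" "c \<in> B (n, k)"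
      unfolding C_def using some_in_eq by blast
    have "pm_dist X x c \<le> pm_dist X x (q n) + pm_dist X (q n) c"
      using x c qn assms by (intro met.triangle) (auto simp: B_def)
    then show ?thesis using c n k by (intro bexI[of _ c]) (auto simp: B_def met.commute)
  qed
  moreover have "countable C" by (simp add: C_def)
  ultimately show ?thesis by blast
qed

lemma pm_space_restrict: "pm_space (pm_restrict X)"
proof -
  obtain C where C: "countable C" "C \<subseteq> pm_support X"
      "\<forall>x\<in>pm_support X. \<forall>e>0. \<exists>c\<in>C. pm_dist X x c < e"
    using dense_subset[OF support_subset] by blast
  show ?thesis
  proof (rule pm_spaceI[of _ C])
    interpret sub: Submetric "pm_points X" "pm_dist X" "pm_support X"
      by unfold_locales (rule support_subset)
    show "mcomplete_of (fst (pm_restrict X))"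
      using sub.closedin_mcomplete_imp_mcomplete closedin_support mcomplete
      by (simp add: mcomplete_of_def points_restrict dist_restrict topology_eq)
    have "{U. openin (pm_topology (pm_restrict X)) U} = (\<inter>) (pm_support X) ` {U. openin (pm_topology X) U}"
      by (auto simp: topology_restrict openin_subtopology)
    moreover have "sigma_sets (pm_support X) ((\<inter>) (pm_support X) ` {U. openin (pm_topology X) U}) =
        (\<inter>) (pm_support X) ` sets (pm_measure X)"
      using support_sets support_subset unfolding sets_eq by (intro sigma_sets_Int[symmetric])
    ultimately show "sets (pm_measure (pm_restrict X)) =
        sigma_sets (pm_points (pm_restrict X)) {U. openin (pm_topology (pm_restrict X)) U}"
      by (simp add: measure_restrict sets_restrict_space points_restrict)
    show "prob_space (pm_measure (pm_restrict X))"
      unfolding measure_restrict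
      using prob_support support_sets by (intro prob_spaceI)
        (simp add: emeasure_restrict_space space_restrict_space emeasure_eq_measure
          Int_absorb2 support_subset space_eq)
  qed (use C support_subset in \<open>auto simp: points_restrict dist_restrict measure_restrict space_restrict_space space_eq\<close>)
qed

lemma support_restrict: "pm_support (pm_restrict X) = pm_points (pm_restrict X)"
proof -
  have "0 < measure (pm_measure (pm_restrict X)) U"
    if U: "openin (pm_topology (pm_restrict X)) U" "x \<in> U" for x U
  proof -
    obtain T where T: "openin (pm_topology X) T" "U = T \<inter> pm_support X"
      using U(1) by (auto simp: topology_restrict openin_subtopology)
    have "measure (pm_measure (pm_restrict X)) U = prob U"
      using T support_sets space_eq support_subset
      by (simp add: measure_restrict measure_restrict_space Int_absorb2)
    also have "\<dots> = prob T"
      using emeasure_Int_support[OF open_sets[OF T(1)]] T(2) by (simp add: measure_def)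
    finally show ?thesis using T U(2) by (simp add: pm_support_def)
  qed
  then show ?thesis by (auto simp: pm_support_def)
qed

lemma iso_restrict: "(X, pm_restrict X) \<in> pm_iso"
proof -
  have "distr (restrict_space (pm_measure X) (pm_support X)) (pm_measure (pm_restrict X)) id = pm_measure (pm_restrict X)"
    unfolding measure_restrict by (simp add: id_def distr_id)
  then have "id ` pm_support X = pm_support (pm_restrict X) \<and>
      (\<forall>x\<in>pm_support X. \<forall>y\<in>pm_support X. pm_dist (pm_restrict X) (id x) (id y) = pm_dist X x y) \<and>
      distr (restrict_space (pm_measure X) (pm_support X)) (pm_measure (pm_restrict X)) id = pm_measure (pm_restrict X)"
    by (simp add: support_restrict points_restrict dist_restrict)
  then show ?thesis
    unfolding pm_iso_def using pm_space pm_space_restrict by blast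
qed

lemma iso_rep: "(X, pm_rep (pm_iso `` {X})) \<in> pm_iso"
    and support_rep: "pm_support (pm_rep (pm_iso `` {X})) = pm_points (pm_rep (pm_iso `` {X}))"
proof -
  have "\<exists>x. x \<in> pm_iso `` {X} \<and> pm_support x = pm_points x"
    using iso_restrict support_restrict by blast
  then have "pm_rep (pm_iso `` {X}) \<in> pm_iso `` {X} \<and>
      pm_support (pm_rep (pm_iso `` {X})) = pm_points (pm_rep (pm_iso `` {X}))"
    unfolding pm_rep_def by (rule someI_ex)
  then show "(X, pm_rep (pm_iso `` {X})) \<in> pm_iso"
    "pm_support (pm_rep (pm_iso `` {X})) = pm_points (pm_rep (pm_iso `` {X}))"
    by blast+
qed

lemma class_in: "pm_iso `` {X} \<in> pm_classes"
  unfolding pm_classes_def by (rule quotientI) (simp add: pm_space)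

end

lemma pm_classesE:
  assumes "X \<in> pm_classes"
  obtains x where "pm_space x" "X = pm_iso `` {x}"
proof -
  have "X \<in> {x. pm_space x} // pm_iso" using assms by (simp only: pm_classes_def)
  then show thesis by (rule quotientE) (rule that, simp_all only: mem_Collect_eq)
qed

lemma pm_space_rep:
  assumes "X \<in> pm_classes"
  shows "pm_space (pm_rep X)"
proof -
  obtain x where x: "pm_space x" "X = pm_iso `` {x}" using assms by (rule pm_classesE)
  interpret pm x by standard fact
  show ?thesis using iso_rep x by (simp add: pm_iso_def)
qed

text \<open>The class only provides an isometry between the supports. Extended by a constant off the
  support, a null set, it becomes \<open>\<phi>\<close>, which is isometric on the support only. Its
  inverse \<open>\<psi>\<close> is isometric everywhere, since the representative has full
  support.\<close>

lemma rep_maps: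
  assumes "pm_space X"
  defines "R \<equiv> pm_rep (pm_iso `` {X})"
  obtains \<phi> \<psi> where
    "\<phi> \<in> measurable (pm_measure X) (pm_measure R)" "distr (pm_measure X) (pm_measure R) \<phi> = pm_measure R"
    "\<And>x y. x \<in> pm_support X \<Longrightarrow> y \<in> pm_support X \<Longrightarrow> pm_dist R (\<phi> x) (\<phi> y) = pm_dist X x y"
    "\<psi> \<in> measurable (pm_measure R) (pm_measure X)" "distr (pm_measure R) (pm_measure X) \<psi> = pm_measure X"
    "\<psi> \<in> pm_points R \<rightarrow> pm_support X"
    "\<And>x y. x \<in> pm_points R \<Longrightarrow> y \<in> pm_points R \<Longrightarrow> pm_dist X (\<psi> x) (\<psi> y) = pm_dist R x y"
proof -
  interpret X: pm X by (rule pm.intro) fact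
  let ?S = "pm_support X" and ?XS = "restrict_space (pm_measure X) (pm_support X)"
  have supp: "pm_support R = pm_points R" using X.support_rep by (simp add: R_def)
  have "(X, R) \<in> pm_iso" using X.iso_rep by (simp add: R_def)
  then obtain \<phi>0 where \<phi>0: "\<phi>0 ` ?S = pm_points R"
      "\<And>x y. x \<in> ?S \<Longrightarrow> y \<in> ?S \<Longrightarrow> pm_dist R (\<phi>0 x) (\<phi>0 y) = pm_dist X x y"
      "distr ?XS (pm_measure R) \<phi>0 = pm_measure R" and R: "pm_space R"
    unfolding pm_iso_def mem_Collect_eq prod.case supp by blast
  interpret R: pm R by standard fact
  interpret Y: pm "pm_restrict X" by standard (rule X.pm_space_restrict)
  have m0: "\<phi>0 \<in> measurable ?XS (pm_measure R)"
    using lipschitz_measurable[OF Y.pm_space R, of \<phi>0] \<phi>0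
    by (auto simp: X.points_restrict X.dist_restrict X.measure_restrict)
  have inj: "inj_on \<phi>0 ?S"
  proof (rule inj_onI)
    fix x y assume "x \<in> ?S" "y \<in> ?S" "\<phi>0 x = \<phi>0 y"
    moreover from this have "\<phi>0 x \<in> pm_points R" "x \<in> pm_points X" "y \<in> pm_points X"
      using \<phi>0(1) X.support_subset by auto
    ultimately show "x = y" using \<phi>0(2)[of x y] by simp
  qed
  obtain r0 where r0: "r0 \<in> pm_points R" using R.points_nonempty by blast
  define \<phi> where "\<phi> x = (if x \<in> ?S then \<phi>0 x else r0)" for x
  define \<psi> where "\<psi> = inv_into ?S \<phi>0"
  have \<psi>_in: "\<psi> x \<in> ?S" "\<phi>0 (\<psi> x) = x" if "x \<in> pm_points R" for x
    using that \<phi>0(1) unfolding \<psi>_def by (auto simp: inv_into_into f_inv_into_f)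
  have \<psi>_iso: "pm_dist X (\<psi> x) (\<psi> y) = pm_dist R x y" if "x \<in> pm_points R" "y \<in> pm_points R" for x y
    using \<psi>_in[OF that(1)] \<psi>_in[OF that(2)] \<phi>0(2) by metis
  have \<psi>_meas: "\<psi> \<in> measurable (pm_measure R) (pm_measure X)"
    using \<psi>_in \<psi>_iso X.support_subset by (intro lipschitz_measurable R \<open>pm_space X\<close>) auto
  have \<phi>_meas: "\<phi> \<in> measurable (pm_measure X) (pm_measure R)"
    unfolding \<phi>_def using X.support_sets m0 r0 R.space_eq
    by (intro measurable_If_restrict_space_iff[THEN iffD2] conjI) auto
  have XSset: "A \<inter> ?S \<in> sets ?XS" if "A \<in> sets (pm_measure X)" for A
    using that by (auto simp: sets_restrict_space)
  have \<phi>_distr: "distr (pm_measure X) (pm_measure R) \<phi> = pm_measure R"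
  proof (rule measure_eqI)
    fix A assume "A \<in> sets (distr (pm_measure X) (pm_measure R) \<phi>)"
    then have A: "A \<in> sets (pm_measure R)" by simp
    have "emeasure (distr (pm_measure X) (pm_measure R) \<phi>) A = emeasure (pm_measure X) (\<phi> -` A \<inter> space (pm_measure X))"
      by (rule emeasure_distr[OF \<phi>_meas A])
    also have "\<dots> = emeasure (pm_measure X) (\<phi> -` A \<inter> space (pm_measure X) \<inter> ?S)"
      by (rule X.emeasure_Int_support[symmetric]) (rule measurable_sets[OF \<phi>_meas A])
    also have "\<phi> -` A \<inter> space (pm_measure X) \<inter> ?S = \<phi>0 -` A \<inter> space ?XS"
      by (auto simp: \<phi>_def space_restrict_space)
    also have "emeasure (pm_measure X) \<dots> = emeasure ?XS \<dots>"
      using X.support_sets by (intro emeasure_restrict_space[symmetric]) (auto simp: space_restrict_space)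
    also have "\<dots> = emeasure (distr ?XS (pm_measure R) \<phi>0) A"
      by (rule emeasure_distr[OF m0 A, symmetric])
    finally show "emeasure (distr (pm_measure X) (pm_measure R) \<phi>) A = emeasure (pm_measure R) A"
      by (simp add: \<phi>0(3))
  qed simp
  have \<psi>_distr: "distr (pm_measure R) (pm_measure X) \<psi> = pm_measure X"
  proof (rule measure_eqI)
    fix A assume "A \<in> sets (distr (pm_measure R) (pm_measure X) \<psi>)"
    then have A: "A \<in> sets (pm_measure X)" by simp
    have 1: "\<psi> -` A \<inter> space (pm_measure R) \<in> sets (pm_measure R)"
      by (rule measurable_sets[OF \<psi>_meas A])
    have "emeasure (distr (pm_measure R) (pm_measure X) \<psi>) A =
        emeasure (distr ?XS (pm_measure R) \<phi>0) (\<psi> -` A \<inter> space (pm_measure R))"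
      unfolding \<phi>0(3) by (rule emeasure_distr[OF \<psi>_meas A])
    also have "\<dots> = emeasure ?XS (\<phi>0 -` (\<psi> -` A \<inter> space (pm_measure R)) \<inter> space ?XS)"
      by (rule emeasure_distr[OF m0 1])
    also have "\<phi>0 -` (\<psi> -` A \<inter> space (pm_measure R)) \<inter> space ?XS = A \<inter> ?S"
      using inj \<phi>0(1) X.support_subset
      by (auto simp: \<psi>_def space_restrict_space R.space_eq X.space_eq)
    also have "emeasure ?XS (A \<inter> ?S) = emeasure (pm_measure X) (A \<inter> ?S)"
      using X.support_sets by (intro emeasure_restrict_space) auto
    also have "\<dots> = emeasure (pm_measure X) A" by (rule X.emeasure_Int_support[OF A])
    finally show "emeasure (distr (pm_measure R) (pm_measure X) \<psi>) A = emeasure (pm_measure X) A" .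
  qed simp
  have \<phi>_iso: "pm_dist R (\<phi> x) (\<phi> y) = pm_dist X x y" if "x \<in> ?S" "y \<in> ?S" for x y
    using \<phi>0(2) that by (simp add: \<phi>_def)
  show thesis
    by (rule that[of \<phi> \<psi>])
      (use \<phi>_meas \<phi>_distr \<psi>_meas \<psi>_distr \<psi>_in \<psi>_iso \<phi>_iso in auto)
qed


section \<open>Parameters\<close>

abbreviation unit_measure :: "real measure" where
  "unit_measure \<equiv> restrict_space lborel {0..1}"

lemma sets_unit_measure: "A \<in> sets unit_measure \<longleftrightarrow> A \<in> sets borel \<and> A \<subseteq> {0..1}"
  by (auto simp: sets_restrict_space_iff)

lemma space_unit_measure: "space unit_measure = {0..1}"
  by (simp add: space_restrict_space)

lemma emeasure_unit_measure: "A \<subseteq> {0..1} \<Longrightarrow> emeasure unit_measure A = emeasure lborel A"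
  by (simp add: emeasure_restrict_space)

lemma measure_unit_measure: "A \<subseteq> {0..1} \<Longrightarrow> measure unit_measure A = measure lborel A"
  by (simp add: measure_restrict_space)

lemma prob_space_unit_measure: "prob_space unit_measure"
  by (rule prob_spaceI) (simp add: space_unit_measure emeasure_unit_measure)

interpretation unit: prob_space unit_measure
  by (rule prob_space_unit_measure)

text \<open>Base 4 leaves room to avoid the ambiguity of binary expansions.\<close>

definition code4 :: "(nat \<Rightarrow> bool) \<Rightarrow> real" where
  "code4 b = (\<Sum>j. of_bool (b j) / 4 ^ Suc j)"

lemma code4_sums: "(\<lambda>j. of_bool (b j) / 4 ^ Suc j :: real) sums code4 b"
  unfolding code4_def
proof (rule summable_sums, rule summable_comparison_test[OF exI, of 0])
  show "\<forall>n\<ge>0. norm (of_bool (b n) / 4 ^ Suc n :: real) \<le> (1 / 4) ^ n"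
    by (auto simp: power_divide field_simps)
qed (simp add: summable_geometric)

lemma code4_bounds: "0 \<le> code4 b" "code4 b \<le> 1 / 3"
proof -
  have geo: "(\<lambda>j. (1 / 4) * (1 / 4) ^ j :: real) sums (1 / 4 * (1 / (1 - 1 / 4)))"
    by (intro sums_mult geometric_sums) simp
  show "0 \<le> code4 b" by (rule sums_le[OF _ sums_zero code4_sums]) simp
  have "code4 b \<le> 1 / 4 * (1 / (1 - 1 / 4))"
    by (rule sums_le[OF _ code4_sums geo]) (simp add: power_divide)
  then show "code4 b \<le> 1 / 3" by simp
qed

lemma code4_Suc: "4 * code4 b = of_bool (b 0) + code4 (b \<circ> Suc)"
proof -
  have scaled: "(\<lambda>j. 4 * (of_bool (b (Suc j)) / 4 ^ Suc (Suc j)) :: real) sums (4 * (code4 b - of_bool (b 0) / 4 ^ Suc 0))"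
    by (intro sums_mult, subst sums_Suc_iff) (use code4_sums[of b] in \<open>simp only: diff_add_cancel\<close>)
  have "(\<lambda>j. of_bool ((b \<circ> Suc) j) / 4 ^ Suc j :: real) sums (4 * code4 b - of_bool (b 0))"
  proof -
    have "(\<lambda>j. 4 * (of_bool (b (Suc j)) / 4 ^ Suc (Suc j)) :: real) = (\<lambda>j. of_bool ((b \<circ> Suc) j) / 4 ^ Suc j)"
      by (rule ext) simp
    moreover have "4 * (code4 b - of_bool (b 0) / 4 ^ Suc 0) = 4 * code4 b - of_bool (b 0)"
      by simp
    ultimately show ?thesis using scaled by (simp only:)
  qed
  then show ?thesis using sums_unique2[OF _ code4_sums] by fastforce
qed

text \<open>The digits after position \<open>j\<close> contribute at most 1/3, so the floor cuts the
  expansion exactly there. The earlier digits contribute multiples of 4, and digit \<open>j\<close>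
  alone decides the parity.\<close>

lemma odd_floor_code4: "odd \<lfloor>4 ^ Suc j * code4 b\<rfloor> \<longleftrightarrow> b j"
proof (induction j arbitrary: b)
  case 0
  have "\<lfloor>4 * code4 b\<rfloor> = of_bool (b 0)"
    using code4_bounds[of "b \<circ> Suc"] unfolding code4_Suc by (intro floor_unique) auto
  then show ?case by simp
next
  case (Suc j)
  have "4 ^ Suc (Suc j) * code4 b = 4 ^ Suc j * code4 (b \<circ> Suc) + of_int (4 ^ Suc j * of_bool (b 0))"
  proof -
    have "4 ^ Suc (Suc j) * code4 b = 4 ^ Suc j * (4 * code4 b)" by simp
    then show ?thesis unfolding code4_Suc by (simp add: distrib_left)
  qed
  then have "\<lfloor>4 ^ Suc (Suc j) * code4 b\<rfloor> = \<lfloor>4 ^ Suc j * code4 (b \<circ> Suc)\<rfloor> + 4 ^ Suc j * of_bool (b 0)"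
    by (simp only: floor_add_int[symmetric])
  then show ?case using Suc[of "b \<circ> Suc"] by (simp add: comp_def)
qed

context pm
begin

text \<open>Points within \<open>1 / Suc k\<close> and \<open>1 / Suc l\<close> of a common point
  satisfy this bound when \<open>k \<le> l\<close>. An explicit rate turns convergence into
  countably many inequalities, hence into a Borel condition in
  \<open>borel_code_exists\<close>.\<close>

lemma cauchy_limit:
  assumes "\<And>k. s k \<in> pm_points X" "\<And>k l. k \<le> l \<Longrightarrow> pm_dist X (s k) (s l) \<le> 2 / Suc k"
  shows "\<exists>z\<in>pm_points X. (\<lambda>k. pm_dist X (s k) z) \<longlonglongrightarrow> 0"
proof -
  have "met.MCauchy s"
    unfolding met.MCauchy_def
  proof (intro conjI allI impI)
    fix e :: real assume e: "e > 0"
    then obtain N where N: "1 / Suc N < e / 4" by (metis nat_approx_posE zero_less_divide_iff zero_less_numeral)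
    have "pm_dist X (s n) (s n') < e" if "N \<le> n" "N \<le> n'" for n n'
    proof -
      have "pm_dist X (s n) (s n') \<le> pm_dist X (s n) (s N) + pm_dist X (s N) (s n')"
        by (intro met.triangle assms)
      also have "\<dots> \<le> 2 / Suc N + 2 / Suc N"
        using assms(2)[of N n] assms(2)[of N n'] that by (intro add_mono) (auto simp: met.commute)
      finally show ?thesis using N by simp
    qed
    then show "\<exists>N. \<forall>n n'. N \<le> n \<longrightarrow> N \<le> n' \<longrightarrow> pm_dist X (s n) (s n') < e" by blast
  qed (use assms in auto)
  then show ?thesis
    using mcomplete unfolding met.mcomplete_def met.limitin_metric_dist_null by blast
qed

lemma dist_tendsto:
  assumes "\<And>k. s k \<in> pm_points X" "z \<in> pm_points X" "w \<in> pm_points X" "(\<lambda>k. pm_dist X (s k) z) \<longlonglongrightarrow> 0"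
  shows "(\<lambda>k. pm_dist X (s k) w) \<longlonglongrightarrow> pm_dist X z w"
proof (rule LIM_zero_cancel, rule Lim_null_comparison[OF _ assms(4)], intro always_eventually allI)
  fix k
  show "norm (pm_dist X (s k) w - pm_dist X z w) \<le> pm_dist X (s k) z"
    using met.mdist_reverse_triangle[of "s k" w z] assms by (simp add: met.commute)
qed

text \<open>
  A Borel map \<open>code\<close> into the reals with a Borel left inverse \<open>decode\<close> reduces the existence of
  parameters to the quantile function of a distribution on the line. The digits of \<open>code x\<close> tell which
  balls around the points of a dense sequence contain \<open>x\<close>.
\<close>

lemma borel_code_exists:
  "\<exists>(code :: real \<Rightarrow> real) decode. code \<in> borel_measurable (pm_measure X) \<and> decode \<in> measurable borel (pm_measure X) \<and>
     (\<forall>x\<in>pm_points X. decode (code x) = x)"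
proof -
  obtain q where q: "dense_seq q" using dense_seq_exists by blast
  then have qX: "q n \<in> pm_points X" for n by (simp add: dense_seq_def)
  define B where "B j = (case prod_decode j of (n, k) \<Rightarrow> met.mball (q n) (1 / Suc k))" for j
  define code where "code x = code4 (\<lambda>j. x \<in> B j)" for x
  define digit where "digit n k y = odd \<lfloor>4 ^ Suc (prod_encode (n, k)) * y\<rfloor>" for n k and y :: real
  \<comment> \<open>For \<open>y = code x\<close> this is the first point of the dense sequence
    within \<open>1 / Suc k\<close> of \<open>x\<close>.\<close>
  define idx where "idx k y = (LEAST n. digit n k y)" for k y
  \<comment> \<open>A real that is no code need not yield convergent centres; where this test fails,
    \<open>decode\<close> takes the default value \<open>q 0\<close>.\<close>
  define fast where "fast y \<longleftrightarrow> (\<forall>k l. k \<le> l \<longrightarrow> pm_dist X (q (idx k y)) (q (idx l y)) \<le> 2 / Suc k)" for y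
  define lim_of where "lim_of y = (SOME z. z \<in> pm_points X \<and> (\<lambda>k. pm_dist X (q (idx k y)) z) \<longlonglongrightarrow> 0)" for y
  define decode where "decode y = (if fast y then lim_of y else q 0)" for y
  have lim_of: "lim_of y \<in> pm_points X" "(\<lambda>k. pm_dist X (q (idx k y)) (lim_of y)) \<longlonglongrightarrow> 0" if "fast y" for y
  proof -
    have "\<exists>z. z \<in> pm_points X \<and> (\<lambda>k. pm_dist X (q (idx k y)) z) \<longlonglongrightarrow> 0"
      using cauchy_limit[of "\<lambda>k. q (idx k y)"] that qX unfolding fast_def by blast
    from someI_ex[OF this] show "lim_of y \<in> pm_points X" "(\<lambda>k. pm_dist X (q (idx k y)) (lim_of y)) \<longlonglongrightarrow> 0"
      unfolding lim_of_def by blast+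
  qed
  have [measurable]: "B j \<in> sets (pm_measure X)" for j
    by (simp add: B_def ball_sets split: prod.split)
  have code: "code \<in> borel_measurable (pm_measure X)"
    unfolding code_def code4_def by measurable
  have [measurable]: "Measurable.pred borel (digit n k)" for n k
    unfolding digit_def by measurable
  have idx[measurable]: "idx k \<in> measurable borel (count_space UNIV)" for k
    unfolding idx_def by measurable
  have [measurable]: "(\<lambda>y. pm_dist X (q (idx k y)) (q (idx l y))) \<in> borel_measurable borel" for k l
  proof -
    have "(\<lambda>y. (idx k y, idx l y)) \<in> measurable borel (count_space UNIV)"
      using measurable_Pair[OF idx[of k] idx[of l]] by (simp add: pair_measure_countable)
    then have "(\<lambda>p. pm_dist X (q (fst p)) (q (snd p))) \<circ> (\<lambda>y. (idx k y, idx l y)) \<in> borel_measurable borel"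
      by (rule measurable_comp) simp
    then show ?thesis by (simp add: comp_def)
  qed
  have [measurable]: "Measurable.pred borel fast"
    unfolding fast_def by measurable
  have decode: "decode \<in> measurable borel (pm_measure X)"
  proof (rule measurableI_dist)
    fix z assume z: "z \<in> pm_points X"
    have "pm_dist X (decode y) z = (if fast y then lim (\<lambda>k. pm_dist X (q (idx k y)) z) else pm_dist X (q 0) z)" for y
      using limI[OF dist_tendsto[OF qX lim_of(1) z lim_of(2)]] by (simp add: decode_def)
    moreover have [measurable]: "(\<lambda>y. pm_dist X (q (idx k y)) z) \<in> borel_measurable borel" for k
      using measurable_comp[OF idx[of k], of "\<lambda>n. pm_dist X (q n) z" borel] by (simp add: comp_def)
    ultimately show "(\<lambda>y. pm_dist X (decode y) z) \<in> borel_measurable borel" by simp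
  qed (use lim_of qX in \<open>auto simp: decode_def\<close>)
  have "decode (code x) = x" if x: "x \<in> pm_points X" for x
  proof -
    have digit: "digit n k (code x) \<longleftrightarrow> pm_dist X (q n) x < 1 / Suc k" for n k
      unfolding digit_def code_def odd_floor_code4 using x qX by (simp add: B_def)
    have near: "pm_dist X (q (idx k (code x))) x < 1 / Suc k" for k
    proof -
      have "\<exists>n. pm_dist X (q n) x < 1 / Suc k"
        using q x unfolding dense_seq_def by (metis of_nat_0_less_iff zero_less_Suc zero_less_divide_1_iff)
      then show ?thesis unfolding idx_def digit by (rule LeastI_ex)
    qed
    have "pm_dist X (q (idx k (code x))) (q (idx l (code x))) \<le> 2 / Suc k" if "k \<le> l" for k l
    proof -
      have "pm_dist X (q (idx k (code x))) (q (idx l (code x)))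
          \<le> pm_dist X (q (idx k (code x))) x + pm_dist X x (q (idx l (code x)))"
        by (intro met.triangle qX x)
      also have "\<dots> \<le> 1 / Suc k + 1 / Suc l"
        using near[of k] near[of l] by (simp add: met.commute)
      also have "1 / Suc l \<le> 1 / Suc k" using that by (simp add: frac_le)
      finally show ?thesis by simp
    qed
    then have fast: "fast (code x)" by (simp add: fast_def)
    have "(\<lambda>k. pm_dist X (q (idx k (code x))) x) \<longlonglongrightarrow> 0"
    proof (rule tendsto_sandwich[OF _ _ tendsto_const LIMSEQ_inverse_real_of_nat])
      show "\<forall>\<^sub>F k in sequentially. pm_dist X (q (idx k (code x))) x \<le> inverse (real (Suc k))"
        using near by (intro always_eventually allI) (simp add: inverse_eq_divide less_imp_le)
    qed simp
    then have "pm_dist X (lim_of (code x)) x = 0"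
      using dist_tendsto[OF qX lim_of(1)[OF fast] x lim_of(2)[OF fast]] LIMSEQ_unique by blast
    then show ?thesis using lim_of(1)[OF fast] x fast by (simp add: decode_def)
  qed
  then show ?thesis using code decode by blast
qed

lemma parameter_exists: "\<exists>a. pm_parameter X a"
proof -
  obtain code :: "real \<Rightarrow> real" and decode where code[measurable]: "code \<in> borel_measurable (pm_measure X)"
    and decode[measurable]: "decode \<in> measurable borel (pm_measure X)"
    and inv: "\<And>x. x \<in> pm_points X \<Longrightarrow> decode (code x) = x"
    using borel_code_exists by blast
  define D where "D = distr (pm_measure X) borel code"
  interpret D: real_distribution D
    unfolding D_def real_distribution_def real_distribution_axioms_def
    by (simp add: prob_space_distr)
  interpret D: cdf_distribution D ..
  obtain x0 where x0: "x0 \<in> pm_points X" using points_nonempty by blast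
  \<comment> \<open>\<open>D.I\<close> is the quantile function of \<open>D\<close>, whose
    push-forward property concerns the open interval. The two endpoints form a null set and receive
    a default value.\<close>
  define a where "a t = (if t \<in> {0<..<1} then decode (D.I t) else x0)" for t
  let ?O = "restrict_space lborel {0<..<1::real}"
  have I: "D.I \<in> measurable ?O borel"
    using D.measurable_CI by (simp cong: measurable_cong_sets)
  have a: "a \<in> measurable unit_measure (pm_measure X)"
  proof -
    have "(\<lambda>t. decode (D.I t)) \<in> measurable (restrict_space unit_measure {0<..<1}) (pm_measure X)"
      using measurable_comp[OF I decode] by (simp add: restrict_restrict_space comp_def Int_absorb1 greaterThanLessThan_subseteq_atLeastAtMost_iff)
    moreover have "(\<lambda>t. x0) \<in> measurable (restrict_space unit_measure {t. t \<notin> {0<..<1}}) (pm_measure X)"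
      by (rule measurable_const) (simp add: space_eq x0)
    moreover have "{t \<in> space unit_measure. t \<in> {0<..<1}} \<in> sets unit_measure"
    proof -
      have "{t \<in> space unit_measure. t \<in> {0<..<1}} = {0<..<1}"
        unfolding space_unit_measure by force
      moreover have "{0<..<1::real} \<in> sets unit_measure"
        unfolding sets_unit_measure by (intro conjI borel_open open_greaterThanLessThan) force
      ultimately show ?thesis by (simp only:)
    qed
    ultimately show ?thesis
      unfolding a_def by (subst measurable_If_restrict_space_iff) (simp_all only: Collect_mem_eq simp_thms)
  qed
  have "distr unit_measure (pm_measure X) a = pm_measure X"
  proof (rule measure_eqI)
    fix A assume "A \<in> sets (distr unit_measure (pm_measure X) a)"
    then have A[measurable]: "A \<in> sets (pm_measure X)" by simp
    have dA: "decode -` A \<in> sets borel" using measurable_sets[OF decode A] by simp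
    have aA: "a -` A \<inter> {0..1} \<in> sets borel"
      using measurable_sets[OF a A] by (simp add: space_unit_measure sets_unit_measure)
    have "emeasure (distr unit_measure (pm_measure X) a) A = emeasure lborel (a -` A \<inter> {0..1})"
      using emeasure_distr[OF a A] by (simp add: space_unit_measure emeasure_unit_measure)
    also have "\<dots> = emeasure lborel (a -` A \<inter> {0..1} \<inter> {0<..<1})"
    proof (rule emeasure_eq_AE)
      have "AE t in lborel. t \<noteq> 0 \<and> t \<noteq> (1::real)"
        by (intro AE_conjI AE_lborel_singleton)
      then show "AE t in lborel. (t \<in> a -` A \<inter> {0..1}) = (t \<in> a -` A \<inter> {0..1} \<inter> {0<..<1})"
        by eventually_elim auto
    qed (use aA in auto)
    also have "a -` A \<inter> {0..1} \<inter> {0<..<1} = D.I -` (decode -` A) \<inter> space ?O"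
      by (auto simp: a_def space_restrict_space)
    also have "emeasure lborel \<dots> = emeasure ?O \<dots>"
      by (subst emeasure_restrict_space) (auto simp: space_restrict_space)
    also have "\<dots> = emeasure (distr ?O borel D.I) (decode -` A)"
      by (rule emeasure_distr[OF I dA, symmetric])
    also have "\<dots> = emeasure (pm_measure X) (code -` (decode -` A) \<inter> space (pm_measure X))"
      unfolding D.distr_I_eq_M using emeasure_distr[OF code dA] by (simp add: D_def)
    also have "code -` (decode -` A) \<inter> space (pm_measure X) = A"
      using inv sets.sets_into_space[OF A] by (auto simp: space_eq)
    finally show "emeasure (distr unit_measure (pm_measure X) a) A = emeasure (pm_measure X) A" .
  qed simp
  then show ?thesis using a by (auto simp: pm_parameter_def)
qed

end


section \<open>Working with non-representatives\<close>

lemma map_to_rep: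
  assumes "pm_space X"
  defines "R \<equiv> pm_rep (pm_iso `` {X})"
  obtains \<phi> where
    "\<phi> \<in> measurable (pm_measure X) (pm_measure R)" "distr (pm_measure X) (pm_measure R) \<phi> = pm_measure R"
    "\<And>x y. x \<in> pm_support X \<Longrightarrow> y \<in> pm_support X \<Longrightarrow> pm_dist R (\<phi> x) (\<phi> y) = pm_dist X x y"
  by (rule rep_maps[OF assms(1), folded R_def]) (rule that)

lemma map_from_rep:
  assumes "pm_space X"
  defines "R \<equiv> pm_rep (pm_iso `` {X})"
  obtains \<psi> where
    "\<psi> \<in> measurable (pm_measure R) (pm_measure X)" "distr (pm_measure R) (pm_measure X) \<psi> = pm_measure X"
    "\<psi> \<in> pm_points R \<rightarrow> pm_support X"
    "\<And>x y. x \<in> pm_points R \<Longrightarrow> y \<in> pm_points R \<Longrightarrow> pm_dist X (\<psi> x) (\<psi> y) = pm_dist R x y"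
  by (rule rep_maps[OF assms(1), folded R_def]) (rule that)

text \<open>The order refers to representatives, while constructed spaces seldom have full support.
  Precomposing with the isometric map out of the representative of \<open>z\<close> allows the
  Lipschitz map to live on \<open>z\<close> itself.\<close>

lemma lipschitz_le_class:
  assumes X: "X \<in> pm_classes" and z: "pm_space z"
    and g: "g \<in> pm_points z \<rightarrow> pm_points (pm_rep X)"
    and lip: "\<And>x y. x \<in> pm_points z \<Longrightarrow> y \<in> pm_points z \<Longrightarrow> pm_dist (pm_rep X) (g x) (g y) \<le> pm_dist z x y"
    and push: "distr (pm_measure z) (pm_measure (pm_rep X)) g = pm_measure (pm_rep X)"
  shows "lipschitz_le X (pm_iso `` {z})"
proof -
  let ?R = "pm_rep (pm_iso `` {z})"
  interpret z: pm z by (rule pm.intro) fact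
  obtain \<psi> where \<psi>: "\<psi> \<in> measurable (pm_measure ?R) (pm_measure z)"
      "distr (pm_measure ?R) (pm_measure z) \<psi> = pm_measure z" "\<psi> \<in> pm_points ?R \<rightarrow> pm_support z"
      "\<And>x y. x \<in> pm_points ?R \<Longrightarrow> y \<in> pm_points ?R \<Longrightarrow> pm_dist z (\<psi> x) (\<psi> y) = pm_dist ?R x y"
    using map_from_rep[OF z] by metis
  have \<psi>z: "\<psi> x \<in> pm_points z" if "x \<in> pm_points ?R" for x
    using \<psi>(3) that z.support_subset by blast
  have gm: "g \<in> measurable (pm_measure z) (pm_measure (pm_rep X))"
    using lipschitz_measurable[OF z pm_space_rep[OF X] g lip] .
  have "distr (pm_measure ?R) (pm_measure (pm_rep X)) (g \<circ> \<psi>) = pm_measure (pm_rep X)"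
    using distr_distr[OF gm \<psi>(1)] by (simp add: \<psi>(2) push)
  moreover have "g \<circ> \<psi> \<in> pm_points ?R \<rightarrow> pm_points (pm_rep X)"
    using \<psi>z g by fastforce
  moreover have "pm_dist (pm_rep X) ((g \<circ> \<psi>) x) ((g \<circ> \<psi>) y) \<le> pm_dist ?R x y"
    if "x \<in> pm_points ?R" "y \<in> pm_points ?R" for x y
    using lip[OF \<psi>z[OF that(1)] \<psi>z[OF that(2)]] \<psi>(4)[OF that] by simp
  ultimately show ?thesis unfolding lipschitz_le_def by blast
qed

lemma class_lipschitz_le:
  assumes "X \<in> pm_classes" and z: "pm_space z" and le: "lipschitz_le (pm_iso `` {z}) X"
  obtains g where "g \<in> measurable (pm_measure (pm_rep X)) (pm_measure z)"
    "distr (pm_measure (pm_rep X)) (pm_measure z) g = pm_measure z"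
    "\<And>x y. x \<in> pm_points (pm_rep X) \<Longrightarrow> y \<in> pm_points (pm_rep X) \<Longrightarrow>
       pm_dist z (g x) (g y) \<le> pm_dist (pm_rep X) x y"
proof -
  let ?R = "pm_rep (pm_iso `` {z})"
  interpret z: pm z by (rule pm.intro) fact
  obtain \<psi> where \<psi>: "\<psi> \<in> measurable (pm_measure ?R) (pm_measure z)"
      "distr (pm_measure ?R) (pm_measure z) \<psi> = pm_measure z" "\<psi> \<in> pm_points ?R \<rightarrow> pm_support z"
      "\<And>x y. x \<in> pm_points ?R \<Longrightarrow> y \<in> pm_points ?R \<Longrightarrow> pm_dist z (\<psi> x) (\<psi> y) = pm_dist ?R x y"
    using map_from_rep[OF z] by metis
  obtain h where h: "h \<in> pm_points (pm_rep X) \<rightarrow> pm_points ?R"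
      "\<And>x y. x \<in> pm_points (pm_rep X) \<Longrightarrow> y \<in> pm_points (pm_rep X) \<Longrightarrow> pm_dist ?R (h x) (h y) \<le> pm_dist (pm_rep X) x y"
      "distr (pm_measure (pm_rep X)) (pm_measure ?R) h = pm_measure ?R"
    using le unfolding lipschitz_le_def by blast
  have hm: "h \<in> measurable (pm_measure (pm_rep X)) (pm_measure ?R)"
    using lipschitz_measurable[OF pm_space_rep pm_space_rep h(1,2)] \<open>X \<in> pm_classes\<close> z.class_in by blast
  show thesis
  proof (rule that)
    show "\<psi> \<circ> h \<in> measurable (pm_measure (pm_rep X)) (pm_measure z)"
      using hm \<psi>(1) by (rule measurable_comp)
    show "distr (pm_measure (pm_rep X)) (pm_measure z) (\<psi> \<circ> h) = pm_measure z"
      using distr_distr[OF \<psi>(1) hm] by (simp add: \<psi>(2) h(3))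
    fix x y assume xy: "x \<in> pm_points (pm_rep X)" "y \<in> pm_points (pm_rep X)"
    then have "h x \<in> pm_points ?R" "h y \<in> pm_points ?R" using h(1) by auto
    then show "pm_dist z ((\<psi> \<circ> h) x) ((\<psi> \<circ> h) y) \<le> pm_dist (pm_rep X) x y"
      using \<psi>(4) h(2)[OF xy] by simp
  qed
qed

section \<open>Bounds for the box distance\<close>

definition box_witness :: "pm \<Rightarrow> pm \<Rightarrow> real \<Rightarrow> bool" where
  "box_witness x y \<epsilon> \<longleftrightarrow> \<epsilon> > 0 \<and>
     (\<exists>a b I\<^sub>0. pm_parameter x a \<and> pm_parameter y b \<and>
        I\<^sub>0 \<in> sets borel \<and> I\<^sub>0 \<subseteq> {0..1} \<and> measure lborel I\<^sub>0 \<ge> 1 - \<epsilon> \<and>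
        (\<forall>s\<in>I\<^sub>0. \<forall>t\<in>I\<^sub>0. \<bar>pm_dist x (a s) (a t) - pm_dist y (b s) (b t)\<bar> \<le> \<epsilon>))"

lemma box_dist_eq: "box_dist X Y = Inf {\<epsilon>. box_witness (pm_rep X) (pm_rep Y) \<epsilon>}"
  by (simp add: box_dist_def box_witness_def)

lemma box_dist_le: "box_witness (pm_rep X) (pm_rep Y) \<epsilon> \<Longrightarrow> box_dist X Y \<le> \<epsilon>"
  unfolding box_dist_eq by (intro cInf_lower bdd_belowI[of _ 0]) (auto simp: box_witness_def)

text \<open>The empty set is admissible as the set of good times, and parameters exist. So the
  infimum defining \<open>box_dist\<close> never runs over an empty set.\<close>

lemma box_witness_ge_1:
  assumes "pm_space x" "pm_space y" "\<epsilon> \<ge> 1"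
  shows "box_witness x y \<epsilon>"
proof -
  obtain a b where "pm_parameter x a" "pm_parameter y b"
    using assms pm.parameter_exists pm.intro by meson
  then show ?thesis
    using assms(3) unfolding box_witness_def by (intro conjI exI[of _ a] exI[of _ b] exI[of _ "{}"]) auto
qed

lemma box_dist_nonneg:
  assumes "X \<in> pm_classes" "Y \<in> pm_classes"
  shows "0 \<le> box_dist X Y"
  unfolding box_dist_eq
proof (rule cInf_greatest)
  show "{\<epsilon>. box_witness (pm_rep X) (pm_rep Y) \<epsilon>} \<noteq> {}"
    using box_witness_ge_1[OF pm_space_rep pm_space_rep, of X Y 1] assms by auto
qed (auto simp: box_witness_def)

lemma box_dist_less:
  assumes "X \<in> pm_classes" "Y \<in> pm_classes" "box_dist X Y < \<epsilon>"
  shows "box_witness (pm_rep X) (pm_rep Y) \<epsilon>"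
proof -
  have "{\<epsilon>. box_witness (pm_rep X) (pm_rep Y) \<epsilon>} \<noteq> {}"
    using box_witness_ge_1[OF pm_space_rep pm_space_rep, of X Y 1] assms by auto
  then obtain \<delta> where \<delta>: "box_witness (pm_rep X) (pm_rep Y) \<delta>" "\<delta> < \<epsilon>"
    using cInf_lessD[OF _ assms(3)[unfolded box_dist_eq]] by blast
  then obtain a b I where "pm_parameter (pm_rep X) a" "pm_parameter (pm_rep Y) b" "0 < \<delta>"
    "I \<in> sets borel" "I \<subseteq> {0..1}" "measure lborel I \<ge> 1 - \<delta>"
    "\<forall>s\<in>I. \<forall>t\<in>I. \<bar>pm_dist (pm_rep X) (a s) (a t) - pm_dist (pm_rep Y) (b s) (b t)\<bar> \<le> \<delta>"
    unfolding box_witness_def by blast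
  then show ?thesis
    unfolding box_witness_def using \<delta>(2)
    by (intro conjI exI[of _ a] exI[of _ b] exI[of _ I]) force+
qed

text \<open>The map into the representative is isometric only on the support of \<open>z\<close>.
  The good times are therefore cut down to those at which \<open>b\<close> lies in the support,
  which costs no measure.\<close>

lemma box_dist_class_le:
  assumes X: "X \<in> pm_classes" and z: "pm_space z" and w: "box_witness (pm_rep X) z \<epsilon>"
  shows "box_dist X (pm_iso `` {z}) \<le> \<epsilon>"
proof (rule box_dist_le)
  let ?R = "pm_rep (pm_iso `` {z})"
  interpret z: pm z by (rule pm.intro) fact
  obtain \<phi> where \<phi>: "\<phi> \<in> measurable (pm_measure z) (pm_measure ?R)"
      "distr (pm_measure z) (pm_measure ?R) \<phi> = pm_measure ?R"
      "\<And>x y. x \<in> pm_support z \<Longrightarrow> y \<in> pm_support z \<Longrightarrow> pm_dist ?R (\<phi> x) (\<phi> y) = pm_dist z x y"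
    using map_to_rep[OF z] by metis
  obtain a b I where ab: "pm_parameter (pm_rep X) a" "pm_parameter z b" and \<epsilon>: "\<epsilon> > 0"
    and I: "I \<in> sets borel" "I \<subseteq> {0..1}" "measure lborel I \<ge> 1 - \<epsilon>"
      "\<And>s t. s \<in> I \<Longrightarrow> t \<in> I \<Longrightarrow> \<bar>pm_dist (pm_rep X) (a s) (a t) - pm_dist z (b s) (b t)\<bar> \<le> \<epsilon>"
    using w unfolding box_witness_def by blast
  have bm: "b \<in> measurable unit_measure (pm_measure z)" "distr unit_measure (pm_measure z) b = pm_measure z"
    using ab(2) by (auto simp: pm_parameter_def)
  define S where "S = b -` pm_support z \<inter> {0..1}"
  have S: "S \<in> sets unit_measure"
    using measurable_sets[OF bm(1) z.support_sets] by (simp add: S_def space_unit_measure)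
  have "measure unit_measure S = 1"
    using measure_distr[OF bm(1) z.support_sets] z.prob_support
    by (simp add: bm(2) S_def space_unit_measure)
  then have "AE t in unit_measure. t \<in> S" by (rule unit.AE_prob_1)
  moreover have "I \<in> sets unit_measure" "I \<inter> S \<in> sets unit_measure"
    using I S by (auto simp: sets_unit_measure)
  ultimately have "measure unit_measure (I \<inter> S) = measure unit_measure I"
    by (intro measure_eq_AE) auto
  then have "measure lborel (I \<inter> S) \<ge> 1 - \<epsilon>"
    using I(2,3) by (subst (asm) (1 2) measure_unit_measure) auto
  moreover have "pm_parameter ?R (\<phi> \<circ> b)"
    unfolding pm_parameter_def using measurable_comp[OF bm(1) \<phi>(1)] distr_distr[OF \<phi>(1) bm(1)]
    by (simp add: bm(2) \<phi>(2))
  moreover have "I \<inter> S \<in> sets borel" "I \<inter> S \<subseteq> {0..1}" using I S by (auto simp: sets_unit_measure)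
  moreover have "\<bar>pm_dist (pm_rep X) (a s) (a t) - pm_dist ?R ((\<phi> \<circ> b) s) ((\<phi> \<circ> b) t)\<bar> \<le> \<epsilon>"
    if "s \<in> I \<inter> S" "t \<in> I \<inter> S" for s t
    using I(4)[of s t] that by (simp add: \<phi>(3) S_def)
  ultimately show "box_witness (pm_rep X) ?R \<epsilon>"
    unfolding box_witness_def using ab(1) \<epsilon> by blast
qed


section \<open>Atoms\<close>

text \<open>Domination of the sum of the weighted Dirac measures, tested on finite groups of atoms
  (see \<open>has_atoms_iff\<close>). The measure is taken of the image of \<open>J\<close>, so
  weights placed at the same point add up; this form passes to push-forwards and to limits, where
  atoms may merge.\<close>

definition has_atoms :: "(nat \<Rightarrow> real) \<Rightarrow> real measure \<Rightarrow> (nat \<Rightarrow> real) \<Rightarrow> bool" where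
  "has_atoms \<alpha> m f \<longleftrightarrow> range f \<subseteq> space m \<and> (\<forall>J. finite J \<longrightarrow> sum \<alpha> J \<le> measure m (f ` J))"

context pm
begin

lemma has_atoms_suminf_le:
  assumes nonneg: "\<And>i. 0 \<le> \<alpha> i" and summ: "summable \<alpha>"
    and at: "has_atoms \<alpha> (pm_measure X) f" and A: "A \<in> sets (pm_measure X)"
  shows "(\<Sum>i. \<alpha> i * of_bool (f i \<in> A)) \<le> prob A"
proof (rule suminf_le_const)
  show "summable (\<lambda>i. \<alpha> i * of_bool (f i \<in> A))"
    by (rule summable_comparison_test'[OF summ, of 0]) (auto simp: nonneg)
  fix n
  have "(\<Sum>i<n. \<alpha> i * of_bool (f i \<in> A)) = (\<Sum>i<n. if f i \<in> A then \<alpha> i else 0)"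
    by (intro sum.cong) auto
  also have "\<dots> = sum \<alpha> {i\<in>{..<n}. f i \<in> A}"
    by (rule sum.inter_filter[symmetric]) simp
  also have "\<dots> \<le> prob (f ` {i\<in>{..<n}. f i \<in> A})" using at by (simp add: has_atoms_def)
  also have "\<dots> \<le> prob A" using A by (intro finite_measure_mono) auto
  finally show "(\<Sum>i<n. \<alpha> i * of_bool (f i \<in> A)) \<le> prob A" .
qed

lemma has_atomsI_suminf:
  assumes nonneg: "\<And>i. 0 \<le> \<alpha> i" and summ: "summable \<alpha>" and f: "\<And>i. f i \<in> pm_points X"
    and ge: "\<And>A. A \<in> sets (pm_measure X) \<Longrightarrow> (\<Sum>i. \<alpha> i * of_bool (f i \<in> A)) \<le> prob A"
  shows "has_atoms \<alpha> (pm_measure X) f"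
  unfolding has_atoms_def
proof (intro conjI allI impI)
  show "range f \<subseteq> space (pm_measure X)" using f by (auto simp: space_eq)
  fix J :: "nat set" assume J: "finite J"
  have "sum \<alpha> J = (\<Sum>i\<in>J. \<alpha> i * of_bool (f i \<in> f ` J))" by (intro sum.cong) auto
  also have "\<dots> \<le> (\<Sum>i. \<alpha> i * of_bool (f i \<in> f ` J))"
  proof (rule sum_le_suminf[OF _ J])
    show "summable (\<lambda>i. \<alpha> i * of_bool (f i \<in> f ` J))"
      by (rule summable_comparison_test'[OF summ, of 0]) (auto simp: nonneg)
  qed (simp add: nonneg)
  also have "\<dots> \<le> prob (f ` J)"
    by (rule ge, rule finite_sets) (use J f in auto)
  finally show "sum \<alpha> J \<le> prob (f ` J)" .
qed

lemma has_atoms_iff: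
  assumes nonneg: "\<And>i. 0 \<le> \<alpha> i" and summ: "summable \<alpha>"
  shows "has_atoms \<alpha> (pm_measure X) f \<longleftrightarrow> (\<forall>i. f i \<in> pm_points X) \<and>
    (\<forall>A\<in>sets (pm_measure X). 0 \<le> prob A - (\<Sum>i. \<alpha> i * measure (return (pm_measure X) (f i)) A))"
    (is "_ \<longleftrightarrow> ?pts \<and> ?ge")
proof -
  have "?ge \<longleftrightarrow> (\<forall>A\<in>sets (pm_measure X). (\<Sum>i. \<alpha> i * of_bool (f i \<in> A)) \<le> prob A)"
    by (intro ball_cong refl) (simp add: measure_return indicator_def)
  moreover have "has_atoms \<alpha> (pm_measure X) f \<Longrightarrow> ?pts"
    by (auto simp: has_atoms_def space_eq)
  ultimately show ?thesis
    using has_atoms_suminf_le[OF assms] has_atomsI_suminf[OF assms] by blast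
qed

text \<open>The preimage of the images of the atoms contains the atoms, so their mass cannot drop,
  even if \<phi> identifies some of them.\<close>

lemma has_atoms_push:
  assumes at: "has_atoms \<alpha> M f" and M: "prob_space M" and \<phi>: "\<phi> \<in> measurable M (pm_measure X)"
    and push: "distr M (pm_measure X) \<phi> = pm_measure X"
  shows "has_atoms \<alpha> (pm_measure X) (\<phi> \<circ> f)"
  unfolding has_atoms_def
proof (intro conjI allI impI)
  interpret M: prob_space M by fact
  have f: "f i \<in> space M" for i using at by (auto simp: has_atoms_def)
  show "range (\<phi> \<circ> f) \<subseteq> space (pm_measure X)" using f measurable_space[OF \<phi>] by auto
  fix J :: "nat set" assume J: "finite J"
  have set: "(\<phi> \<circ> f) ` J \<in> sets (pm_measure X)"
    using J f measurable_space[OF \<phi>] by (intro finite_sets) (auto simp: space_eq)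
  have "sum \<alpha> J \<le> measure M (f ` J)" using at J by (simp add: has_atoms_def)
  also have "\<dots> \<le> measure M (\<phi> -` ((\<phi> \<circ> f) ` J) \<inter> space M)"
    using f by (intro M.finite_measure_mono measurable_sets[OF \<phi> set]) auto
  also have "\<dots> = prob ((\<phi> \<circ> f) ` J)" using measure_distr[OF \<phi> set] by (simp add: push)
  finally show "sum \<alpha> J \<le> prob ((\<phi> \<circ> f) ` J)" .
qed

end

lemma atom_weightsD:
  assumes "\<alpha> \<in> atom_weights"
  shows "0 \<le> apply_bcontfun \<alpha> i" "summable (apply_bcontfun \<alpha>)" "(\<Sum>i. apply_bcontfun \<alpha> i) \<le> 1"
    "apply_bcontfun \<alpha> (Suc i) \<le> apply_bcontfun \<alpha> i"
  using assms by (auto simp: atom_weights_def)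

lemma atom_pyramid_iff:
  assumes "\<alpha> \<in> atom_weights"
  shows "X \<in> atom_pyramid \<alpha> \<longleftrightarrow> X \<in> pm_classes \<and> (\<exists>f. has_atoms (apply_bcontfun \<alpha>) (pm_measure (pm_rep X)) f)"
proof (cases "X \<in> pm_classes")
  case True
  interpret R: pm "pm_rep X" by (rule pm.intro) (rule pm_space_rep[OF True])
  show ?thesis
    unfolding atom_pyramid_def R.has_atoms_iff[OF atom_weightsD(1,2)[OF assms]] using True by blast
qed (simp add: atom_pyramid_def)

lemma class_in_atom_pyramid:
  assumes \<alpha>: "\<alpha> \<in> atom_weights" and z: "pm_space z"
  shows "pm_iso `` {z} \<in> atom_pyramid \<alpha> \<longleftrightarrow> (\<exists>f. has_atoms (apply_bcontfun \<alpha>) (pm_measure z) f)"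
proof -
  let ?R = "pm_rep (pm_iso `` {z})"
  interpret z: pm z by (rule pm.intro) fact
  interpret R: pm ?R by (rule pm.intro) (rule pm_space_rep[OF z.class_in])
  obtain \<phi> where \<phi>: "\<phi> \<in> measurable (pm_measure z) (pm_measure ?R)"
      "distr (pm_measure z) (pm_measure ?R) \<phi> = pm_measure ?R"
    using map_to_rep[OF z] by metis
  obtain \<psi> where \<psi>: "\<psi> \<in> measurable (pm_measure ?R) (pm_measure z)"
      "distr (pm_measure ?R) (pm_measure z) \<psi> = pm_measure z"
    using map_from_rep[OF z] by metis
  have "(\<exists>f. has_atoms (apply_bcontfun \<alpha>) (pm_measure ?R) f) \<longleftrightarrow> (\<exists>f. has_atoms (apply_bcontfun \<alpha>) (pm_measure z) f)"
  proof
    assume "\<exists>f. has_atoms (apply_bcontfun \<alpha>) (pm_measure ?R) f"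
    then obtain f where "has_atoms (apply_bcontfun \<alpha>) (pm_measure ?R) f" ..
    then show "\<exists>f. has_atoms (apply_bcontfun \<alpha>) (pm_measure z) f"
      using z.has_atoms_push[OF _ R.prob_space_axioms \<psi>(1,2)] by blast
  next
    assume "\<exists>f. has_atoms (apply_bcontfun \<alpha>) (pm_measure z) f"
    then obtain f where "has_atoms (apply_bcontfun \<alpha>) (pm_measure z) f" ..
    then show "\<exists>f. has_atoms (apply_bcontfun \<alpha>) (pm_measure ?R) f"
      using R.has_atoms_push[OF _ z.prob_space_axioms \<phi>(1,2)] by blast
  qed
  then show ?thesis using atom_pyramid_iff[OF \<alpha>] z.class_in by blast
qed

lemma atom_pyramid_lipschitz_le:
  assumes \<alpha>: "\<alpha> \<in> atom_weights" and X: "X \<in> atom_pyramid \<alpha>" and Y: "Y \<in> pm_classes" and le: "lipschitz_le Y X"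
  shows "Y \<in> atom_pyramid \<alpha>"
proof -
  have XC: "X \<in> pm_classes" using X by (simp add: atom_pyramid_def)
  interpret X: pm "pm_rep X" by (rule pm.intro) (rule pm_space_rep[OF XC])
  interpret Y: pm "pm_rep Y" by (rule pm.intro) (rule pm_space_rep[OF Y])
  obtain f where f: "has_atoms (apply_bcontfun \<alpha>) (pm_measure (pm_rep X)) f"
    using X atom_pyramid_iff[OF \<alpha>] by blast
  obtain h where h: "h \<in> pm_points (pm_rep X) \<rightarrow> pm_points (pm_rep Y)"
      "\<And>x y. x \<in> pm_points (pm_rep X) \<Longrightarrow> y \<in> pm_points (pm_rep X) \<Longrightarrow> pm_dist (pm_rep Y) (h x) (h y) \<le> pm_dist (pm_rep X) x y"
      "distr (pm_measure (pm_rep X)) (pm_measure (pm_rep Y)) h = pm_measure (pm_rep Y)"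
    using le unfolding lipschitz_le_def by blast
  have "has_atoms (apply_bcontfun \<alpha>) (pm_measure (pm_rep Y)) (h \<circ> f)"
    using Y.has_atoms_push[OF f X.prob_space_axioms lipschitz_measurable[OF X.pm_space Y.pm_space h(1,2)] h(3)] .
  then show ?thesis using Y atom_pyramid_iff[OF \<alpha>] by blast
qed


section \<open>Parameters adapted to atoms\<close>

lemma sum_lessThan_mono:
  fixes \<alpha> :: "nat \<Rightarrow> real"
  assumes "\<And>i. 0 \<le> \<alpha> i" "i \<le> j"
  shows "sum \<alpha> {..<i} \<le> sum \<alpha> {..<j}"
  using assms by (intro sum_mono2) auto

text \<open>The half-open intervals with endpoints at consecutive partial sums partition
  \<open>{0..<suminf \<alpha>}\<close>, and a weight 0 gives an empty interval. The
  \<open>LEAST\<close> expression is a visibly Borel formula for the index of the interval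
  containing \<open>t\<close>.\<close>

lemma stick_interval:
  fixes \<alpha> :: "nat \<Rightarrow> real"
  assumes nonneg: "\<And>i. 0 \<le> \<alpha> i" and summ: "summable \<alpha>"
  shows "0 \<le> t \<Longrightarrow> t < suminf \<alpha> \<Longrightarrow> \<exists>i. sum \<alpha> {..<i} \<le> t \<and> t < sum \<alpha> {..<Suc i}"
    and "sum \<alpha> {..<i} \<le> t \<Longrightarrow> t < sum \<alpha> {..<Suc i} \<Longrightarrow> (LEAST i. t < sum \<alpha> {..<Suc i}) = i"
    and "sum \<alpha> {..<i} \<le> suminf \<alpha>"
proof -
  show "sum \<alpha> {..<i} \<le> suminf \<alpha>" by (intro sum_le_suminf summ) (auto simp: nonneg)
  show "(LEAST i. t < sum \<alpha> {..<Suc i}) = i" if "sum \<alpha> {..<i} \<le> t" "t < sum \<alpha> {..<Suc i}"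
  proof (rule Least_equality)
    fix j assume j: "t < sum \<alpha> {..<Suc j}"
    show "i \<le> j"
    proof (rule ccontr)
      assume "\<not> i \<le> j"
      then have "sum \<alpha> {..<Suc j} \<le> sum \<alpha> {..<i}" by (intro sum_lessThan_mono nonneg) auto
      then show False using j that(1) by simp
    qed
  qed (rule that(2))
  show "\<exists>i. sum \<alpha> {..<i} \<le> t \<and> t < sum \<alpha> {..<Suc i}" if t: "0 \<le> t" "t < suminf \<alpha>"
  proof -
    define n where "n = (LEAST n. t < sum \<alpha> {..<n})"
    have "\<forall>\<^sub>F n in sequentially. t < sum \<alpha> {..<n}"
      using order_tendstoD(1)[OF summable_LIMSEQ[OF summ] t(2)] .
    then have "\<exists>n. t < sum \<alpha> {..<n}" by (auto simp: eventually_sequentially)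
    then have n: "t < sum \<alpha> {..<n}" "\<And>m. m < n \<Longrightarrow> \<not> t < sum \<alpha> {..<m}"
      unfolding n_def by (rule LeastI_ex) (rule not_less_Least)
    then obtain i where "n = Suc i" using t(1) by (cases n) auto
    then show ?thesis using n by (intro exI[of _ i]) (auto simp: not_less)
  qed
qed

context pm
begin

text \<open>The mass that remains after removal of the atoms, once normalised, again makes a
  pm-space of the same metric space, and \<open>parameter_exists\<close> applies to it. If no mass
  remains, any constant map serves.\<close>

lemma residual_parameter:
  assumes nonneg: "\<And>i. 0 \<le> \<alpha> i" and summ: "summable \<alpha>" and le1: "suminf \<alpha> \<le> 1"
    and at: "has_atoms \<alpha> (pm_measure X) f"
  shows "\<exists>b \<in> measurable unit_measure (pm_measure X). \<forall>A\<in>sets (pm_measure X).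
    emeasure (pm_measure X) A = ennreal (\<Sum>i. \<alpha> i * of_bool (f i \<in> A)) +
      ennreal (1 - suminf \<alpha>) * emeasure unit_measure (b -` A \<inter> {0..1})"
proof -
  \<comment> \<open>The sum of the Dirac measures at \<open>f i\<close> with weights
    \<open>\<alpha> i\<close>, as the push-forward of a weighted counting measure.\<close>
  define N where "N = distr (density (count_space UNIV) (\<lambda>i. ennreal (\<alpha> i))) (pm_measure X) f"
  define \<sigma> where "\<sigma> = suminf \<alpha>"
  have fX: "f i \<in> pm_points X" for i using at by (auto simp: has_atoms_def space_eq)
  have summ': "summable (\<lambda>i. \<alpha> i * of_bool (f i \<in> A))" for A
    by (rule summable_comparison_test'[OF summ, of 0]) (auto simp: nonneg)
  have N: "emeasure N A = ennreal (\<Sum>i. \<alpha> i * of_bool (f i \<in> A))" if "A \<in> sets (pm_measure X)" for A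
  proof -
    have f: "f \<in> measurable (density (count_space UNIV) (\<lambda>i. ennreal (\<alpha> i))) (pm_measure X)"
      using fX by (simp add: space_eq)
    have "emeasure N A = (\<Sum>i. ennreal (\<alpha> i) * indicator (f -` A) i)"
      unfolding N_def using that by (subst emeasure_distr[OF f]) (auto simp: emeasure_density nn_integral_count_space_nat)
    also have "\<dots> = (\<Sum>i. ennreal (\<alpha> i * of_bool (f i \<in> A)))"
      by (intro suminf_cong) (auto simp: indicator_def)
    also have "\<dots> = ennreal (\<Sum>i. \<alpha> i * of_bool (f i \<in> A))"
      by (rule suminf_ennreal2) (use nonneg summ' in auto)
    finally show ?thesis .
  qed
  have sN: "sets N = sets (pm_measure X)" by (simp add: N_def)
  have le: "emeasure N A \<le> emeasure (pm_measure X) A" if "A \<in> sets (pm_measure X)" for A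
    using has_atoms_suminf_le[OF nonneg summ at that] that by (simp add: N emeasure_eq_measure ennreal_leI)
  have Nspace: "emeasure N (space (pm_measure X)) = ennreal \<sigma>"
    by (subst N[OF sets.top]) (simp add: space_eq fX \<sigma>_def)
  have finN: "finite_measure N"
    by (rule finite_measureI) (use Nspace sets_eq_imp_space_eq[OF sN] in simp)
  define \<nu> where "\<nu> = diff_measure (pm_measure X) N"
  have \<nu>: "emeasure \<nu> A = emeasure (pm_measure X) A - emeasure N A" if "A \<in> sets (pm_measure X)" for A
    unfolding \<nu>_def using emeasure_diff_measure[OF finite_measure_axioms finN sN[symmetric] le that] .
  have s\<nu>: "sets \<nu> = sets (pm_measure X)" "space \<nu> = space (pm_measure X)" by (simp_all add: \<nu>_def)
  have \<sigma>: "0 \<le> \<sigma>" "\<sigma> \<le> 1" using le1 suminf_nonneg[OF summ nonneg] by (auto simp: \<sigma>_def)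
  have \<nu>space: "emeasure \<nu> (space (pm_measure X)) = ennreal (1 - \<sigma>)"
    using \<sigma> by (simp add: \<nu> Nspace emeasure_space_1 ennreal_minus flip: ennreal_1)
  have "\<exists>b \<in> measurable unit_measure (pm_measure X). \<forall>A\<in>sets (pm_measure X).
      emeasure \<nu> A = ennreal (1 - \<sigma>) * emeasure unit_measure (b -` A \<inter> {0..1})"
  proof (cases "\<sigma> = 1")
    case True
    have "emeasure \<nu> A = 0" if "A \<in> sets (pm_measure X)" for A
      using emeasure_mono[of A "space \<nu>" \<nu>] that sets.sets_into_space[OF that] \<nu>space True by (simp add: s\<nu>)
    then show ?thesis
      using True points_nonempty by (intro bexI[of _ "\<lambda>_. SOME x. x \<in> pm_points X"])
        (auto simp: space_eq some_in_eq)
  next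
    case False
    then have \<sigma>1: "\<sigma> < 1" using \<sigma> by simp
    define \<mu> where "\<mu> = scale_measure (ennreal (1 / (1 - \<sigma>))) \<nu>"
    have \<mu>: "emeasure \<mu> A = ennreal (1 / (1 - \<sigma>)) * emeasure \<nu> A" for A
      by (simp add: \<mu>_def emeasure_scale_measure)
    have "prob_space \<mu>"
      by (rule prob_spaceI) (use \<sigma>1 \<nu>space in \<open>simp add: \<mu> s\<nu> \<mu>_def space_scale_measure flip: ennreal_mult\<close>)
    then have "pm_space (fst X, \<mu>)"
      using pm_space by (simp add: pm_space_def \<mu>_def s\<nu> space_scale_measure)
    then obtain b where b: "pm_parameter (fst X, \<mu>) b"
      using pm.parameter_exists pm.intro by blast
    have s\<mu>: "sets \<mu> = sets (pm_measure X)" by (simp add: \<mu>_def s\<nu>)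
    have bm: "b \<in> measurable unit_measure (pm_measure X)"
      using b by (simp add: pm_parameter_def s\<mu> cong: measurable_cong_sets)
    have "emeasure \<nu> A = ennreal (1 - \<sigma>) * emeasure unit_measure (b -` A \<inter> {0..1})"
      if A: "A \<in> sets (pm_measure X)" for A
    proof -
      have "emeasure unit_measure (b -` A \<inter> {0..1}) = emeasure \<mu> A"
        using b A emeasure_distr[of b unit_measure \<mu> A]
        by (simp add: pm_parameter_def s\<mu> space_unit_measure)
      then show ?thesis
        using \<sigma>1 by (simp add: \<mu> mult.assoc[symmetric] flip: ennreal_mult)
    qed
    then show ?thesis using bm by blast
  qed
  then obtain b where b: "b \<in> measurable unit_measure (pm_measure X)"
    "\<And>A. A \<in> sets (pm_measure X) \<Longrightarrow> emeasure \<nu> A = ennreal (1 - \<sigma>) * emeasure unit_measure (b -` A \<inter> {0..1})"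
    by blast
  show ?thesis
  proof (intro bexI[OF _ b(1)] ballI)
    fix A assume A: "A \<in> sets (pm_measure X)"
    have "emeasure (pm_measure X) A = emeasure N A + (emeasure (pm_measure X) A - emeasure N A)"
      using le[OF A] by (simp add: ennreal_add_diff_cancel_left add_diff_inverse_ennreal)
    then show "emeasure (pm_measure X) A = ennreal (\<Sum>i. \<alpha> i * of_bool (f i \<in> A)) +
      ennreal (1 - suminf \<alpha>) * emeasure unit_measure (b -` A \<inter> {0..1})"
      using b(2)[OF A] \<nu>[OF A] N[OF A] by (simp add: \<sigma>_def)
  qed
qed

text \<open>Below \<sigma> the parameter runs through the atoms, spending time
  \<open>\<alpha> i\<close> at \<open>f i\<close>; from \<sigma> on it runs through the residual
  parameter, slowed down to take time 1 - \<sigma>.\<close>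

lemma atomic_parameter:
  assumes nonneg: "\<And>i. 0 \<le> \<alpha> i" and summ: "summable \<alpha>" and le1: "suminf \<alpha> \<le> 1"
    and at: "has_atoms \<alpha> (pm_measure X) f"
  shows "\<exists>a. pm_parameter X a \<and> (\<forall>i t. sum \<alpha> {..<i} \<le> t \<and> t < sum \<alpha> {..<Suc i} \<longrightarrow> a t = f i)"
proof -
  define \<sigma> where "\<sigma> = suminf \<alpha>"
  have \<sigma>: "0 \<le> \<sigma>" "\<sigma> \<le> 1" using le1 suminf_nonneg[OF summ nonneg] by (auto simp: \<sigma>_def)
  define I where "I i = {sum \<alpha> {..<i}..<sum \<alpha> {..<Suc i}}" for i
  note stick = stick_interval[OF nonneg summ, folded \<sigma>_def]
  obtain b where b: "b \<in> measurable unit_measure (pm_measure X)"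
    and mass: "\<And>A. A \<in> sets (pm_measure X) \<Longrightarrow> emeasure (pm_measure X) A = ennreal (\<Sum>i. \<alpha> i * of_bool (f i \<in> A)) +
      ennreal (1 - \<sigma>) * emeasure unit_measure (b -` A \<inter> {0..1})"
    using residual_parameter[OF assms] unfolding \<sigma>_def by blast
  have fX: "f i \<in> pm_points X" for i using at by (auto simp: has_atoms_def space_eq)
  define idx where "idx t = (LEAST i. t < sum \<alpha> {..<Suc i})" for t
  \<comment> \<open>On \<open>{\<sigma>..1}\<close> with \<sigma> < 1 this inverts
    \<open>x \<mapsto> \<sigma> + (1 - \<sigma>) * x\<close>. Clamping to the unit interval makes
    the composition with \<open>b\<close> Borel on the whole line.\<close>
  define c where "c t = max 0 (min 1 ((t - \<sigma>) / (1 - \<sigma>)))" for t :: real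
  define a where "a t = (if t < \<sigma> then f (idx t) else b (c t))" for t
  have aI: "a t = f i" if "sum \<alpha> {..<i} \<le> t" "t < sum \<alpha> {..<Suc i}" for t i
    using stick(2)[OF that] stick(3)[of "Suc i"] that by (simp add: a_def idx_def)
  have [measurable]: "idx \<in> measurable borel (count_space UNIV)"
    unfolding idx_def by measurable
  have fidx: "(\<lambda>t. f (idx t)) \<in> measurable borel (pm_measure X)"
    using measurable_comp[of idx borel "count_space UNIV" f "pm_measure X"] fX by (simp add: comp_def space_eq)
  have "c \<in> borel_measurable borel" unfolding c_def by measurable
  then have c: "c \<in> measurable borel unit_measure"
    by (intro measurable_restrict_space2) (auto simp: c_def)
  have bc: "(\<lambda>t. b (c t)) \<in> measurable borel (pm_measure X)"
    using measurable_comp[OF c b] by (simp add: comp_def)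
  have a: "a \<in> measurable borel (pm_measure X)"
    unfolding a_def by (rule measurable_If[OF fidx bc]) simp
  then have au: "a \<in> measurable unit_measure (pm_measure X)"
    by (intro measurable_restrict_space1) (simp cong: measurable_cong_sets)
  have "distr unit_measure (pm_measure X) a = pm_measure X"
  proof (rule measure_eqI)
    fix A assume "A \<in> sets (distr unit_measure (pm_measure X) a)"
    then have A: "A \<in> sets (pm_measure X)" by simp
    define P where "P i = (if f i \<in> A then I i else {})" for i
    define Q where "Q = (\<lambda>t. b (c t)) -` A \<inter> {\<sigma>..1}"
    have disj: "disjoint_family P"
      unfolding disjoint_family_on_def
    proof (intro ballI impI)
      fix i j :: nat assume "i \<noteq> j"
      have False if "t \<in> I i" "t \<in> I j" for t
        using stick(2)[of i t] stick(2)[of j t] that \<open>i \<noteq> j\<close> unfolding I_def by simp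
      then have "I i \<inter> I j = {}" by blast
      then show "P i \<inter> P j = {}" by (auto simp: P_def)
    qed
    have UP: "(\<Union>i. P i) = (\<lambda>t. f (idx t)) -` A \<inter> {0..<\<sigma>}"
    proof (intro equalityI subsetI)
      fix t assume "t \<in> (\<Union>i. P i)"
      then obtain i where i: "f i \<in> A" "sum \<alpha> {..<i} \<le> t" "t < sum \<alpha> {..<Suc i}"
        by (auto simp: P_def I_def split: if_splits)
      moreover have "0 \<le> sum \<alpha> {..<i}" by (intro sum_nonneg nonneg)
      ultimately show "t \<in> (\<lambda>t. f (idx t)) -` A \<inter> {0..<\<sigma>}"
        using stick(2)[OF i(2,3)] stick(3)[of "Suc i"] by (auto simp: idx_def)
    next
      fix t assume t: "t \<in> (\<lambda>t. f (idx t)) -` A \<inter> {0..<\<sigma>}"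
      then obtain i where "sum \<alpha> {..<i} \<le> t" "t < sum \<alpha> {..<Suc i}" using stick(1) by auto
      then show "t \<in> (\<Union>i. P i)" using t stick(2) by (auto simp: P_def I_def idx_def intro!: exI[of _ i])
    qed
    have "emeasure lborel (\<Union>i. P i) = (\<Sum>i. emeasure lborel (P i))"
      by (rule suminf_emeasure[symmetric, OF _ disj]) (auto simp: P_def I_def)
    also have "\<dots> = (\<Sum>i. ennreal (\<alpha> i * of_bool (f i \<in> A)))"
      by (intro suminf_cong) (auto simp: P_def I_def nonneg)
    also have "\<dots> = ennreal (\<Sum>i. \<alpha> i * of_bool (f i \<in> A))"
      by (rule suminf_ennreal2) (auto simp: nonneg intro: summable_comparison_test'[OF summ, of 0])
    finally have emP: "emeasure lborel (\<Union>i. P i) = ennreal (\<Sum>i. \<alpha> i * of_bool (f i \<in> A))" .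
    have Qs: "Q \<in> sets borel" using measurable_sets[OF bc A] by (simp add: Q_def)
    have emQ: "emeasure lborel Q = ennreal (1 - \<sigma>) * emeasure unit_measure (b -` A \<inter> {0..1})"
    proof (cases "\<sigma> = 1")
      case True
      then have "Q \<subseteq> {1}" by (auto simp: Q_def)
      then have "emeasure lborel Q \<le> emeasure lborel {1::real}" by (intro emeasure_mono) auto
      then show ?thesis using True by simp
    next
      case False
      then have \<sigma>1: "\<sigma> < 1" using \<sigma> by simp
      have "emeasure lborel Q = emeasure (density (distr lborel borel (\<lambda>x. \<sigma> + (1 - \<sigma>) * x)) (\<lambda>_. ennreal \<bar>1 - \<sigma>\<bar>)) Q"
        using lborel_real_affine[of "1 - \<sigma>" \<sigma>] \<sigma>1 by simp
      also have "\<dots> = ennreal (1 - \<sigma>) * emeasure lborel ((\<lambda>x. \<sigma> + (1 - \<sigma>) * x) -` Q)"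
        using Qs \<sigma>1 by (simp add: emeasure_density_const emeasure_distr)
      also have "(\<lambda>x. \<sigma> + (1 - \<sigma>) * x) -` Q = b -` A \<inter> {0..1}"
      proof -
        have "c (\<sigma> + (1 - \<sigma>) * x) = x" if "x \<in> {0..1}" for x using that \<sigma>1 by (simp add: c_def)
        moreover have "\<sigma> + (1 - \<sigma>) * x \<in> {\<sigma>..1} \<longleftrightarrow> x \<in> {0..1}" for x
        proof -
          have "\<sigma> + (1 - \<sigma>) * x \<le> 1 \<longleftrightarrow> (1 - \<sigma>) * x \<le> (1 - \<sigma>) * 1"
            unfolding mult_1_right le_diff_eq by (simp only: add.commute)
          then show ?thesis using \<sigma>1 by (simp only: mult_le_cancel_left_pos) (simp add: zero_le_mult_iff)
        qed
        ultimately show ?thesis unfolding Q_def by (auto simp del: atLeastAtMost_iff)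
      qed
      finally show ?thesis by (simp add: emeasure_unit_measure)
    qed
    have split: "a -` A \<inter> {0..1} = (\<Union>i. P i) \<union> Q"
      unfolding UP using \<sigma> by (auto simp: a_def Q_def split: if_splits)
    have "emeasure (distr unit_measure (pm_measure X) a) A = emeasure lborel (a -` A \<inter> {0..1})"
      using emeasure_distr[OF au A] by (simp add: space_unit_measure emeasure_unit_measure)
    also have "\<dots> = emeasure lborel (\<Union>i. P i) + emeasure lborel Q"
      unfolding split by (rule plus_emeasure[symmetric]) (use Qs UP in \<open>auto simp: P_def I_def Q_def\<close>)
    also have "\<dots> = emeasure (pm_measure X) A" using mass[OF A] emP emQ by simp
    finally show "emeasure (distr unit_measure (pm_measure X) a) A = emeasure (pm_measure X) A" .
  qed simp
  then show ?thesis using au aI unfolding pm_parameter_def by blast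
qed

end


section \<open>Directedness\<close>

text \<open>The converse of \<open>atomic_parameter\<close>: time spent at a constant value is mass
  at that value. The left endpoint of an interval lies in \<open>{0..1}\<close> even if the interval
  is empty, so every index gets a point of the space.\<close>

lemma (in pm) has_atoms_parameter:
  assumes nonneg: "\<And>i. 0 \<le> \<alpha> i" and summ: "summable \<alpha>" and le1: "suminf \<alpha> \<le> 1"
    and c: "c \<in> measurable unit_measure (pm_measure X)" "distr unit_measure (pm_measure X) c = pm_measure X"
    and const: "\<And>i s t. sum \<alpha> {..<i} \<le> s \<Longrightarrow> s < sum \<alpha> {..<Suc i} \<Longrightarrow>
      sum \<alpha> {..<i} \<le> t \<Longrightarrow> t < sum \<alpha> {..<Suc i} \<Longrightarrow> c s = c t"
  shows "has_atoms \<alpha> (pm_measure X) (\<lambda>i. c (sum \<alpha> {..<i}))"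
  unfolding has_atoms_def
proof (intro conjI allI impI)
  define I where "I i = {sum \<alpha> {..<i}..<sum \<alpha> {..<Suc i}}" for i
  have bounds: "0 \<le> sum \<alpha> {..<i}" "sum \<alpha> {..<i} \<le> 1" for i
    using stick_interval(3)[OF nonneg summ, of i] le1 by (auto intro: sum_nonneg nonneg)
  then have cX: "c (sum \<alpha> {..<i}) \<in> pm_points X" for i
    using measurable_space[OF c(1)] by (simp add: space_unit_measure space_eq)
  then show "range (\<lambda>i. c (sum \<alpha> {..<i})) \<subseteq> space (pm_measure X)" by (auto simp: space_eq)
  fix J :: "nat set" assume J: "finite J"
  define F where "F = (\<lambda>i. c (sum \<alpha> {..<i})) ` J"
  have F: "F \<in> sets (pm_measure X)" unfolding F_def using J cX by (intro finite_sets) auto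
  have I: "I i \<in> sets unit_measure" for i
    using bounds[of i] bounds[of "Suc i"] unfolding sets_unit_measure I_def by auto
  have "sum \<alpha> J = (\<Sum>i\<in>J. measure unit_measure (I i))"
  proof (rule sum.cong[OF refl])
    fix i
    have "I i \<subseteq> {0..1}" using I[of i] sets_unit_measure by blast
    then have "measure unit_measure (I i) = measure lborel (I i)" by (rule measure_unit_measure)
    then show "\<alpha> i = measure unit_measure (I i)" by (simp add: I_def nonneg)
  qed
  also have "\<dots> = measure unit_measure (\<Union>i\<in>J. I i)"
  proof (rule unit.finite_measure_finite_Union[symmetric])
    have False if "t \<in> I i" "t \<in> I j" "i \<noteq> j" for t i j
      using stick_interval(2)[OF nonneg summ, of i t] stick_interval(2)[OF nonneg summ, of j t] that
      unfolding I_def by simp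
    then show "disjoint_family_on I J" by (auto simp: disjoint_family_on_def)
  qed (use J I in auto)
  also have "\<dots> \<le> measure unit_measure (c -` F \<inter> {0..1})"
  proof (rule unit.finite_measure_mono)
    show "c -` F \<inter> {0..1} \<in> sets unit_measure"
      using measurable_sets[OF c(1) F] by (simp add: space_unit_measure)
    show "(\<Union>i\<in>J. I i) \<subseteq> c -` F \<inter> {0..1}"
    proof
      fix t assume "t \<in> (\<Union>i\<in>J. I i)"
      then obtain i where i: "i \<in> J" "t \<in> I i" by blast
      then have "c t = c (sum \<alpha> {..<i})" by (intro const[of i]) (auto simp: I_def)
      moreover have "t \<in> {0..1}" using I[of i] i(2) unfolding sets_unit_measure by blast
      ultimately show "t \<in> c -` F \<inter> {0..1}" using i(1) by (auto simp: F_def)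
    qed
  qed
  also have "\<dots> = prob F" using measure_distr[OF c(1) F] by (simp add: c(2) space_unit_measure)
  finally show "sum \<alpha> J \<le> prob ((\<lambda>i. c (sum \<alpha> {..<i})) ` J)" by (simp add: F_def)
qed

text \<open>
  Parameters of \<open>X\<close> and \<open>Y\<close> that are constant on the same intervals give a coupling of the two
  measures with the prescribed atoms. The product carries the sum of the two metrics and is coded by real numbers.
\<close>

lemma coupling_exists:
  assumes X: "pm_space X" and Y: "pm_space Y" and a: "pm_parameter X a" and b: "pm_parameter Y b"
  obtains Z c p q where "pm_space Z" "c \<in> measurable unit_measure (pm_measure Z)"
    "distr unit_measure (pm_measure Z) c = pm_measure Z"
    "p \<in> pm_points Z \<rightarrow> pm_points X" "q \<in> pm_points Z \<rightarrow> pm_points Y"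
    "\<And>u v. pm_dist X (p u) (p v) \<le> pm_dist Z u v" "\<And>u v. pm_dist Y (q u) (q v) \<le> pm_dist Z u v"
    "\<And>s t. a s = a t \<Longrightarrow> b s = b t \<Longrightarrow> c s = c t" "\<And>t. p (c t) = a t" "\<And>t. q (c t) = b t"
proof -
  interpret X: pm X by (rule pm.intro) fact
  interpret Y: pm Y by (rule pm.intro) fact
  have am: "a \<in> measurable unit_measure (pm_measure X)" "distr unit_measure (pm_measure X) a = pm_measure X"
    and bm: "b \<in> measurable unit_measure (pm_measure Y)" "distr unit_measure (pm_measure Y) b = pm_measure Y"
    using a b by (auto simp: pm_parameter_def)
  obtain e :: "real \<times> real \<Rightarrow> real" where "bij_betw e (UNIV \<times> UNIV) UNIV"
    using card_of_Times_same_infinite[of "UNIV :: real set"] infinite_UNIV_char_0 card_of_ordIso by blast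
  then have e: "inj e" by (simp add: bij_betw_def)
  define p where "p u = fst (inv e u)" for u
  define q where "q u = snd (inv e u)" for u
  define S where "S = e ` (pm_points X \<times> pm_points Y)"
  \<comment> \<open>The sum dominates both metrics, which makes the two projections
    1-Lipschitz.\<close>
  define d where "d u v = pm_dist X (p u) (p v) + pm_dist Y (q u) (q v)" for u v
  have pqe[simp]: "p (e (x, y)) = x" "q (e (x, y)) = y" for x y using e by (auto simp: p_def q_def)
  have pS: "p u \<in> pm_points X" and qS: "q u \<in> pm_points Y" and eS: "e (p u, q u) = u" if "u \<in> S" for u
    using that by (auto simp: S_def)
  interpret Z: Metric_space S d
  proof
    fix u v w
    show "0 \<le> d u v" by (simp add: d_def)
    show "d u v = d v u" by (simp add: d_def X.met.commute Y.met.commute)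
    show "d u v = 0 \<longleftrightarrow> u = v" if "u \<in> S" "v \<in> S"
    proof -
      have "d u v = 0 \<longleftrightarrow> pm_dist X (p u) (p v) = 0 \<and> pm_dist Y (q u) (q v) = 0"
        unfolding d_def by (rule add_nonneg_eq_0_iff) simp_all
      also have "\<dots> \<longleftrightarrow> p u = p v \<and> q u = q v"
        using pS qS that by simp
      also have "\<dots> \<longleftrightarrow> u = v" using eS[OF that(1)] eS[OF that(2)] by metis
      finally show ?thesis .
    qed
    show "d u w \<le> d u v + d v w" if "u \<in> S" "v \<in> S" "w \<in> S"
      using X.met.triangle[OF pS[OF that(1)] pS[OF that(2)] pS[OF that(3)]]
        Y.met.triangle[OF qS[OF that(1)] qS[OF that(2)] qS[OF that(3)]] by (simp add: d_def)
  qed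
  have complete: "Z.mcomplete"
    unfolding Z.mcomplete_def
  proof (intro allI impI)
    fix \<sigma> assume C: "Z.MCauchy \<sigma>"
    then have \<sigma>S: "\<sigma> n \<in> S" for n by (auto simp: Z.MCauchy_def)
    have "X.met.MCauchy (p \<circ> \<sigma>)" "Y.met.MCauchy (q \<circ> \<sigma>)"
    proof -
      have le: "pm_dist X (p u) (p v) \<le> d u v" "pm_dist Y (q u) (q v) \<le> d u v" for u v by (simp_all add: d_def)
      have *: "\<exists>N. \<forall>n n'. N \<le> n \<longrightarrow> N \<le> n' \<longrightarrow> d (\<sigma> n) (\<sigma> n') < e" if "e > 0" for e
        using C that unfolding Z.MCauchy_def by blast
      show "X.met.MCauchy (p \<circ> \<sigma>)" unfolding X.met.MCauchy_def
      proof (intro conjI allI impI)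
        show "range (p \<circ> \<sigma>) \<subseteq> pm_points X" using pS[OF \<sigma>S] by auto
        fix r :: real assume "r > 0"
        then obtain N where "\<forall>n n'. N \<le> n \<longrightarrow> N \<le> n' \<longrightarrow> d (\<sigma> n) (\<sigma> n') < r" using * by blast
        then show "\<exists>N. \<forall>n n'. N \<le> n \<longrightarrow> N \<le> n' \<longrightarrow> pm_dist X ((p \<circ> \<sigma>) n) ((p \<circ> \<sigma>) n') < r"
          unfolding comp_def using le_less_trans[OF le(1)] by blast
      qed
      show "Y.met.MCauchy (q \<circ> \<sigma>)" unfolding Y.met.MCauchy_def
      proof (intro conjI allI impI)
        show "range (q \<circ> \<sigma>) \<subseteq> pm_points Y" using qS[OF \<sigma>S] by auto
        fix r :: real assume "r > 0"
        then obtain N where "\<forall>n n'. N \<le> n \<longrightarrow> N \<le> n' \<longrightarrow> d (\<sigma> n) (\<sigma> n') < r" using * by blast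
        then show "\<exists>N. \<forall>n n'. N \<le> n \<longrightarrow> N \<le> n' \<longrightarrow> pm_dist Y ((q \<circ> \<sigma>) n) ((q \<circ> \<sigma>) n') < r"
          unfolding comp_def using le_less_trans[OF le(2)] by blast
      qed
    qed
    then obtain x y where x: "limitin X.met.mtopology (p \<circ> \<sigma>) x sequentially"
      and y: "limitin Y.met.mtopology (q \<circ> \<sigma>) y sequentially"
      using X.mcomplete Y.mcomplete unfolding X.met.mcomplete_def Y.met.mcomplete_def by blast
    have "(\<lambda>n. pm_dist X (p (\<sigma> n)) x + pm_dist Y (q (\<sigma> n)) y) \<longlonglongrightarrow> 0 + 0"
      using x y unfolding X.met.limitin_metric_dist_null Y.met.limitin_metric_dist_null
      by (intro tendsto_add) (auto simp: comp_def)
    moreover have "e (x, y) \<in> S"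
      using x y by (auto simp: S_def X.met.limitin_metric_dist_null Y.met.limitin_metric_dist_null)
    ultimately have "limitin Z.mtopology \<sigma> (e (x, y)) sequentially"
      unfolding Z.limitin_metric_dist_null using \<sigma>S by (simp add: d_def)
    then show "\<exists>x. limitin Z.mtopology \<sigma> x sequentially" by blast
  qed
  define c where "c t = e (a t, b t)" for t
  define B where "B = sigma S {U. openin Z.mtopology U}"
  have sB: "space B = S" "sets B = sigma_sets S {U. openin Z.mtopology U}"
    using openin_subset[of Z.mtopology] by (auto simp: B_def space_measure_of_conv sets_measure_of_conv)
  define \<mu> where "\<mu> = distr unit_measure B c"
  define Z where "Z = (metric (S, d), \<mu>)"
  have Zs: "fst Z = metric (S, d)" "pm_points Z = S" "pm_dist Z = d" "pm_topology Z = Z.mtopology"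
    by (simp_all add: Z_def)
  obtain D1 where D1: "countable D1" "D1 \<subseteq> pm_points X" "\<forall>x\<in>pm_points X. \<forall>e>0. \<exists>c\<in>D1. pm_dist X x c < e"
    using X.dense_subset[OF subset_refl] by blast
  obtain D2 where D2: "countable D2" "D2 \<subseteq> pm_points Y" "\<forall>x\<in>pm_points Y. \<forall>e>0. \<exists>c\<in>D2. pm_dist Y x c < e"
    using Y.dense_subset[OF subset_refl] by blast
  have dense: "\<exists>c\<in>e ` (D1 \<times> D2). d u c < r" if u: "u \<in> S" "r > 0" for u r
  proof -
    obtain x where x: "x \<in> D1" "pm_dist X (p u) x < r / 2" using D1(3) pS[OF u(1)] u(2) half_gt_zero by blast
    obtain y where y: "y \<in> D2" "pm_dist Y (q u) y < r / 2" using D2(3) qS[OF u(1)] u(2) half_gt_zero by blast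
    have "d u (e (x, y)) < r" using x y by (simp add: d_def)
    then show ?thesis using x y by blast
  qed
  have aX: "a t \<in> pm_points X" and bY: "b t \<in> pm_points Y" if "t \<in> {0..1}" for t
    using measurable_space[OF am(1)] measurable_space[OF bm(1)] that
    by (auto simp: space_unit_measure X.space_eq Y.space_eq)
  have cS: "c t \<in> S" if "t \<in> {0..1}" for t
    using aX bY that by (auto simp: c_def S_def)
  text \<open>A Dirac measure, only to have the Borel structure of the product available.\<close>
  define Z0 where "Z0 = (metric (S, d), return B (c 0))"
  have "pm_space Z0"
  proof (rule pm_spaceI[of _ "e ` (D1 \<times> D2)"])
    show "prob_space (pm_measure Z0)"
      using cS[of 0] by (simp add: Z0_def prob_space_return sB)
    have "e ` (D1 \<times> D2) \<subseteq> S" using D1(2) D2(2) by (auto simp: S_def)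
    then show "e ` (D1 \<times> D2) \<subseteq> pm_points Z0" by (simp add: Z0_def)
  qed (use complete D1(1) D2(1) dense in \<open>simp_all add: Z0_def sB mcomplete_of_def\<close>)
  interpret Z0: pm Z0 by (rule pm.intro) fact
  have Z0: "pm_points Z0 = S" "pm_dist Z0 = d" by (simp_all add: Z0_def)
  have cm: "c \<in> measurable unit_measure (pm_measure Z0)"
  proof (rule Z0.measurableI_dist)
    fix z assume "z \<in> pm_points Z0"
    then have "p z \<in> pm_points X" "q z \<in> pm_points Y" using pS qS by (simp_all add: Z0)
    then have "(\<lambda>t. pm_dist X (a t) (p z) + pm_dist Y (b t) (q z)) \<in> borel_measurable unit_measure"
      using measurable_compose[OF am(1) X.dist_measurable] measurable_compose[OF bm(1) Y.dist_measurable]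
      by (intro borel_measurable_add)
    then show "(\<lambda>t. pm_dist Z0 (c t) z) \<in> borel_measurable unit_measure"
      by (simp add: Z0 d_def c_def)
  qed (use cS in \<open>simp add: Z0 space_unit_measure\<close>)
  define Z where "Z = (fst Z0, distr unit_measure (pm_measure Z0) c)"
  have Z: "pm_points Z = S" "pm_dist Z = d" using Z0 by (simp_all add: Z_def)
  show thesis
  proof (rule that[of Z c p q])
    show "pm_space Z"
      unfolding Z_def by (rule pm_space_distr[OF \<open>pm_space Z0\<close> prob_space_unit_measure cm])
    show "c \<in> measurable unit_measure (pm_measure Z)" using cm by (simp add: Z_def)
    show "distr unit_measure (pm_measure Z) c = pm_measure Z"
      unfolding Z_def snd_conv by (rule distr_cong) auto
  qed (use pS qS in \<open>auto simp: Z d_def c_def\<close>)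
qed

text \<open>The product of the two measures would break the atoms into smaller ones. The joint law
  of parameters that are constant on the same intervals keeps an atom of mass at least
  \<open>\<alpha> i\<close> for each of them.\<close>

lemma atom_pyramid_directed:
  assumes \<alpha>: "\<alpha> \<in> atom_weights" and "X \<in> atom_pyramid \<alpha>" "Y \<in> atom_pyramid \<alpha>"
  shows "\<exists>Z\<in>atom_pyramid \<alpha>. lipschitz_le X Z \<and> lipschitz_le Y Z"
proof -
  let ?\<alpha> = "apply_bcontfun \<alpha>"
  note \<alpha>D = atom_weightsD[OF \<alpha>]
  have XY: "X \<in> pm_classes" "Y \<in> pm_classes" using assms(2,3) by (auto simp: atom_pyramid_def)
  interpret X: pm "pm_rep X" by (rule pm.intro) (rule pm_space_rep[OF XY(1)])
  interpret Y: pm "pm_rep Y" by (rule pm.intro) (rule pm_space_rep[OF XY(2)])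
  obtain f g where f: "has_atoms ?\<alpha> (pm_measure (pm_rep X)) f" and g: "has_atoms ?\<alpha> (pm_measure (pm_rep Y)) g"
    using assms(2,3) atom_pyramid_iff[OF \<alpha>] by blast
  obtain a where a: "pm_parameter (pm_rep X) a"
      "\<And>i t. sum ?\<alpha> {..<i} \<le> t \<Longrightarrow> t < sum ?\<alpha> {..<Suc i} \<Longrightarrow> a t = f i"
    using X.atomic_parameter[OF \<alpha>D(1,2,3) f] by blast
  obtain b where b: "pm_parameter (pm_rep Y) b"
      "\<And>i t. sum ?\<alpha> {..<i} \<le> t \<Longrightarrow> t < sum ?\<alpha> {..<Suc i} \<Longrightarrow> b t = g i"
    using Y.atomic_parameter[OF \<alpha>D(1,2,3) g] by blast
  obtain Z c p q where Z: "pm_space Z" and c: "c \<in> measurable unit_measure (pm_measure Z)"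
    "distr unit_measure (pm_measure Z) c = pm_measure Z"
    and p: "p \<in> pm_points Z \<rightarrow> pm_points (pm_rep X)" and q: "q \<in> pm_points Z \<rightarrow> pm_points (pm_rep Y)"
    and lip: "\<And>u v. pm_dist (pm_rep X) (p u) (p v) \<le> pm_dist Z u v" "\<And>u v. pm_dist (pm_rep Y) (q u) (q v) \<le> pm_dist Z u v"
    and cc: "\<And>s t. a s = a t \<Longrightarrow> b s = b t \<Longrightarrow> c s = c t" and pq: "\<And>t. p (c t) = a t" "\<And>t. q (c t) = b t"
    by (rule coupling_exists[OF X.pm_space Y.pm_space a(1) b(1)]) (rule that)
  interpret Z: pm Z by (rule pm.intro) fact
  have pm: "p \<in> measurable (pm_measure Z) (pm_measure (pm_rep X))"
    and qm: "q \<in> measurable (pm_measure Z) (pm_measure (pm_rep Y))"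
    using lipschitz_measurable[OF Z X.pm_space p] lipschitz_measurable[OF Z Y.pm_space q] lip by auto
  have "distr (pm_measure Z) (pm_measure (pm_rep X)) p = pm_measure (pm_rep X)"
    using distr_distr[OF pm c(1)] a(1) by (simp add: c(2) comp_def pq pm_parameter_def)
  then have leX: "lipschitz_le X (pm_iso `` {Z})"
    using lipschitz_le_class[OF XY(1) Z p] lip by blast
  have "distr (pm_measure Z) (pm_measure (pm_rep Y)) q = pm_measure (pm_rep Y)"
    using distr_distr[OF qm c(1)] b(1) by (simp add: c(2) comp_def pq pm_parameter_def)
  then have leY: "lipschitz_le Y (pm_iso `` {Z})"
    using lipschitz_le_class[OF XY(2) Z q] lip by blast
  have "pm_iso `` {Z} \<in> atom_pyramid \<alpha>"
    unfolding class_in_atom_pyramid[OF \<alpha> Z]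
    by (rule exI, rule Z.has_atoms_parameter[OF _ _ _ c]) (use \<alpha>D cc a(2) b(2) in \<open>auto\<close>)
  then show ?thesis using leX leY by blast
qed


section \<open>Box limits of spaces with prescribed atoms\<close>

text \<open>At the good times when \<open>b\<close> sits at the atom \<open>g i\<close>, the values
  of \<open>a\<close> are within \<epsilon> of each other, because the corresponding distances in
  \<open>y\<close> are 0; \<open>u i\<close> is one of these values. The mass of the bad times is
  lost only once for all of \<open>J\<close>.\<close>

lemma box_witness_atoms:
  assumes "pm_space x" "pm_space y" and w: "box_witness x y \<epsilon>" and at: "has_atoms \<beta> (pm_measure y) g"
  shows "\<exists>u. (\<forall>i. u i \<in> pm_points x) \<and> (\<forall>J. finite J \<longrightarrow>
    sum \<beta> J - \<epsilon> \<le> measure (pm_measure x) (\<Union>i\<in>J. Metric_space.mcball (pm_points x) (pm_dist x) (u i) \<epsilon>))"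
proof -
  interpret X: pm x by (rule pm.intro) fact
  interpret Y: pm y by (rule pm.intro) fact
  obtain a b I where ab: "pm_parameter x a" "pm_parameter y b" and \<epsilon>: "\<epsilon> > 0"
    and I: "I \<in> sets borel" "I \<subseteq> {0..1}" "measure lborel I \<ge> 1 - \<epsilon>"
      "\<And>s t. s \<in> I \<Longrightarrow> t \<in> I \<Longrightarrow> \<bar>pm_dist x (a s) (a t) - pm_dist y (b s) (b t)\<bar> \<le> \<epsilon>"
    using w unfolding box_witness_def by blast
  have am: "a \<in> measurable unit_measure (pm_measure x)" "distr unit_measure (pm_measure x) a = pm_measure x"
    and bm: "b \<in> measurable unit_measure (pm_measure y)" "distr unit_measure (pm_measure y) b = pm_measure y"
    using ab by (auto simp: pm_parameter_def)
  have aX: "a t \<in> pm_points x" and bY: "b t \<in> pm_points y" if "t \<in> {0..1}" for t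
    using measurable_space[OF am(1)] measurable_space[OF bm(1)] that
    by (auto simp: space_unit_measure X.space_eq Y.space_eq)
  have gY: "g i \<in> pm_points y" for i using at by (auto simp: has_atoms_def Y.space_eq)
  \<comment> \<open>If \<open>b\<close> is never at \<open>g i\<close> during a good time, the
    second clause is vacuous and the time 0 is a default.\<close>
  have "\<exists>v. v \<in> {0..1} \<and> (\<forall>t\<in>I. b t = g i \<longrightarrow> v \<in> I \<and> b v = g i)" for i
  proof (cases "\<exists>t\<in>I. b t = g i")
    case True
    then show ?thesis using I(2) by blast
  next
    case False
    then show ?thesis by (intro exI[of _ 0]) auto
  qed
  then obtain v where v: "\<And>i. v i \<in> {0..1}" "\<And>i t. t \<in> I \<Longrightarrow> b t = g i \<Longrightarrow> v i \<in> I \<and> b (v i) = g i"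
    by metis
  define u where "u i = a (v i)" for i
  have "sum \<beta> J - \<epsilon> \<le> X.prob (\<Union>i\<in>J. X.met.mcball (u i) \<epsilon>)" if J: "finite J" for J
  proof -
    let ?U = "\<Union>i\<in>J. X.met.mcball (u i) \<epsilon>"
    have U: "?U \<in> sets (pm_measure x)" using J by (intro sets.finite_UN X.cball_sets)
    have gJ: "g ` J \<in> sets (pm_measure y)" using J gY by (intro Y.finite_sets) auto
    define B where "B = b -` (g ` J) \<inter> {0..1}"
    have B: "B \<in> sets unit_measure"
      using measurable_sets[OF bm(1) gJ] by (simp add: B_def space_unit_measure)
    have Iu: "I \<in> sets unit_measure" using I by (simp add: sets_unit_measure)
    have aU: "a -` ?U \<inter> {0..1} \<in> sets unit_measure"
      using measurable_sets[OF am(1) U] by (simp add: space_unit_measure)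
    have sub: "B \<inter> I \<subseteq> a -` ?U \<inter> {0..1}"
    proof
      fix t assume t: "t \<in> B \<inter> I"
      then obtain i where i: "i \<in> J" "b t = g i" by (auto simp: B_def)
      have vi: "v i \<in> I" "b (v i) = g i" using v(2)[of t i] t i by auto
      have "t \<in> {0..1}" using t by (simp add: B_def)
      have "pm_dist y (b (v i)) (b t) = 0" using vi i gY by simp
      then have "pm_dist x (u i) (a t) \<le> \<epsilon>" using I(4)[of "v i" t] vi t by (simp add: u_def)
      then have "a t \<in> X.met.mcball (u i) \<epsilon>"
        using aX[OF \<open>t \<in> {0..1}\<close>] aX[OF v(1)] by (simp add: u_def)
      then show "t \<in> a -` ?U \<inter> {0..1}" using i \<open>t \<in> {0..1}\<close> by blast
    qed
    have "sum \<beta> J \<le> Y.prob (g ` J)" using at J by (simp add: has_atoms_def)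
    also have "\<dots> = unit.prob B"
      using measure_distr[OF bm(1) gJ] by (simp add: bm(2) B_def space_unit_measure)
    also have "\<dots> \<le> unit.prob (B \<inter> I) + unit.prob (space unit_measure - I)"
    proof -
      have Ic: "space unit_measure - I \<in> sets unit_measure" using Iu by (rule sets.compl_sets)
      have "unit.prob B \<le> unit.prob (B \<inter> I \<union> (space unit_measure - I))"
        using sets.sets_into_space[OF B]
        by (intro unit.finite_measure_mono sets.Un sets.Int Ic B Iu) auto
      also have "\<dots> \<le> unit.prob (B \<inter> I) + unit.prob (space unit_measure - I)"
        by (intro measure_Un_le sets.Int Ic B Iu)
      finally show ?thesis .
    qed
    also have "unit.prob (space unit_measure - I) \<le> \<epsilon>"
      using unit.prob_compl[OF Iu] measure_unit_measure[OF I(2)] I(3) by simp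
    also have "unit.prob (B \<inter> I) \<le> unit.prob (a -` ?U \<inter> {0..1})"
      by (rule unit.finite_measure_mono[OF sub aU])
    also have "\<dots> = X.prob ?U"
      using measure_distr[OF am(1) U] by (simp add: am(2) space_unit_measure)
    finally show ?thesis by simp
  qed
  moreover have "u i \<in> pm_points x" for i using aX v by (simp add: u_def)
  ultimately show ?thesis by blast
qed

context pm
begin

text \<open>
  A point lying in infinitely many of the balls is a limit of centres; there are such points since
  the upper limit of the balls has measure at least \<open>c\<close>.
\<close>

lemma heavy_balls_subseq:
  assumes x: "\<And>k. x k \<in> pm_points X" and e: "e \<longlonglongrightarrow> 0" and c: "c > 0"
    and heavy: "\<forall>\<^sub>F k in sequentially. c \<le> prob (met.mcball (x k) (e k))"
  shows "\<exists>z\<in>pm_points X. \<exists>r. strict_mono (r :: nat \<Rightarrow> nat) \<and> (\<lambda>k. pm_dist X (x (r k)) z) \<longlonglongrightarrow> 0"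
proof -
  obtain K where K: "\<And>k. k \<ge> K \<Longrightarrow> c \<le> prob (met.mcball (x k) (e k))"
    using heavy unfolding eventually_sequentially by blast
  define A where "A n = (\<Union>k\<in>{n..}. met.mcball (x k) (e k))" for n
  have A: "A n \<in> sets (pm_measure X)" for n
    unfolding A_def using cball_sets by (intro sets.countable_UN') auto
  have "decseq A" unfolding decseq_def A_def by (auto intro: order_trans)
  then have lim: "(\<lambda>n. prob (A n)) \<longlonglongrightarrow> prob (\<Inter>n. A n)"
    using A by (intro finite_Lim_measure_decseq) auto
  have "c \<le> prob (A n)" for n
  proof -
    have "c \<le> prob (met.mcball (x (max n K)) (e (max n K)))" by (rule K) simp
    also have "\<dots> \<le> prob (A n)"
      by (rule finite_measure_mono[OF _ A]) (unfold A_def, rule UN_upper, simp)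
    finally show ?thesis .
  qed
  then have "c \<le> prob (\<Inter>n. A n)" by (intro LIMSEQ_le_const[OF lim]) auto
  then have "(\<Inter>n. A n) \<noteq> {}" using c by (metis measure_empty not_le)
  then obtain z where z: "\<And>n. z \<in> A n" by blast
  define S where "S = {k. z \<in> met.mcball (x k) (e k)}"
  have "\<exists>k\<ge>n. k \<in> S" for n using z[of n] by (auto simp: A_def S_def)
  then have inf: "infinite S" unfolding infinite_nat_iff_unbounded_le by blast
  define r where "r = enumerate S"
  have r: "strict_mono r" unfolding r_def using inf by (rule strict_mono_enumerate)
  have rS: "r k \<in> S" for k unfolding r_def using inf by (rule enumerate_in_set)
  have "(\<lambda>k. pm_dist X (x (r k)) z) \<longlonglongrightarrow> 0"
  proof (rule tendsto_sandwich[OF _ _ tendsto_const])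
    show "(\<lambda>k. e (r k)) \<longlonglongrightarrow> 0" using LIMSEQ_subseq_LIMSEQ[OF e r] by (simp add: comp_def)
    show "\<forall>\<^sub>F k in sequentially. pm_dist X (x (r k)) z \<le> e (r k)"
      using rS by (intro always_eventually allI) (auto simp: S_def)
  qed simp
  moreover have "z \<in> pm_points X" using rS[of 0] by (auto simp: S_def)
  ultimately show ?thesis using r by blast
qed

lemma prob_finite_limit:
  assumes F: "finite F" "F \<subseteq> pm_points X"
  shows "(\<lambda>n. prob (\<Union>w\<in>F. met.mcball w (1 / Suc n))) \<longlonglongrightarrow> prob F"
proof -
  have "decseq (\<lambda>n. \<Union>w\<in>F. met.mcball w (1 / Suc n))"
  proof (unfold decseq_def, intro allI impI UN_mono subset_refl met.mcball_subset_concentric)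
    fix m n :: nat assume "m \<le> n"
    then show "1 / real (Suc n) \<le> 1 / real (Suc m)" by (simp add: frac_le)
  qed
  then have "(\<lambda>n. prob (\<Union>w\<in>F. met.mcball w (1 / Suc n))) \<longlonglongrightarrow> prob (\<Inter>n. \<Union>w\<in>F. met.mcball w (1 / Suc n))"
    using F by (intro finite_Lim_measure_decseq) (auto intro!: sets.finite_UN cball_sets)
  moreover have "(\<Inter>n. \<Union>w\<in>F. met.mcball w (1 / Suc n)) = F"
  proof (intro equalityI subsetI)
    fix y assume y: "y \<in> (\<Inter>n. \<Union>w\<in>F. met.mcball w (1 / Suc n))"
    show "y \<in> F"
    proof (rule ccontr)
      assume "y \<notin> F"
      have yX: "y \<in> pm_points X" using y by auto
      have "\<exists>d>0. \<forall>w\<in>F. d \<le> pm_dist X w y"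
      proof (cases "F = {}")
        case False
        then show ?thesis
          using F yX \<open>y \<notin> F\<close> by (intro exI[of _ "Min ((\<lambda>w. pm_dist X w y) ` F)"]) (auto simp: subset_iff)
      qed (auto intro: exI[of _ 1])
      then obtain d where d: "d > 0" "\<forall>w\<in>F. d \<le> pm_dist X w y" by blast
      then obtain n where "1 / real (Suc n) < d" using nat_approx_posE by metis
      moreover obtain w where "w \<in> F" "pm_dist X w y \<le> 1 / Suc n" using y by auto
      ultimately show False using d(2) by fastforce
    qed
  qed (use F in \<open>auto intro!: bexI\<close>)
  ultimately show ?thesis by simp
qed

text \<open>For positive \<open>\<alpha> i\<close> the balls around \<open>x k i\<close> eventually
  have mass above \<open>\<alpha> i / 2\<close>, so \<open>heavy_balls_subseq\<close> applies; a
  diagonal subsequence makes the centres converge for all such \<open>i\<close> at once. For a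
  finite group of these indices the balls then lie in any given neighbourhood of the limit points,
  and shrinking the neighbourhood bounds the mass of the limit points themselves. Centres belonging
  to weight 0 may escape; such indices add nothing to the sum and get an arbitrary point.\<close>

lemma has_atoms_limit:
  fixes \<beta> :: "nat \<Rightarrow> nat \<Rightarrow> real"
  assumes nonneg: "\<And>i. 0 \<le> \<alpha> i" and lim: "\<And>i. (\<lambda>k. \<beta> k i) \<longlonglongrightarrow> \<alpha> i" and e: "e \<longlonglongrightarrow> 0"
    and x: "\<And>k i. x k i \<in> pm_points X"
    and heavy: "\<And>k J. finite J \<Longrightarrow> sum (\<beta> k) J - e k \<le> prob (\<Union>i\<in>J. met.mcball (x k i) (e k))"
  shows "\<exists>f. has_atoms \<alpha> (pm_measure X) f"
proof -
  define P where "P i s \<longleftrightarrow> (0 < \<alpha> i \<longrightarrow> (\<exists>z\<in>pm_points X. (\<lambda>k. pm_dist X (x (s k) i) z) \<longlonglongrightarrow> 0))" for i and s :: "nat \<Rightarrow> nat"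
  interpret subseqs P
  proof
    fix i and s :: "nat \<Rightarrow> nat" assume s: "strict_mono s"
    show "\<exists>r. strict_mono r \<and> P i (s \<circ> r)"
    proof (cases "0 < \<alpha> i")
      case True
      have "(\<lambda>k. \<beta> (s k) i - e (s k)) \<longlonglongrightarrow> \<alpha> i - 0"
        using LIMSEQ_subseq_LIMSEQ[OF lim[of i] s] LIMSEQ_subseq_LIMSEQ[OF e s] by (intro tendsto_diff) (auto simp: comp_def)
      then have "\<forall>\<^sub>F k in sequentially. \<alpha> i / 2 < \<beta> (s k) i - e (s k)"
        by (rule order_tendstoD(1)) (use True in simp)
      then have "\<forall>\<^sub>F k in sequentially. \<alpha> i / 2 \<le> prob (met.mcball (x (s k) i) (e (s k)))"
      proof (rule eventually_mono)
        fix k assume "\<alpha> i / 2 < \<beta> (s k) i - e (s k)"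
        then show "\<alpha> i / 2 \<le> prob (met.mcball (x (s k) i) (e (s k)))" using heavy[of "{i}" "s k"] by simp
      qed
      moreover have "(\<lambda>k. e (s k)) \<longlonglongrightarrow> 0" using LIMSEQ_subseq_LIMSEQ[OF e s] by (simp add: comp_def)
      ultimately have "\<exists>z\<in>pm_points X. \<exists>r. strict_mono (r :: nat \<Rightarrow> nat) \<and> (\<lambda>k. pm_dist X (x (s (r k)) i) z) \<longlonglongrightarrow> 0"
        using True by (intro heavy_balls_subseq[of "\<lambda>k. x (s k) i" "\<lambda>k. e (s k)" "\<alpha> i / 2"] x) auto
      then show ?thesis unfolding P_def comp_def by blast
    qed (auto simp: P_def intro: exI[of _ id] strict_mono_id)
  qed
  have "P i (diagseq \<circ> ((+) (Suc i)))" for i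
  proof (rule diagseq_holds)
    fix r s :: "nat \<Rightarrow> nat" and n assume "strict_mono r" "P n s"
    then show "P n (s \<circ> r)"
      unfolding P_def using LIMSEQ_subseq_LIMSEQ[of _ _ r] by (fastforce simp: comp_def)
  qed
  then have "\<exists>z\<in>pm_points X. 0 < \<alpha> i \<longrightarrow> (\<lambda>k. pm_dist X (x (diagseq k) i) z) \<longlonglongrightarrow> 0" for i
  proof -
    assume *: "\<And>i. P i (diagseq \<circ> ((+) (Suc i)))"
    show ?thesis
    proof (cases "0 < \<alpha> i")
      case True
      then obtain z where z: "z \<in> pm_points X" "(\<lambda>k. pm_dist X (x (diagseq (Suc i + k)) i) z) \<longlonglongrightarrow> 0"
        using *[of i] unfolding P_def comp_def by blast
      \<comment> \<open>The diagonal sequence follows the \<open>i\<close>-th refinement only from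
        \<open>Suc i\<close> on; a shift of the index does not affect the limit.\<close>
      have "(\<lambda>k. pm_dist X (x (diagseq k) i) z) \<longlonglongrightarrow> 0"
        by (rule LIMSEQ_offset[of _ "Suc i"]) (use z(2) in \<open>simp add: add.commute\<close>)
      then show ?thesis using z(1) by blast
    qed (use points_nonempty in auto)
  qed
  then obtain z where z: "\<And>i. z i \<in> pm_points X" "\<And>i. 0 < \<alpha> i \<Longrightarrow> (\<lambda>k. pm_dist X (x (diagseq k) i) (z i)) \<longlonglongrightarrow> 0"
    by metis
  have "has_atoms \<alpha> (pm_measure X) z"
    unfolding has_atoms_def
  proof (intro conjI allI impI)
    show "range z \<subseteq> space (pm_measure X)" using z(1) by (auto simp: space_eq)
    fix J :: "nat set" assume J: "finite J"
    define J' where "J' = {i\<in>J. 0 < \<alpha> i}"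
    have J': "finite J'" using J by (simp add: J'_def)
    have "sum \<alpha> J' \<le> prob (\<Union>w\<in>z ` J'. met.mcball w (1 / Suc n))" for n
    proof -
      let ?r = "1 / real (Suc n)"
      let ?D = diagseq
      have eD: "(\<lambda>k. e (?D k)) \<longlonglongrightarrow> 0" using LIMSEQ_subseq_LIMSEQ[OF e subseq_diagseq] by (simp add: comp_def)
      have "\<forall>\<^sub>F k in sequentially. \<forall>i\<in>J'. pm_dist X (x (?D k) i) (z i) + e (?D k) < ?r"
      proof (rule eventually_ball_finite[OF J'], rule ballI)
        fix i assume "i \<in> J'"
        then have "(\<lambda>k. pm_dist X (x (?D k) i) (z i) + e (?D k)) \<longlonglongrightarrow> 0 + 0"
          using z(2) eD by (intro tendsto_add) (auto simp: J'_def)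
        then show "\<forall>\<^sub>F k in sequentially. pm_dist X (x (?D k) i) (z i) + e (?D k) < ?r"
          by (rule order_tendstoD(2)) simp
      qed
      then have ev: "\<forall>\<^sub>F k in sequentially. sum (\<beta> (?D k)) J' - e (?D k) \<le> prob (\<Union>w\<in>z ` J'. met.mcball w ?r)"
      proof (rule eventually_mono)
        fix k assume k: "\<forall>i\<in>J'. pm_dist X (x (?D k) i) (z i) + e (?D k) < ?r"
        have "met.mcball (x (?D k) i) (e (?D k)) \<subseteq> met.mcball (z i) ?r" if "i \<in> J'" for i
          using k that z(1) by (intro met.mcball_subset) (auto intro: less_imp_le)
        then have "(\<Union>i\<in>J'. met.mcball (x (?D k) i) (e (?D k))) \<subseteq> (\<Union>w\<in>z ` J'. met.mcball w ?r)" by blast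
        then have "prob (\<Union>i\<in>J'. met.mcball (x (?D k) i) (e (?D k))) \<le> prob (\<Union>w\<in>z ` J'. met.mcball w ?r)"
          using J' by (intro finite_measure_mono sets.finite_UN cball_sets) auto
        then show "sum (\<beta> (?D k)) J' - e (?D k) \<le> prob (\<Union>w\<in>z ` J'. met.mcball w ?r)"
          using heavy[OF J', of "?D k"] by linarith
      qed
      have "(\<lambda>k. sum (\<beta> (?D k)) J' - e (?D k)) \<longlonglongrightarrow> sum \<alpha> J' - 0"
        using LIMSEQ_subseq_LIMSEQ[OF lim subseq_diagseq]
        by (intro tendsto_diff tendsto_sum eD) (simp add: comp_def)
      then show ?thesis
        using tendsto_upperbound[OF _ ev] by simp
    qed
    then have "sum \<alpha> J' \<le> prob (z ` J')"
      using prob_finite_limit[of "z ` J'"] J' z(1) by (intro LIMSEQ_le_const[where X = "\<lambda>n. prob (\<Union>w\<in>z ` J'. met.mcball w (1 / Suc n))"]) auto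
    also have "\<dots> \<le> prob (z ` J)"
      using J z(1) by (intro finite_measure_mono finite_sets) (auto simp: J'_def)
    also have "sum \<alpha> J' = sum \<alpha> J"
      unfolding J'_def using J nonneg by (intro sum.mono_neutral_left) (auto simp: order.order_iff_strict)
    finally show "sum \<alpha> J \<le> prob (z ` J)" .
  qed
  then show ?thesis by blast
qed

end

text \<open>Varying weights let one statement serve twice: constant \<beta> gives box-closedness,
  and \<beta> converging to \<alpha> gives the second condition of weak convergence.\<close>

lemma atom_pyramid_limit:
  assumes \<alpha>: "\<alpha> \<in> atom_weights" and \<beta>: "\<And>k. \<beta> k \<in> atom_weights"
    and lim: "\<And>i. (\<lambda>k. apply_bcontfun (\<beta> k) i) \<longlonglongrightarrow> apply_bcontfun \<alpha> i"
    and X: "X \<in> pm_classes" and Y: "\<And>k. Y k \<in> atom_pyramid (\<beta> k)"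
    and near: "\<And>k. box_dist X (Y k) < 1 / Suc k"
  shows "X \<in> atom_pyramid \<alpha>"
proof -
  interpret X: pm "pm_rep X" by (rule pm.intro) (rule pm_space_rep[OF X])
  have "\<exists>u. (\<forall>i. u i \<in> pm_points (pm_rep X)) \<and> (\<forall>J. finite J \<longrightarrow>
    sum (apply_bcontfun (\<beta> k)) J - 1 / Suc k \<le> X.prob (\<Union>i\<in>J. X.met.mcball (u i) (1 / Suc k)))" for k
  proof -
    have YC: "Y k \<in> pm_classes" using Y by (simp add: atom_pyramid_def)
    obtain g where "has_atoms (apply_bcontfun (\<beta> k)) (pm_measure (pm_rep (Y k))) g"
      using Y atom_pyramid_iff[OF \<beta>] by blast
    then show ?thesis
      by (rule box_witness_atoms[OF X.pm_space pm_space_rep[OF YC] box_dist_less[OF X YC near]])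
  qed
  then obtain u where u: "\<And>k i. u k i \<in> pm_points (pm_rep X)"
    "\<And>k J. finite J \<Longrightarrow> sum (apply_bcontfun (\<beta> k)) J - 1 / Suc k \<le> X.prob (\<Union>i\<in>J. X.met.mcball (u k i) (1 / Suc k))"
    by metis
  have "\<exists>f. has_atoms (apply_bcontfun \<alpha>) (pm_measure (pm_rep X)) f"
    by (rule X.has_atoms_limit[OF atom_weightsD(1)[OF \<alpha>] lim _ u(1,2)])
      (use LIMSEQ_inverse_real_of_nat in \<open>simp_all add: inverse_eq_divide\<close>)
  then show ?thesis using atom_pyramid_iff[OF \<alpha>] X by blast
qed

lemma box_closed_atom_pyramid:
  assumes \<alpha>: "\<alpha> \<in> atom_weights"
  shows "box_closed (atom_pyramid \<alpha>)"
  unfolding box_closed_def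
proof (intro ballI impI)
  fix X assume X: "X \<in> pm_classes" and near: "\<forall>\<epsilon>>0. \<exists>Y\<in>atom_pyramid \<alpha>. box_dist X Y < \<epsilon>"
  have "\<exists>Y\<in>atom_pyramid \<alpha>. box_dist X Y < 1 / Suc k" for k using near by simp
  then obtain Y where "\<And>k. Y k \<in> atom_pyramid \<alpha>" "\<And>k. box_dist X (Y k) < 1 / Suc k" by metis
  then show "X \<in> atom_pyramid \<alpha>" by (intro atom_pyramid_limit[OF \<alpha> \<alpha> _ X]) auto
qed


section \<open>Approximation by spaces with perturbed atoms\<close>

context pm
begin

text \<open>A variant of Lusin's theorem. The unit interval is split into countably many Borel
  pieces on each of which \<open>a\<close> varies by less than \<epsilon>; finitely many of them,
  shrunk to compact sets, still have measure at least 1 - \<epsilon>. Disjoint compact sets have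
  positive distance, so sufficiently close points of \<open>K\<close> belong to the same
  piece.\<close>

lemma almost_uniformly_continuous:
  assumes a: "a \<in> measurable unit_measure (pm_measure X)" and \<epsilon>: "\<epsilon> > 0"
  shows "\<exists>K \<eta>. K \<in> sets unit_measure \<and> 1 - \<epsilon> \<le> measure unit_measure K \<and> 0 < \<eta> \<and>
    (\<forall>s\<in>K. \<forall>t\<in>K. \<bar>s - t\<bar> < \<eta> \<longrightarrow> pm_dist X (a s) (a t) \<le> \<epsilon>)"
proof -
  obtain q where q: "dense_seq q" using dense_seq_exists by blast
  then have qX: "q n \<in> pm_points X" for n by (simp add: dense_seq_def)
  have aX: "a t \<in> pm_points X" if "t \<in> {0..1}" for t
    using measurable_space[OF a] that by (simp add: space_unit_measure space_eq)
  define E where "E n = a -` met.mball (q n) (\<epsilon> / 2) \<inter> {0..1}" for n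
  define D where "D = disjointed E"
  have E: "E n \<in> sets unit_measure" for n
    using measurable_sets[OF a ball_sets[of "q n" "\<epsilon> / 2"]] by (simp add: E_def space_unit_measure)
  then have D: "D n \<in> sets unit_measure" for n
    unfolding D_def using sets.range_disjointed_sets[of E unit_measure] by blast
  have disj: "disjoint_family D" unfolding D_def by (rule disjoint_family_disjointed)
  have "(\<Union>n. E n) = {0..1}"
  proof (intro equalityI subsetI)
    fix t :: real assume t: "t \<in> {0..1}"
    then obtain n where "pm_dist X (q n) (a t) < \<epsilon> / 2"
      using q aX[OF t] \<epsilon> half_gt_zero[OF \<epsilon>] unfolding dense_seq_def by blast
    then show "t \<in> (\<Union>n. E n)" using t aX[OF t] qX by (auto simp: E_def)
  qed (auto simp: E_def)
  then have UD: "(\<Union>n. D n) = {0..1}" unfolding D_def by (simp add: UN_disjointed_eq)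
  have "(\<lambda>n. unit.prob (\<Union>i<n. D i)) \<longlonglongrightarrow> unit.prob (\<Union>n. \<Union>i<n. D i)"
    using D by (intro unit.finite_Lim_measure_incseq) (auto simp: incseq_def intro: less_le_trans)
  moreover have "(\<Union>n. \<Union>i<n. D i) = {0..1}" unfolding UD[symmetric] by blast
  moreover have "unit.prob {0..1} = 1" using unit.prob_space by (simp add: space_unit_measure)
  ultimately have "(\<lambda>n. unit.prob (\<Union>i<n. D i)) \<longlonglongrightarrow> 1" by simp
  then have "\<forall>\<^sub>F n in sequentially. 1 - \<epsilon> / 2 < unit.prob (\<Union>i<n. D i)"
    by (rule order_tendstoD(1)) (use \<epsilon> in simp)
  then obtain M where M: "1 - \<epsilon> / 2 < unit.prob (\<Union>i<M. D i)"
    using eventually_happens'[OF sequentially_bot] by blast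
  \<comment> \<open>The shrinking of \<open>M\<close> pieces may cost \<epsilon> / 2 in total; the
    summand 1 keeps \<delta> positive for \<open>M = 0\<close>.\<close>
  define \<delta> where "\<delta> = \<epsilon> / (2 * (real M + 1))"
  have \<delta>: "\<delta> > 0" "real M * \<delta> \<le> \<epsilon> / 2" using \<epsilon> by (auto simp: \<delta>_def field_simps)
  have "\<exists>C. compact C \<and> C \<subseteq> D n \<and> unit.prob (D n - C) \<le> \<delta>" for n
  proof -
    have Db: "D n \<in> sets borel" "D n \<subseteq> {0..1}" using D[of n] by (auto simp: sets_unit_measure)
    then have "D n \<in> sets lebesgue" by auto
    then obtain C where C: "closed C" "C \<subseteq> D n" "emeasure lebesgue (D n - C) < ennreal \<delta>"
      using sets_lebesgue_inner_closed[OF _ \<delta>(1)] by metis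
    have "compact C" using C(1,2) Db(2) by (meson bounded_closed_interval bounded_subset compact_eq_bounded_closed)
    moreover have "unit.prob (D n - C) \<le> \<delta>"
    proof -
      have "D n - C \<in> sets borel" using Db(1) C(1) by auto
      then have "emeasure lborel (D n - C) < ennreal \<delta>" using C(3) by simp
      then have "measure lborel (D n - C) \<le> \<delta>"
        unfolding measure_def using \<delta>(1) by (intro enn2real_leI) auto
      moreover have "unit.prob (D n - C) = measure lborel (D n - C)"
        using Db(2) by (intro measure_unit_measure) auto
      ultimately show ?thesis by simp
    qed
    ultimately show ?thesis using C(2) by blast
  qed
  then obtain C where C: "\<And>n. compact (C n)" "\<And>n. C n \<subseteq> D n" "\<And>n. unit.prob (D n - C n) \<le> \<delta>" by metis
  have Cu: "C n \<in> sets unit_measure" for n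
    using C(1)[of n] C(2)[of n] D[of n] by (auto simp: sets_unit_measure intro: borel_compact)
  define K where "K = (\<Union>i<M. C i)"
  have K: "K \<in> sets unit_measure" unfolding K_def using Cu by auto
  have "unit.prob (\<Union>i<M. D i) \<le> unit.prob (K \<union> (\<Union>i<M. D i - C i))"
    using K D Cu by (intro unit.finite_measure_mono) (auto simp: K_def)
  also have "\<dots> \<le> unit.prob K + unit.prob (\<Union>i<M. D i - C i)"
    using K D Cu by (intro measure_Un_le) auto
  also have "unit.prob (\<Union>i<M. D i - C i) \<le> (\<Sum>i<M. unit.prob (D i - C i))"
    using D Cu by (intro unit.finite_measure_subadditive_finite) auto
  also have "\<dots> \<le> (\<Sum>i<M. \<delta>)" by (intro sum_mono C(3))
  also have "\<dots> \<le> \<epsilon> / 2" using \<delta>(2) by simp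
  finally have mK: "1 - \<epsilon> \<le> unit.prob K" using M by simp
  have "\<exists>d>0. i \<noteq> j \<longrightarrow> (\<forall>s\<in>C i. \<forall>t\<in>C j. d \<le> dist s t)" for i j
  proof (cases "i = j")
    case False
    then have "D i \<inter> D j = {}" using disj unfolding disjoint_family_on_def by blast
    then have "C i \<inter> C j = {}" using C(2)[of i] C(2)[of j] by blast
    then show ?thesis using separate_compact_closed[OF C(1) compact_imp_closed[OF C(1)]] by blast
  qed (auto intro: exI[of _ 1])
  then obtain d where d: "\<And>i j. d i j > 0" "\<And>i j s t. i \<noteq> j \<Longrightarrow> s \<in> C i \<Longrightarrow> t \<in> C j \<Longrightarrow> d i j \<le> dist s t"
    by metis
  \<comment> \<open>The inserted 1 keeps the set non-empty for \<open>M = 0\<close>.\<close>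
  define \<eta> where "\<eta> = Min (insert 1 ((\<lambda>(i, j). d i j) ` ({..<M} \<times> {..<M})))"
  have \<eta>: "\<eta> > 0" unfolding \<eta>_def using d(1) by (subst Min_gr_iff) auto
  have "pm_dist X (a s) (a t) \<le> \<epsilon>" if st: "s \<in> K" "t \<in> K" "\<bar>s - t\<bar> < \<eta>" for s t
  proof -
    obtain i j where ij: "i < M" "j < M" "s \<in> C i" "t \<in> C j" using st(1,2) by (auto simp: K_def)
    have "\<eta> \<le> d i j" unfolding \<eta>_def using ij(1,2) by (intro Min_le) auto
    then have "i = j" using d(2)[OF _ ij(3,4)] st(3) by (fastforce simp: dist_real_def)
    moreover have "C n \<subseteq> E n" for n using C(2)[of n] disjointed_subset[of E n] by (auto simp: D_def)
    ultimately have "s \<in> E i" "t \<in> E i" using ij by auto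
    then have b: "pm_dist X (q i) (a s) < \<epsilon> / 2" "pm_dist X (q i) (a t) < \<epsilon> / 2" "s \<in> {0..1}" "t \<in> {0..1}"
      by (auto simp: E_def)
    have "pm_dist X (a s) (a t) \<le> pm_dist X (a s) (q i) + pm_dist X (q i) (a t)"
      by (intro met.triangle aX qX b)
    then show ?thesis using b by (simp add: met.commute)
  qed
  then show ?thesis using K mK \<eta> by blast
qed

text \<open>The new space lives on the same metric space, with the law of a parameter
  \<open>c\<close> that is constant on the intervals of \<beta>. On the first \<open>N\<close> of
  them \<open>c\<close> takes the old atoms, which is what \<open>a\<close> does wherever the
  intervals of \<alpha> and \<beta> overlap. The others are shorter than \<eta>, so a value of
  \<open>a\<close> at a time in \<open>K\<close> is within \<epsilon> of all values of
  \<open>a\<close> on \<open>K\<close> in the same interval. Both halves of the bound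
  \<open>2 * \<epsilon>\<close> are thus explained: measure is lost outside \<open>K\<close> and by
  misalignment, and distances change by \<epsilon> at each of two points.\<close>

lemma perturbed_atoms:
  assumes \<alpha>: "\<And>i. 0 \<le> \<alpha> i" "summable \<alpha>" "suminf \<alpha> \<le> 1"
    and f: "has_atoms \<alpha> (pm_measure X) f" and \<epsilon>: "\<epsilon> > 0"
  shows "\<exists>\<delta>>0. \<forall>\<beta>. (\<forall>i. 0 \<le> \<beta> i) \<and> summable \<beta> \<and> suminf \<beta> \<le> 1 \<and> (\<forall>i. \<bar>\<beta> i - \<alpha> i\<bar> \<le> \<delta>) \<longrightarrow>
    (\<exists>z g. pm_space z \<and> has_atoms \<beta> (pm_measure z) g \<and> box_witness X z (2 * \<epsilon>))"
proof -
  obtain a where a: "pm_parameter X a"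
      "\<And>i t. sum \<alpha> {..<i} \<le> t \<Longrightarrow> t < sum \<alpha> {..<Suc i} \<Longrightarrow> a t = f i"
    using atomic_parameter[OF \<alpha> f] by blast
  have am: "a \<in> measurable unit_measure (pm_measure X)" "distr unit_measure (pm_measure X) a = pm_measure X"
    using a(1) by (auto simp: pm_parameter_def)
  have aX: "a t \<in> pm_points X" if "t \<in> {0..1}" for t
    using measurable_space[OF am(1)] that by (simp add: space_unit_measure space_eq)
  have fX: "f i \<in> pm_points X" for i using f by (auto simp: has_atoms_def space_eq)
  obtain K \<eta> where K: "K \<in> sets unit_measure" "1 - \<epsilon> \<le> unit.prob K" and \<eta>: "0 < \<eta>"
    and close: "\<And>s t. s \<in> K \<Longrightarrow> t \<in> K \<Longrightarrow> \<bar>s - t\<bar> < \<eta> \<Longrightarrow> pm_dist X (a s) (a t) \<le> \<epsilon>"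
    using almost_uniformly_continuous[OF am(1) \<epsilon>] by blast
  have "\<forall>\<^sub>F i in sequentially. \<alpha> i < \<eta> / 2"
    using order_tendstoD(2)[OF summable_LIMSEQ_zero[OF \<alpha>(2)], of "\<eta> / 2"] \<eta> by simp
  then obtain N where N: "\<And>i. i \<ge> N \<Longrightarrow> \<alpha> i < \<eta> / 2" unfolding eventually_sequentially by blast
  \<comment> \<open>The first bound makes \<open>\<beta> i < \<eta>\<close> for
    \<open>i \<ge> N\<close>. For the second, the endpoints of each of the first \<open>N\<close>
    intervals move by at most \<open>N * \<delta>\<close>, so the misaligned parts have total
    measure at most \<open>2 * N * N * \<delta>\<close>; the summand 1 covers
    \<open>N = 0\<close>.\<close>
  define \<delta> where "\<delta> = min (\<eta> / 2) (\<epsilon> / (2 * (real N + 1)\<^sup>2))"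
  have \<delta>: "\<delta> > 0" "\<delta> \<le> \<eta> / 2" using \<eta> \<epsilon> by (auto simp: \<delta>_def)
  have N\<delta>: "real N * (2 * (real N * \<delta>)) \<le> \<epsilon>"
  proof -
    have "2 * real N ^ 2 * \<delta> \<le> 2 * (real N + 1)\<^sup>2 * \<delta>" using \<delta>(1) by (intro mult_right_mono) auto
    also have "\<dots> \<le> 2 * (real N + 1)\<^sup>2 * (\<epsilon> / (2 * (real N + 1)\<^sup>2))" by (intro mult_left_mono) (auto simp: \<delta>_def)
    also have "\<dots> = \<epsilon>" by simp
    finally show ?thesis by (simp add: power2_eq_square algebra_simps)
  qed
  have "\<exists>z g. pm_space z \<and> has_atoms \<beta> (pm_measure z) g \<and> box_witness X z (2 * \<epsilon>)"
    if \<beta>: "\<And>i. 0 \<le> \<beta> i" "summable \<beta>" "suminf \<beta> \<le> 1" and near: "\<And>i. \<bar>\<beta> i - \<alpha> i\<bar> \<le> \<delta>" for \<beta>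
  proof -
    define \<sigma> where "\<sigma> = suminf \<beta>"
    note stick = stick_interval[OF \<beta>(1,2), folded \<sigma>_def]
    define I where "I i = {sum \<beta> {..<i}..<sum \<beta> {..<Suc i}}" for i
    define I' where "I' i = {sum \<alpha> {..<i}..<sum \<alpha> {..<Suc i}}" for i
    \<comment> \<open>For a late interval that misses \<open>K\<close> no value is ever compared
      with \<open>a\<close>, and \<open>f 0\<close> is only a point at hand.\<close>
    define v where "v i = (if i < N then f i else if K \<inter> I i = {} then f 0 else a (SOME t. t \<in> K \<inter> I i))" for i
    define idx where "idx t = (LEAST i. t < sum \<beta> {..<Suc i})" for t
    define c where "c t = (if t < \<sigma> then v (idx t) else a t)" for t
    have K01: "K \<subseteq> {0..1}" using K(1) by (simp add: sets_unit_measure)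
    have pick: "(SOME t. t \<in> K \<inter> I i) \<in> K \<inter> I i" if "K \<inter> I i \<noteq> {}" for i
    proof -
      have "\<exists>t. t \<in> K \<inter> I i" using that by blast
      then show ?thesis by (rule someI_ex)
    qed
    have "a (SOME t. t \<in> K \<inter> I i) \<in> pm_points X" if "K \<inter> I i \<noteq> {}" for i
      using aX pick[OF that] K01 by blast
    then have vX: "v i \<in> pm_points X" for i
      using fX by (simp add: v_def)
    have [measurable]: "idx \<in> measurable borel (count_space UNIV)"
      unfolding idx_def by measurable
    have "(\<lambda>t. v (idx t)) \<in> measurable borel (pm_measure X)"
      using measurable_comp[of idx borel "count_space UNIV" v "pm_measure X"] vX by (simp add: comp_def space_eq)
    then have vm: "(\<lambda>t. v (idx t)) \<in> measurable unit_measure (pm_measure X)"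
      by (intro measurable_restrict_space1) (simp cong: measurable_cong_sets)
    have "{t \<in> space unit_measure. t < \<sigma>} \<in> sets unit_measure"
      unfolding sets_unit_measure space_unit_measure by auto
    then have cm: "c \<in> measurable unit_measure (pm_measure X)"
      unfolding c_def by (intro measurable_If[OF vm am(1)])
    have cI: "c t = v i" if "sum \<beta> {..<i} \<le> t" "t < sum \<beta> {..<Suc i}" for t i
      using stick(2)[OF that] stick(3)[of "Suc i"] that by (simp add: c_def idx_def)
    define z where "z = (fst X, distr unit_measure (pm_measure X) c)"
    have z: "pm_space z"
      unfolding z_def by (rule pm_space_distr[OF pm_space prob_space_unit_measure cm])
    interpret z: pm z by (rule pm.intro) fact
    have cz: "c \<in> measurable unit_measure (pm_measure z)" using cm by (simp add: z_def)
    have dz: "distr unit_measure (pm_measure z) c = pm_measure z"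
      unfolding z_def snd_conv by (rule distr_cong) auto
    have at: "has_atoms \<beta> (pm_measure z) (\<lambda>i. c (sum \<beta> {..<i}))"
      by (rule z.has_atoms_parameter[OF \<beta> cz dz]) (use cI in auto)
    define G where "G = K - (\<Union>i<N. I i - I' i)"
    have Im: "I i - I' i \<in> sets borel" for i by (auto simp: I_def I'_def)
    have near_sum: "\<bar>sum \<beta> {..<i} - sum \<alpha> {..<i}\<bar> \<le> real i * \<delta>" for i
    proof -
      have "\<bar>sum \<beta> {..<i} - sum \<alpha> {..<i}\<bar> \<le> (\<Sum>j<i. \<bar>\<beta> j - \<alpha> j\<bar>)"
        by (simp add: sum_subtractf[symmetric])
      also have "\<dots> \<le> (\<Sum>j<i. \<delta>)" by (intro sum_mono near)
      finally show ?thesis by simp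
    qed
    have small: "measure lborel (I i - I' i) \<le> 2 * (real N * \<delta>)" if "i < N" for i
    proof -
      let ?l = "sum \<beta> {..<i}" and ?r = "sum \<beta> {..<Suc i}" and ?l' = "sum \<alpha> {..<i}" and ?r' = "sum \<alpha> {..<Suc i}"
      have "I i - I' i \<subseteq> {?l..max ?l ?l'} \<union> {min ?r ?r'..?r}" by (auto simp: I_def I'_def)
      then have "measure lborel (I i - I' i) \<le> measure lborel ({?l..max ?l ?l'} \<union> {min ?r ?r'..?r})"
        using Im[of i] by (intro measure_mono_fmeasurable) (auto simp: fmeasurable_compact)
      also have "\<dots> \<le> measure lborel {?l..max ?l ?l'} + measure lborel {min ?r ?r'..?r}"
        by (intro measure_Un_le) auto
      also have "\<dots> \<le> \<bar>?l - ?l'\<bar> + \<bar>?r - ?r'\<bar>" by auto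
      also have "\<dots> \<le> real i * \<delta> + real (Suc i) * \<delta>" by (intro add_mono near_sum)
      also have "\<dots> \<le> real N * \<delta> + real N * \<delta>" using that \<delta>(1) by (intro add_mono mult_right_mono) auto
      finally show ?thesis by (simp add: algebra_simps)
    qed
    have I01: "I i \<subseteq> {0..1}" for i
      using stick(3)[of "Suc i"] \<beta>(3) sum_nonneg[of "{..<i}" \<beta>] \<beta>(1) by (auto simp: I_def \<sigma>_def)
    then have Iu: "I i - I' i \<in> sets unit_measure" for i
      using Im[of i] unfolding sets_unit_measure by blast
    then have UI: "(\<Union>i<N. I i - I' i) \<in> sets unit_measure" by (intro sets.finite_UN) auto
    have Gm: "G \<in> sets unit_measure" unfolding G_def using K(1) UI by (rule sets.Diff)
    have "unit.prob K \<le> unit.prob (G \<union> (\<Union>i<N. I i - I' i))"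
      by (rule unit.finite_measure_mono[OF _ sets.Un[OF Gm UI]]) (auto simp: G_def)
    also have "\<dots> \<le> unit.prob G + unit.prob (\<Union>i<N. I i - I' i)"
      by (intro measure_Un_le Gm UI)
    also have "unit.prob (\<Union>i<N. I i - I' i) \<le> (\<Sum>i<N. unit.prob (I i - I' i))"
      using Iu by (intro unit.finite_measure_subadditive_finite) auto
    also have "\<dots> \<le> (\<Sum>i<N. 2 * (real N * \<delta>))"
    proof (rule sum_mono)
      fix i assume "i \<in> {..<N}"
      moreover have "I i - I' i \<subseteq> {0..1}" using I01 by blast
      ultimately show "unit.prob (I i - I' i) \<le> 2 * (real N * \<delta>)" using small by (simp add: measure_unit_measure)
    qed
    also have "\<dots> \<le> \<epsilon>" using N\<delta> by simp
    finally have G: "1 - 2 * \<epsilon> \<le> unit.prob G" using K(2) by simp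
    have G01: "G \<subseteq> {0..1}" using K01 by (auto simp: G_def)
    have cX: "c t \<in> pm_points X" if "t \<in> {0..1}" for t
      using measurable_space[OF cm] that by (simp add: space_unit_measure space_eq)
    have ac: "pm_dist X (a t) (c t) \<le> \<epsilon>" if t: "t \<in> G" for t
    proof (cases "t < \<sigma>")
      case True
      have t01: "t \<in> {0..1}" using t G01 by blast
      then obtain i where i: "sum \<beta> {..<i} \<le> t" "t < sum \<beta> {..<Suc i}"
        using stick(1)[of t] True by auto
      have tI: "t \<in> I i" using i by (simp add: I_def)
      show ?thesis
      proof (cases "i < N")
        case True
        then have "t \<in> I' i" using t tI by (auto simp: G_def)
        then have "a t = c t" using a(2)[of i t] cI[OF i] True by (simp add: I'_def v_def)
        then show ?thesis using cX[OF t01] \<epsilon> by simp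
      next
        case False
        have "t \<in> K" using t by (simp add: G_def)
        then have ne: "K \<inter> I i \<noteq> {}" using tI by blast
        define s where "s = (SOME t. t \<in> K \<inter> I i)"
        have s: "s \<in> K" "s \<in> I i" using pick[OF ne] by (auto simp: s_def)
        have "c t = a s" using cI[OF i] False ne by (simp add: v_def s_def)
        moreover have "\<bar>t - s\<bar> < \<beta> i" using s(2) tI by (auto simp: I_def)
        moreover have "\<beta> i < \<eta>" using near[of i] N[of i] False \<delta>(2) by linarith
        ultimately show ?thesis using close[OF \<open>t \<in> K\<close> s(1)] by simp
      qed
    next
      case False
      then show ?thesis using t G01 aX \<epsilon> by (auto simp: c_def)
    qed
    have "\<bar>pm_dist X (a s) (a t) - pm_dist z (c s) (c t)\<bar> \<le> 2 * \<epsilon>" if st: "s \<in> G" "t \<in> G" for s t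
    proof -
      have pts: "a s \<in> pm_points X" "a t \<in> pm_points X" "c s \<in> pm_points X" "c t \<in> pm_points X"
        using st G01 aX cX by auto
      have "pm_dist X (a s) (a t) \<le> pm_dist X (a s) (c s) + pm_dist X (c s) (a t)"
        "pm_dist X (c s) (a t) \<le> pm_dist X (c s) (c t) + pm_dist X (c t) (a t)"
        "pm_dist X (c s) (c t) \<le> pm_dist X (c s) (a s) + pm_dist X (a s) (c t)"
        "pm_dist X (a s) (c t) \<le> pm_dist X (a s) (a t) + pm_dist X (a t) (c t)"
        by (intro met.triangle pts)+
      then show ?thesis
        using ac[OF st(1)] ac[OF st(2)] met.commute[of "c s" "a s"] met.commute[of "c t" "a t"]
        by (simp add: z_def)
    qed
    moreover have "pm_parameter z c" using cz dz by (simp add: pm_parameter_def)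
    moreover have "1 - 2 * \<epsilon> \<le> measure lborel G" using G measure_unit_measure[OF G01] by simp
    moreover have "G \<in> sets borel" using Gm by (simp add: sets_unit_measure)
    ultimately have "box_witness X z (2 * \<epsilon>)"
      unfolding box_witness_def using a(1) G01 \<epsilon> by (intro conjI exI[of _ a] exI[of _ c] exI[of _ G]) auto
    then show ?thesis using z at by blast
  qed
  then show ?thesis using \<delta>(1) by blast
qed

end


section \<open>Countable discrete spaces\<close>

text \<open>Test spaces whose points have prescribed masses and equal mutual distances. Membership
  in a pyramid of atoms depends on \<open>p\<close> alone; the distance \<delta> matters when
  principal pyramids are excluded, where it is taken large.\<close>

definition discrete_pm :: "real \<Rightarrow> nat pmf \<Rightarrow> pm" where
  "discrete_pm \<delta> p = (metric (range real, \<lambda>x y. if x = y then 0 else \<delta>),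
     distr (measure_pmf p) (count_space (range real)) real)"

lemma discrete_pm_space:
  assumes \<delta>: "\<delta> > 0"
  shows "pm_points (discrete_pm \<delta> p) = range real"
    and "pm_dist (discrete_pm \<delta> p) = (\<lambda>x y. if x = y then 0 else \<delta>)"
    and "pm_space (discrete_pm \<delta> p)"
    and "A \<subseteq> range real \<Longrightarrow> measure (pm_measure (discrete_pm \<delta> p)) A = measure_pmf.prob p (real -` A)"
    and "sets (pm_measure (discrete_pm \<delta> p)) = Pow (range real)"
proof -
  let ?d = "\<lambda>x y :: real. if x = y then 0 else \<delta>"
  interpret D: Metric_space "range real" ?d
    by unfold_locales (use \<delta> in auto)
  show pts: "pm_points (discrete_pm \<delta> p) = range real"
    and dist: "pm_dist (discrete_pm \<delta> p) = ?d"
    by (simp_all add: discrete_pm_def)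
  have meas: "real \<in> measurable (measure_pmf p) (count_space (range real))" by simp
  show sets: "sets (pm_measure (discrete_pm \<delta> p)) = Pow (range real)"
    by (simp add: discrete_pm_def)
  show "measure (pm_measure (discrete_pm \<delta> p)) A = measure_pmf.prob p (real -` A)" if "A \<subseteq> range real"
    using that by (simp add: discrete_pm_def measure_distr[OF meas])
  have "openin D.mtopology U" if "U \<subseteq> range real" for U
    unfolding D.openin_mtopology
  proof (intro conjI that allI impI)
    fix x assume "x \<in> U"
    moreover have "D.mball x \<delta> \<subseteq> {x}" by (auto split: if_splits)
    ultimately show "\<exists>r>0. D.mball x r \<subseteq> U" using \<delta> by blast
  qed
  then have opens: "{U. openin D.mtopology U} = Pow (range real)"
    using openin_subset[of D.mtopology] by auto
  have complete: "D.mcomplete"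
    unfolding D.mcomplete_def
  proof (intro allI impI)
    fix \<sigma> assume \<sigma>: "D.MCauchy \<sigma>"
    then obtain N where N: "\<And>n n'. N \<le> n \<Longrightarrow> N \<le> n' \<Longrightarrow> ?d (\<sigma> n) (\<sigma> n') < \<delta>"
      unfolding D.MCauchy_def using \<delta> by blast
    have const: "\<sigma> n = \<sigma> N" if "n \<ge> N" for n using N[of n N] that by (auto split: if_splits)
    have \<sigma>D: "\<sigma> n \<in> range real" for n using \<sigma> unfolding D.MCauchy_def by blast
    have "\<forall>\<^sub>F n in sequentially. ?d (\<sigma> n) (\<sigma> N) = 0"
      unfolding eventually_sequentially
    proof (intro exI allI impI)
      fix n assume "N \<le> n"
      then show "?d (\<sigma> n) (\<sigma> N) = 0" by (rule const[THEN if_P])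
    qed
    then have lim: "(\<lambda>n. ?d (\<sigma> n) (\<sigma> N)) \<longlonglongrightarrow> 0"
      by (rule tendsto_eventually)
    have pts: "\<forall>\<^sub>F n in sequentially. \<sigma> n \<in> range real"
      by (rule always_eventually, rule allI, rule \<sigma>D)
    have "limitin D.mtopology \<sigma> (\<sigma> N) sequentially"
      by (rule D.limitin_metric_dist_null[THEN iffD2], intro conjI, rule \<sigma>D, rule pts, rule lim)
    then show "\<exists>x. limitin D.mtopology \<sigma> x sequentially" by blast
  qed
  show "pm_space (discrete_pm \<delta> p)"
  proof (rule pm_spaceI[of _ "range real"])
    show "sets (pm_measure (discrete_pm \<delta> p)) =
        sigma_sets (pm_points (discrete_pm \<delta> p)) {U. openin (pm_topology (discrete_pm \<delta> p)) U}"
    proof -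
      have "pm_topology (discrete_pm \<delta> p) = D.mtopology" by (simp add: discrete_pm_def)
      then show ?thesis
        by (simp only: sets pts opens sigma_algebra.sigma_sets_eq[OF sigma_algebra_Pow])
    qed
    show "prob_space (pm_measure (discrete_pm \<delta> p))"
      unfolding discrete_pm_def snd_conv by (rule measure_pmf.prob_space_distr[OF meas])
    show "\<exists>c\<in>range real. pm_dist (discrete_pm \<delta> p) x c < e" if "x \<in> pm_points (discrete_pm \<delta> p)" "0 < e" for x e
      using that unfolding pts dist by (intro bexI[of _ x]) auto
  qed (use complete pts in \<open>auto simp: discrete_pm_def mcomplete_of_def\<close>)
qed

lemma discrete_has_atoms:
  assumes "\<delta> > 0" "\<And>J. finite J \<Longrightarrow> sum \<alpha> J \<le> measure_pmf.prob p (f ` J)"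
  shows "has_atoms \<alpha> (pm_measure (discrete_pm \<delta> p)) (\<lambda>i. real (f i))"
  unfolding has_atoms_def
proof (intro conjI allI impI)
  interpret pm "discrete_pm \<delta> p" by (rule pm.intro) (rule discrete_pm_space(3)[OF assms(1)])
  show "range (\<lambda>i. real (f i)) \<subseteq> space (pm_measure (discrete_pm \<delta> p))"
    unfolding space_eq discrete_pm_space(1)[OF assms(1)] by auto
  fix J :: "nat set" assume "finite J"
  moreover have "real -` (\<lambda>i. real (f i)) ` J = f ` J" by auto
  ultimately show "sum \<alpha> J \<le> prob ((\<lambda>i. real (f i)) ` J)"
    using assms by (subst discrete_pm_space(4)) auto
qed

lemma discrete_has_atomsE:
  assumes "\<delta> > 0" "has_atoms \<alpha> (pm_measure (discrete_pm \<delta> p)) f"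
  obtains g :: "nat \<Rightarrow> nat" where "\<And>J. finite J \<Longrightarrow> sum \<alpha> J \<le> measure_pmf.prob p (g ` J)"
proof -
  interpret pm "discrete_pm \<delta> p" by (rule pm.intro) (rule discrete_pm_space(3)[OF assms(1)])
  have f: "f i \<in> range real" for i
    using assms(2) unfolding has_atoms_def space_eq discrete_pm_space(1)[OF assms(1)] by blast
  then have "\<exists>n. f i = real n" for i by blast
  then obtain g where g: "\<And>i. f i = real (g i)" by metis
  show thesis
  proof (rule that)
    fix J :: "nat set" assume "finite J"
    then have "sum \<alpha> J \<le> prob (f ` J)" using assms(2) by (simp add: has_atoms_def)
    also have "\<dots> = measure_pmf.prob p (real -` f ` J)"
      using f by (intro discrete_pm_space(4)[OF assms(1)]) auto
    also have "real -` f ` J = g ` J" using g by auto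
    finally show "sum \<alpha> J \<le> measure_pmf.prob p (g ` J)" .
  qed
qed

lemma discrete_in_atom_pyramid:
  assumes \<alpha>: "\<alpha> \<in> atom_weights" and \<delta>: "\<delta> > 0"
  shows "pm_iso `` {discrete_pm \<delta> p} \<in> atom_pyramid \<alpha> \<longleftrightarrow>
    (\<exists>f. \<forall>J. finite J \<longrightarrow> sum (apply_bcontfun \<alpha>) J \<le> measure_pmf.prob p (f ` J))"
  unfolding class_in_atom_pyramid[OF \<alpha> discrete_pm_space(3)[OF \<delta>]]
  using discrete_has_atoms[OF \<delta>] discrete_has_atomsE[OF \<delta>] by metis

lemma sum_atom_weights_le_1:
  assumes "\<alpha> \<in> atom_weights" "finite J"
  shows "sum (apply_bcontfun \<alpha>) J \<le> 1"
  using sum_le_suminf[OF atom_weightsD(2)[OF assms(1)] assms(2)] atom_weightsD(1,3)[OF assms(1)]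
  by fastforce

lemma atom_weights_antimono:
  assumes "\<alpha> \<in> atom_weights" "i \<le> j"
  shows "apply_bcontfun \<alpha> j \<le> apply_bcontfun \<alpha> i"
  using atom_weightsD(4)[OF assms(1)] assms(2) by (rule lift_Suc_antimono_le)

lemma atom_pyramid_nonempty:
  assumes "\<alpha> \<in> atom_weights"
  shows "atom_pyramid \<alpha> \<noteq> {}"
proof -
  have "sum (apply_bcontfun \<alpha>) J \<le> measure_pmf.prob (return_pmf 0) ((\<lambda>_. 0 :: nat) ` J)" if "finite J" for J
    using sum_atom_weights_le_1[OF assms that] by (cases "J = {}") (auto simp: measure_return_pmf)
  then have "pm_iso `` {discrete_pm 1 (return_pmf 0)} \<in> atom_pyramid \<alpha>"
    using discrete_in_atom_pyramid[OF assms, of 1 "return_pmf 0"] by auto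
  then show ?thesis by blast
qed

text \<open>
  The witness has the atoms of \<open>\<alpha>\<close> together with \<open>r\<close> equal atoms for the remaining mass, all of them
  smaller than \<open>\<beta> k\<close>: so \<open>\<beta> 0, \<dots>, \<beta> k\<close> would have to fit into \<open>\<alpha> 0, \<dots>, \<alpha> (k - 1)\<close>.
\<close>

lemma atom_pyramid_not_subset:
  assumes \<alpha>: "\<alpha> \<in> atom_weights" and \<beta>: "\<beta> \<in> atom_weights"
    and eq: "\<And>i. i < k \<Longrightarrow> apply_bcontfun \<alpha> i = apply_bcontfun \<beta> i"
    and less: "apply_bcontfun \<alpha> k < apply_bcontfun \<beta> k"
  shows "\<not> atom_pyramid \<alpha> \<subseteq> atom_pyramid \<beta>"
proof -
  let ?a = "apply_bcontfun \<alpha>" and ?b = "apply_bcontfun \<beta>"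
  note \<alpha>D = atom_weightsD[OF \<alpha>] and \<beta>D = atom_weightsD[OF \<beta>]
  have bk: "0 < ?b k" using less \<alpha>D(1)[of k] by linarith
  define s where "s = 1 - suminf ?a"
  have s: "0 \<le> s" "s \<le> 1" using \<alpha>D suminf_nonneg[OF \<alpha>D(2,1)] by (auto simp: s_def)
  obtain m where m: "1 / real (Suc m) < ?b k" using nat_approx_posE[OF bk] by blast
  define r where "r = Suc m"
  have r: "s / real r < ?b k"
  proof -
    have "s / real r \<le> 1 / real r" using s by (intro divide_right_mono) auto
    then show ?thesis using m by (simp add: r_def)
  qed
  define w where "w j = (if j < r then s / real r else ?a (j - r))" for j
  have w0: "0 \<le> w j" for j using s \<alpha>D(1) by (simp add: w_def)
  have "(\<lambda>j. w (j + r)) sums suminf ?a"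
    using summable_sums[OF \<alpha>D(2)] by (simp add: w_def)
  then have "w sums (suminf ?a + sum w {..<r})" by (simp only: sums_iff_shift)
  moreover have "sum w {..<r} = s" by (simp add: w_def r_def)
  ultimately have w1: "w sums 1" by (simp add: s_def)
  have "(\<integral>\<^sup>+ j. ennreal (w j) \<partial>count_space UNIV) = 1"
    using w0 w1 by (simp add: nn_integral_count_space_nat suminf_ennreal2 sums_iff)
  then have pmf: "pmf (embed_pmf w) j = w j" for j
    using w0 by (intro pmf_embed_pmf) auto
  define p where "p = embed_pmf w"
  have "sum ?a J \<le> measure_pmf.prob p ((\<lambda>i. i + r) ` J)" if "finite J" for J
  proof -
    have "measure_pmf.prob p ((\<lambda>i. i + r) ` J) = sum (pmf p) ((\<lambda>i. i + r) ` J)"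
      using that by (intro measure_measure_pmf_finite) auto
    also have "\<dots> = sum ?a J"
      by (subst sum.reindex) (auto simp: p_def pmf w_def)
    finally show ?thesis by simp
  qed
  then have in\<alpha>: "pm_iso `` {discrete_pm 1 p} \<in> atom_pyramid \<alpha>"
    using discrete_in_atom_pyramid[OF \<alpha>, of 1 p] by (auto intro!: exI[of _ "\<lambda>i. i + r"])
  have "pm_iso `` {discrete_pm 1 p} \<notin> atom_pyramid \<beta>"
  proof
    assume "pm_iso `` {discrete_pm 1 p} \<in> atom_pyramid \<beta>"
    then obtain g where g: "\<And>J. finite J \<Longrightarrow> sum ?b J \<le> measure_pmf.prob p (g ` J)"
      using discrete_in_atom_pyramid[OF \<beta>, of 1 p] by auto
    have gk: "g i \<in> {r..<r + k}" if "i \<le> k" for i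
    proof -
      have "?b k \<le> ?b i" using atom_weights_antimono[OF \<beta> that] .
      also have "?b i \<le> w (g i)" using g[of "{i}"] by (simp add: measure_pmf_single p_def pmf)
      finally have b: "?b k \<le> w (g i)" .
      then have 1: "r \<le> g i" using r by (auto simp: w_def not_less[symmetric] split: if_splits)
      then have "?b k \<le> ?a (g i - r)" using b by (simp add: w_def)
      then have "g i - r < k" using less atom_weights_antimono[OF \<alpha>, of k "g i - r"] by (meson not_le order.strict_trans1 order.strict_trans2 linorder_not_less)
      then show ?thesis using 1 by auto
    qed
    \<comment> \<open>The \<open>k\<close> available points carry exactly the first \<open>k\<close>
      weights of \<beta> in total, too little by \<open>?b k\<close>.\<close>
    have "sum ?b {..k} \<le> measure_pmf.prob p (g ` {..k})" by (rule g) simp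
    also have "\<dots> \<le> measure_pmf.prob p {r..<r + k}"
      using gk by (intro measure_pmf.finite_measure_mono) auto
    also have "\<dots> = sum (pmf p) {r..<r + k}" by (intro measure_measure_pmf_finite) auto
    also have "\<dots> = sum ?a {..<k}"
      by (rule sum.reindex_bij_witness[of _ "\<lambda>i. i + r" "\<lambda>j. j - r"]) (auto simp: p_def pmf w_def)
    also have "\<dots> = sum ?b {..<k}" using eq by (intro sum.cong) auto
    finally show False using bk by (simp add: lessThan_Suc_atMost[symmetric])
  qed
  then show ?thesis using in\<alpha> by blast
qed

text \<open>At the first index where two sequences differ one of them is smaller, and
  \<open>atom_pyramid_not_subset\<close> separates their pyramids.\<close>

lemma inj_on_atom_pyramid: "inj_on atom_pyramid atom_weights"
proof (rule inj_onI, rule ccontr)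
  fix \<alpha> \<beta> assume \<alpha>: "\<alpha> \<in> atom_weights" and \<beta>: "\<beta> \<in> atom_weights"
    and eq: "atom_pyramid \<alpha> = atom_pyramid \<beta>" and "\<alpha> \<noteq> \<beta>"
  then have ex: "\<exists>k. apply_bcontfun \<alpha> k \<noteq> apply_bcontfun \<beta> k" using bcontfun_eqI by blast
  define k where "k = (LEAST k. apply_bcontfun \<alpha> k \<noteq> apply_bcontfun \<beta> k)"
  have k: "apply_bcontfun \<alpha> k \<noteq> apply_bcontfun \<beta> k" unfolding k_def by (rule LeastI_ex[OF ex])
  have "apply_bcontfun \<alpha> i = apply_bcontfun \<beta> i" if "i < k" for i
    using not_less_Least[of i] that unfolding k_def by blast
  then show False
    using atom_pyramid_not_subset[OF \<alpha> \<beta>, of k] atom_pyramid_not_subset[OF \<beta> \<alpha>, of k] eq k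
    by (metis linorder_less_linear order_refl)
qed


section \<open>Non-triviality\<close>

text \<open>In a uniform distribution on more than \<open>1 / \<alpha> 0\<close> points no point is
  heavy enough for the first weight.\<close>

lemma atom_pyramid_not_top:
  assumes \<alpha>: "\<alpha> \<in> atom_weights" and pos: "0 < apply_bcontfun \<alpha> 0"
  shows "atom_pyramid \<alpha> \<noteq> pm_classes"
proof -
  obtain m where m: "1 / real (Suc m) < apply_bcontfun \<alpha> 0" using nat_approx_posE[OF pos] by blast
  define p where "p = pmf_of_set {..<Suc m}"
  have "pm_iso `` {discrete_pm 1 p} \<notin> atom_pyramid \<alpha>"
  proof
    assume "pm_iso `` {discrete_pm 1 p} \<in> atom_pyramid \<alpha>"
    then obtain g where g: "\<And>J. finite J \<Longrightarrow> sum (apply_bcontfun \<alpha>) J \<le> measure_pmf.prob p (g ` J)"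
      using discrete_in_atom_pyramid[OF \<alpha>, of 1 p] by auto
    have "apply_bcontfun \<alpha> 0 \<le> pmf p (g 0)" using g[of "{0}"] by (simp add: measure_pmf_single)
    also have "\<dots> \<le> 1 / real (Suc m)"
      unfolding p_def by (subst pmf_of_set) (auto simp: indicator_def)
    finally show False using m by simp
  qed
  moreover have "pm_iso `` {discrete_pm 1 p} \<in> pm_classes"
    using pm.class_in pm.intro discrete_pm_space(3) zero_less_one by blast
  ultimately show ?thesis by blast
qed

text \<open>
  The two-point spaces with masses \<open>\<alpha> 0\<close> and \<open>1 - \<alpha> 0\<close> at arbitrarily large distance all belong
  to the pyramid, but a single space cannot dominate all of them.
\<close>

lemma atom_pyramid_not_principal:
  assumes \<alpha>: "\<alpha> \<in> atom_weights" and pos: "0 < apply_bcontfun \<alpha> 0" "apply_bcontfun \<alpha> 0 < 1"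
    and X: "X \<in> pm_classes"
  shows "atom_pyramid \<alpha> \<noteq> principal_pyramid X"
proof
  assume eq: "atom_pyramid \<alpha> = principal_pyramid X"
  let ?a = "apply_bcontfun \<alpha>"
  interpret R: pm "pm_rep X" by (rule pm.intro) (rule pm_space_rep[OF X])
  obtain x0 where x0: "x0 \<in> pm_points (pm_rep X)" using R.points_nonempty by blast
  have "(\<lambda>n. R.prob (R.met.mball x0 (real n))) \<longlonglongrightarrow> R.prob (\<Union>n. R.met.mball x0 (real n))"
    by (rule R.finite_Lim_measure_incseq)
      (auto simp: incseq_def R.ball_sets intro: less_le_trans)
  moreover have "(\<Union>n. R.met.mball x0 (real n)) = space (pm_measure (pm_rep X))"
    using x0 reals_Archimedean2 by (auto simp: R.space_eq)
  ultimately have "(\<lambda>n. R.prob (R.met.mball x0 (real n))) \<longlonglongrightarrow> 1" by (simp add: R.prob_space)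
  then have "\<forall>\<^sub>F n in sequentially. max (?a 0) (1 - ?a 0) < R.prob (R.met.mball x0 (real n))"
    by (rule order_tendstoD(1)) (use pos in simp)
  \<comment> \<open>With this much mass the ball must meet the fibre over either point of a
    two-point space with masses \<open>?a 0\<close> and \<open>1 - ?a 0\<close>.\<close>
  then obtain n where n: "max (?a 0) (1 - ?a 0) < R.prob (R.met.mball x0 (real n))"
    using eventually_happens'[OF sequentially_bot] by blast
  define B where "B = R.met.mball x0 (real n)"
  define p where "p = map_pmf (\<lambda>b. if b then 0 else 1 :: nat) (bernoulli_pmf (?a 0))"
  \<comment> \<open>Larger than any distance within the ball, which is at most
    \<open>2 * real n\<close>.\<close>
  define \<delta> where "\<delta> = 2 * real n + 1"
  have \<delta>: "\<delta> > 0" by (simp add: \<delta>_def)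
  have p0: "measure_pmf.prob p {0} = ?a 0" and p1: "measure_pmf.prob p {1} = 1 - ?a 0"
  proof -
    have "(\<lambda>b. if b then 0 else 1 :: nat) -` {0} = {True}" "(\<lambda>b. if b then 0 else 1 :: nat) -` {1} = {False}"
      by (auto split: if_splits)
    then show "measure_pmf.prob p {0} = ?a 0" "measure_pmf.prob p {1} = 1 - ?a 0"
      using pos unfolding p_def measure_map_pmf by (simp_all only: measure_pmf_single) auto
  qed
  \<comment> \<open>The first weight sits at the point 0 and fills it; all other weights together
    fit into the mass \<open>1 - ?a 0\<close> at the point 1.\<close>
  have "sum ?a J \<le> measure_pmf.prob p ((\<lambda>i. if i = 0 then 0 else 1) ` J)" if J: "finite J" for J
  proof -
    have "sum ?a (insert 0 J) \<le> 1" using sum_atom_weights_le_1[OF \<alpha>] J by blast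
    then have tail: "sum ?a (J - {0}) \<le> 1 - ?a 0" using J by (simp add: sum.insert_remove)
    show ?thesis
    proof (cases "0 \<in> J")
      case True
      show ?thesis
      proof (cases "J = {0}")
        case False
        then have "(\<lambda>i. if i = 0 then 0 else 1) ` J = {0, 1 :: nat}" using True by auto
        moreover have "set_pmf p \<subseteq> {0, 1}" by (auto simp: p_def)
        ultimately have "measure_pmf.prob p ((\<lambda>i. if i = 0 then 0 else 1) ` J) = 1"
          by (simp add: measure_pmf.prob_eq_1 AE_measure_pmf_iff subset_iff)
        then show ?thesis using sum_atom_weights_le_1[OF \<alpha> J] by simp
      qed (simp add: p0)
    next
      case False
      show ?thesis
      proof (cases "J = {}")
        case ne: False
        have "(\<lambda>i. if i = 0 then 0 else 1 :: nat) ` J = (\<lambda>_. 1) ` J"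
          using False by (intro image_cong refl) (metis (full_types))
        also have "\<dots> = {1}" using ne by (simp add: image_constant_conv)
        finally show ?thesis using tail False p1 by simp
      qed simp
    qed
  qed
  then have "pm_iso `` {discrete_pm \<delta> p} \<in> atom_pyramid \<alpha>"
    unfolding discrete_in_atom_pyramid[OF \<alpha> \<delta>] by blast
  then have "lipschitz_le (pm_iso `` {discrete_pm \<delta> p}) X" by (simp add: eq principal_pyramid_def)
  then obtain g where g: "g \<in> measurable (pm_measure (pm_rep X)) (pm_measure (discrete_pm \<delta> p))"
    "distr (pm_measure (pm_rep X)) (pm_measure (discrete_pm \<delta> p)) g = pm_measure (discrete_pm \<delta> p)"
    "\<And>x y. x \<in> pm_points (pm_rep X) \<Longrightarrow> y \<in> pm_points (pm_rep X) \<Longrightarrow>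
       pm_dist (discrete_pm \<delta> p) (g x) (g y) \<le> pm_dist (pm_rep X) x y"
    using class_lipschitz_le[OF X discrete_pm_space(3)[OF \<delta>]] by metis
  have meet: "\<exists>x\<in>B. g x = real j" if j: "1 < measure_pmf.prob p {j} + R.prob B" for j
  proof (rule ccontr)
    assume none: "\<not> (\<exists>x\<in>B. g x = real j)"
    let ?A = "g -` {real j} \<inter> space (pm_measure (pm_rep X))"
    have A: "?A \<in> sets (pm_measure (pm_rep X))"
      by (rule measurable_sets[OF g(1)]) (auto simp: discrete_pm_space(5)[OF \<delta>])
    have "R.prob ?A = measure (pm_measure (discrete_pm \<delta> p)) {real j}"
      using measure_distr[OF g(1), of "{real j}"] by (simp add: g(2) discrete_pm_space(5)[OF \<delta>])
    also have "\<dots> = measure_pmf.prob p {j}"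
      by (subst discrete_pm_space(4)[OF \<delta>]) (auto intro: arg_cong[of _ _ "measure_pmf.prob p"])
    finally have "1 < R.prob ?A + R.prob B" using j by simp
    also have "\<dots> = R.prob (?A \<union> B)"
      using none A by (intro R.finite_measure_Union[symmetric]) (auto simp: B_def R.ball_sets)
    also have "\<dots> \<le> 1" by (rule R.prob_le_1)
    finally show False by simp
  qed
  obtain x where x: "x \<in> B" "g x = real 0" using meet[of 0] n p0 by (auto simp: B_def)
  obtain y where y: "y \<in> B" "g y = real 1" using meet[of 1] n p1 by (auto simp: B_def)
  have xy: "x \<in> pm_points (pm_rep X)" "y \<in> pm_points (pm_rep X)" using x y by (auto simp: B_def)
  have "\<delta> \<le> pm_dist (pm_rep X) x y"
    using g(3)[OF xy] x y by (simp add: discrete_pm_space(2)[OF \<delta>])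
  also have "\<dots> \<le> pm_dist (pm_rep X) x x0 + pm_dist (pm_rep X) x0 y"
    by (intro R.met.triangle xy x0)
  also have "\<dots> \<le> 2 * real n" using x y by (simp add: B_def R.met.commute)
  finally show False by (simp add: \<delta>_def)
qed


section \<open>The embedding\<close>

lemma atom_pyramid_in_pyramids:
  assumes "\<alpha> \<in> atom_weights"
  shows "atom_pyramid \<alpha> \<in> pyramids"
proof -
  have "atom_pyramid \<alpha> \<subseteq> pm_classes" by (auto simp: atom_pyramid_def)
  then show ?thesis
    unfolding pyramids_def pyramid_def mem_Collect_eq
    using atom_pyramid_nonempty[OF assms] box_closed_atom_pyramid[OF assms]
      atom_pyramid_lipschitz_le[OF assms] atom_pyramid_directed[OF assms] by (intro conjI) blast+
qed

lemma atom_pyramid_nontrivial: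
  assumes "\<alpha> \<in> atom_weights" "0 < apply_bcontfun \<alpha> 0" "apply_bcontfun \<alpha> 0 < 1"
  shows "atom_pyramid \<alpha> \<in> nontrivial_pyramids"
  using atom_pyramid_in_pyramids atom_pyramid_not_top atom_pyramid_not_principal assms
  by (auto simp: nontrivial_pyramids_def)

section \<open>Continuity into the weak topology\<close>

lemma approximable_in_nearby_pyramids:
  assumes \<alpha>: "\<alpha> \<in> atom_weights" and X: "X \<in> atom_pyramid \<alpha>" and \<epsilon>: "\<epsilon> > 0"
  shows "\<exists>\<delta>>0. \<forall>\<beta>\<in>atom_weights. dist \<beta> \<alpha> < \<delta> \<longrightarrow> (\<exists>Y\<in>atom_pyramid \<beta>. box_dist X Y < \<epsilon>)"
proof -
  have XC: "X \<in> pm_classes" using X by (simp add: atom_pyramid_def)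
  interpret R: pm "pm_rep X" by (rule pm.intro) (rule pm_space_rep[OF XC])
  obtain f where f: "has_atoms (apply_bcontfun \<alpha>) (pm_measure (pm_rep X)) f"
    using X atom_pyramid_iff[OF \<alpha>] by blast
  obtain \<delta> where \<delta>: "\<delta> > 0" "\<forall>\<beta>. (\<forall>i. 0 \<le> \<beta> i) \<and> summable \<beta> \<and> suminf \<beta> \<le> 1 \<and> (\<forall>i. \<bar>\<beta> i - apply_bcontfun \<alpha> i\<bar> \<le> \<delta>) \<longrightarrow>
    (\<exists>z g. pm_space z \<and> has_atoms \<beta> (pm_measure z) g \<and> box_witness (pm_rep X) z (2 * (\<epsilon> / 3)))"
    using R.perturbed_atoms[OF atom_weightsD(1,2,3)[OF \<alpha>] f, of "\<epsilon> / 3"] \<epsilon> by auto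
  have "\<exists>Y\<in>atom_pyramid \<beta>. box_dist X Y < \<epsilon>" if \<beta>: "\<beta> \<in> atom_weights" and near: "dist \<beta> \<alpha> < \<delta>" for \<beta>
  proof -
    have "\<bar>apply_bcontfun \<beta> i - apply_bcontfun \<alpha> i\<bar> \<le> \<delta>" for i
      using dist_bounded[of \<beta> i \<alpha>] near by (simp add: dist_real_def)
    then obtain z g where z: "pm_space z" "has_atoms (apply_bcontfun \<beta>) (pm_measure z) g"
        "box_witness (pm_rep X) z (2 * (\<epsilon> / 3))"
      using \<delta>(2) atom_weightsD(1,2,3)[OF \<beta>] by blast
    have "pm_iso `` {z} \<in> atom_pyramid \<beta>" using class_in_atom_pyramid[OF \<beta> z(1)] z(2) by blast
    moreover have "box_dist X (pm_iso `` {z}) \<le> 2 * (\<epsilon> / 3)" by (rule box_dist_class_le[OF XC z(1,3)])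
    ultimately show ?thesis using \<epsilon> by force
  qed
  then show ?thesis using \<delta>(1) by blast
qed

lemma INF_box_dist_less:
  assumes "X \<in> pm_classes" "P \<subseteq> pm_classes" "P \<noteq> {}" "(INF Y\<in>P. box_dist X Y) < \<epsilon>"
  shows "\<exists>Y\<in>P. box_dist X Y < \<epsilon>"
proof -
  have "bdd_below (box_dist X ` P)"
    by (rule bdd_belowI[of _ 0]) (use box_dist_nonneg[OF assms(1)] assms(2) in auto)
  then show ?thesis using assms(3,4) by (subst (asm) cInf_less_iff) auto
qed

lemma atom_pyramid_weakly_converges:
  assumes \<alpha>: "\<alpha> \<in> atom_weights" and \<beta>: "\<And>n. \<beta> n \<in> atom_weights" and lim: "\<beta> \<longlonglongrightarrow> \<alpha>"
  shows "weakly_converges (\<lambda>n. atom_pyramid (\<beta> n)) (atom_pyramid \<alpha>)"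
  unfolding weakly_converges_def
proof (intro conjI ballI)
  have sub: "atom_pyramid (\<beta> n) \<subseteq> pm_classes" for n by (auto simp: atom_pyramid_def)
  have ne: "atom_pyramid (\<beta> n) \<noteq> {}" for n by (rule atom_pyramid_nonempty[OF \<beta>])
  fix X assume X: "X \<in> atom_pyramid \<alpha>"
  have XC: "X \<in> pm_classes" using X by (simp add: atom_pyramid_def)
  let ?e = "\<lambda>n. INF Y\<in>atom_pyramid (\<beta> n). box_dist X Y"
  \<comment> \<open>Near-minimisers do not refer to a prescribed precision, so that one sequence
    serves every \<open>c\<close> below.\<close>
  have "\<exists>Y\<in>atom_pyramid (\<beta> n). box_dist X Y < ?e n + 1 / Suc n" for n
    by (rule INF_box_dist_less[OF XC sub ne]) simp
  then obtain x where x: "\<And>n. x n \<in> atom_pyramid (\<beta> n)" "\<And>n. box_dist X (x n) < ?e n + 1 / Suc n" by metis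
  have nonneg: "0 \<le> box_dist X (x n)" for n using box_dist_nonneg[OF XC] x(1) sub by blast
  have bdd: "bdd_below (box_dist X ` atom_pyramid (\<beta> n))" for n
    by (rule bdd_belowI[of _ 0]) (use box_dist_nonneg[OF XC] sub in auto)
  have "(\<lambda>n. box_dist X (x n)) \<longlonglongrightarrow> 0"
  proof (rule order_tendstoI)
    fix c :: real assume "c < 0"
    then show "\<forall>\<^sub>F n in sequentially. c < box_dist X (x n)"
      using nonneg by (intro always_eventually allI) (rule less_le_trans)
  next
    fix c :: real assume c: "0 < c"
    obtain \<delta> where \<delta>: "\<delta> > 0" "\<And>\<beta>. \<beta> \<in> atom_weights \<Longrightarrow> dist \<beta> \<alpha> < \<delta> \<Longrightarrow> \<exists>Y\<in>atom_pyramid \<beta>. box_dist X Y < c / 2"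
      using approximable_in_nearby_pyramids[OF \<alpha> X, of "c / 2"] c by auto
    have "\<forall>\<^sub>F n in sequentially. dist (\<beta> n) \<alpha> < \<delta>" using lim \<delta>(1) by (rule tendstoD)
    moreover have "\<forall>\<^sub>F n in sequentially. 1 / real (Suc n) < c / 2"
      using order_tendstoD(2)[OF LIMSEQ_inverse_real_of_nat, of "c / 2"] c by (simp add: inverse_eq_divide)
    ultimately show "\<forall>\<^sub>F n in sequentially. box_dist X (x n) < c"
    proof eventually_elim
      case (elim n)
      obtain Y where Y: "Y \<in> atom_pyramid (\<beta> n)" "box_dist X Y < c / 2" using \<delta>(2)[OF \<beta> elim(1)] by blast
      have "?e n \<le> box_dist X Y" using cINF_lower[OF bdd Y(1)] .
      then show ?case using x(2)[of n] Y(2) elim(2) by linarith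
    qed
  qed
  then show "\<exists>x. (\<forall>n. x n \<in> atom_pyramid (\<beta> n)) \<and> (\<lambda>n. box_dist X (x n)) \<longlonglongrightarrow> 0" using x(1) by blast
next
  have sub: "atom_pyramid (\<beta> n) \<subseteq> pm_classes" for n by (auto simp: atom_pyramid_def)
  have ne: "atom_pyramid (\<beta> n) \<noteq> {}" for n by (rule atom_pyramid_nonempty[OF \<beta>])
  fix X assume X: "X \<in> pm_classes - atom_pyramid \<alpha>"
  let ?e = "\<lambda>n. INF Y\<in>atom_pyramid (\<beta> n). box_dist X Y"
  show "0 < liminf (\<lambda>n. ereal (?e n))"
  proof (rule ccontr)
    assume neg: "\<not> 0 < liminf (\<lambda>n. ereal (?e n))"
    have "\<exists>n\<ge>k. \<exists>Y\<in>atom_pyramid (\<beta> n). box_dist X Y < 1 / Suc k" for k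
    proof (rule ccontr)
      assume none: "\<not> (\<exists>n\<ge>k. \<exists>Y\<in>atom_pyramid (\<beta> n). box_dist X Y < 1 / Suc k)"
      have "ereal (1 / Suc k) \<le> ereal (?e n)" if "n \<ge> k" for n
        using INF_box_dist_less[of X "atom_pyramid (\<beta> n)" "1 / Suc k"] X sub ne none that by (meson DiffD1 ereal_less_eq(3) not_le)
      then have "ereal (1 / Suc k) \<le> liminf (\<lambda>n. ereal (?e n))"
        by (intro Liminf_bounded) (auto simp: eventually_sequentially)
      moreover have "0 < ereal (1 / Suc k)" by simp
      ultimately show False using neg by (meson less_le_trans)
    qed
    then obtain n Y where nY: "\<And>k. n k \<ge> k" "\<And>k. Y k \<in> atom_pyramid (\<beta> (n k))" "\<And>k. box_dist X (Y k) < 1 / Suc k"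
      by metis
    \<comment> \<open>The indices \<open>n k\<close> need not increase strictly;
      \<open>n k \<ge> k\<close> suffices for the limit.\<close>
    have "filterlim n at_top sequentially"
      by (rule filterlim_at_top_mono[OF filterlim_ident]) (simp add: nY(1))
    then have lim': "(\<lambda>k. \<beta> (n k)) \<longlonglongrightarrow> \<alpha>" by (rule filterlim_compose[OF lim])
    have "(\<lambda>k. apply_bcontfun (\<beta> (n k)) i) \<longlonglongrightarrow> apply_bcontfun \<alpha> i" for i
    proof (rule tendstoI)
      fix e :: real assume "e > 0"
      with lim' have "\<forall>\<^sub>F k in sequentially. dist (\<beta> (n k)) \<alpha> < e" by (rule tendstoD)
      then show "\<forall>\<^sub>F k in sequentially. dist (apply_bcontfun (\<beta> (n k)) i) (apply_bcontfun \<alpha> i) < e"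
        by eventually_elim (rule le_less_trans[OF dist_bounded])
    qed
    then have "X \<in> atom_pyramid \<alpha>"
      using X nY(2,3) by (intro atom_pyramid_limit[OF \<alpha> \<beta>]) auto
    then show False using X by simp
  qed
qed

text \<open>Weakly open sets are defined by sequences and the weights form a metric space, so
  convergence along sequences is all that has to be known.\<close>

lemma continuous_map_atom_pyramid:
  "continuous_map (top_of_set atom_weights) weak_topology atom_pyramid"
  unfolding continuous_map_def
proof (intro conjI allI impI)
  show "atom_pyramid \<in> topspace (top_of_set atom_weights) \<rightarrow> topspace weak_topology"
    using atom_pyramid_in_pyramids by (simp add: topspace_weak_topology)
  fix U assume "openin weak_topology U"
  then have U: "weak_open U" by (simp add: openin_weak_topology)
  have "\<exists>e>0. \<forall>\<beta>\<in>atom_weights. dist \<beta> \<alpha> < e \<longrightarrow> atom_pyramid \<beta> \<in> U"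
    if \<alpha>: "\<alpha> \<in> atom_weights" "atom_pyramid \<alpha> \<in> U" for \<alpha>
  proof (rule ccontr)
    assume neg: "\<not> (\<exists>e>0. \<forall>\<beta>\<in>atom_weights. dist \<beta> \<alpha> < e \<longrightarrow> atom_pyramid \<beta> \<in> U)"
    have "\<exists>\<beta>\<in>atom_weights. dist \<beta> \<alpha> < 1 / Suc n \<and> atom_pyramid \<beta> \<notin> U" for n
    proof -
      have "0 < 1 / real (Suc n)" by simp
      then show ?thesis using neg by blast
    qed
    then obtain \<beta> where \<beta>: "\<And>n. \<beta> n \<in> atom_weights" "\<And>n. dist (\<beta> n) \<alpha> < 1 / Suc n" "\<And>n. atom_pyramid (\<beta> n) \<notin> U"
      by metis
    have "(\<lambda>n. dist (\<beta> n) \<alpha>) \<longlonglongrightarrow> 0"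
    proof (rule tendsto_sandwich[OF _ _ tendsto_const LIMSEQ_inverse_real_of_nat])
      show "\<forall>\<^sub>F n in sequentially. dist (\<beta> n) \<alpha> \<le> inverse (real (Suc n))"
        using \<beta>(2) by (intro always_eventually allI) (simp add: inverse_eq_divide less_imp_le)
    qed simp
    then have "\<beta> \<longlonglongrightarrow> \<alpha>" by (rule tendsto_dist_iff[THEN iffD2])
    then have "weakly_converges (\<lambda>n. atom_pyramid (\<beta> n)) (atom_pyramid \<alpha>)"
      by (rule atom_pyramid_weakly_converges[OF \<alpha>(1) \<beta>(1)])
    moreover have "\<forall>\<sigma>. (\<forall>n. \<sigma> n \<in> pyramids) \<and> weakly_converges \<sigma> (atom_pyramid \<alpha>) \<longrightarrow>
        (\<forall>\<^sub>F n in sequentially. \<sigma> n \<in> U)"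
      using U \<alpha>(2) unfolding weak_open_def by blast
    ultimately have "\<forall>\<^sub>F n in sequentially. atom_pyramid (\<beta> n) \<in> U"
      using atom_pyramid_in_pyramids[OF \<beta>(1)] by simp
    then show False using \<beta>(3) by simp
  qed
  then show "openin (top_of_set atom_weights) {\<alpha> \<in> topspace (top_of_set atom_weights). atom_pyramid \<alpha> \<in> U}"
    unfolding openin_euclidean_subtopology_iff by auto
qed

section \<open>Compactness of the space of weights\<close>

lemma atom_weights_le_inverse:
  assumes "\<alpha> \<in> atom_weights"
  shows "apply_bcontfun \<alpha> i \<le> 1 / Suc i"
proof -
  have "real (Suc i) * apply_bcontfun \<alpha> i = (\<Sum>j\<le>i. apply_bcontfun \<alpha> i)" by simp
  also have "\<dots> \<le> (\<Sum>j\<le>i. apply_bcontfun \<alpha> j)" by (intro sum_mono atom_weights_antimono[OF assms]) auto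
  also have "\<dots> \<le> 1" by (rule sum_atom_weights_le_1[OF assms]) simp
  finally show ?thesis by (simp add: field_simps)
qed

text \<open>Tychonoff's theorem in its sequential form. It yields coordinatewise convergent
  subsequences, here of weights and later of approximate fixed points.\<close>

lemma seq_compact_unit_cube: "seq_compact (PiE UNIV (\<lambda>_ :: nat. {0..1 :: real}))"
proof -
  have "compactin (product_topology (\<lambda>_. euclidean) UNIV) (PiE UNIV (\<lambda>_ :: nat. {0..1 :: real}))"
    by (subst compactin_PiE) auto
  then show ?thesis by (simp add: euclidean_product_topology compact_eq_seq_compact_metric)
qed

text \<open>The entries tend to 0 uniformly, so that pointwise convergence is uniform.\<close>

lemma seq_compact_atom_weights: "seq_compact atom_weights"
  unfolding seq_compact_def
proof (intro allI impI)
  fix \<beta> :: "nat \<Rightarrow> nat \<Rightarrow>\<^sub>C real" assume "\<forall>n. \<beta> n \<in> atom_weights"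
  then have \<beta>: "\<beta> n \<in> atom_weights" for n by simp
  let ?K = "PiE UNIV (\<lambda>_ :: nat. {0..1 :: real})"
  have "apply_bcontfun (\<beta> n) \<in> ?K" for n
  proof -
    have "apply_bcontfun (\<beta> n) i \<le> 1" for i using sum_atom_weights_le_1[OF \<beta>, of "{i}"] by simp
    then show ?thesis using atom_weightsD(1)[OF \<beta>] by auto
  qed
  then obtain l r where l: "l \<in> ?K" and r: "strict_mono (r :: nat \<Rightarrow> nat)"
    and lim: "((\<lambda>n. apply_bcontfun (\<beta> n)) \<circ> r) \<longlonglongrightarrow> l"
    using seq_compact_unit_cube unfolding seq_compact_def by meson
  have limi: "(\<lambda>n. apply_bcontfun (\<beta> (r n)) i) \<longlonglongrightarrow> l i" for i
    using continuous_on_tendsto_compose[OF continuous_on_product_coordinates lim] by (simp add: comp_def)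
  have l0: "0 \<le> l i" for i by (rule LIMSEQ_le_const[OF limi]) (use atom_weightsD(1)[OF \<beta>] in auto)
  have l1: "sum l J \<le> 1" if "finite J" for J
  proof (rule LIMSEQ_le_const2)
    show "(\<lambda>n. sum (apply_bcontfun (\<beta> (r n))) J) \<longlonglongrightarrow> sum l J" by (intro tendsto_sum limi)
  qed (use sum_atom_weights_le_1[OF \<beta> that] in auto)
  have summ: "summable l" by (rule summableI_nonneg_bounded[of _ 1]) (use l0 l1 in auto)
  have lb: "l \<in> bcontfun"
  proof (rule bcontfun_normI)
    show "norm (l i) \<le> 1" for i using l1[of "{i}"] l0[of i] by simp
  qed simp
  define \<alpha> where "\<alpha> = Bcontfun l"
  have a: "apply_bcontfun \<alpha> = l" unfolding \<alpha>_def using lb by (rule Bcontfun_inverse)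
  have "l (Suc i) \<le> l i" for i
    by (rule LIMSEQ_le[OF limi limi]) (use atom_weightsD(4)[OF \<beta>] in auto)
  then have \<alpha>: "\<alpha> \<in> atom_weights"
    unfolding atom_weights_def a mem_Collect_eq
    using l0 summ l1 by (intro conjI allI suminf_le_const) auto
  have "(\<beta> \<circ> r) \<longlonglongrightarrow> \<alpha>"
  proof (rule metric_LIMSEQ_I)
    fix e :: real assume e: "e > 0"
    \<comment> \<open>From \<open>N\<close> on, entries of both sequences lie between 0 and
      \<open>e / 2\<close> by \<open>atom_weights_le_inverse\<close>, which leaves finitely many
      coordinates to control.\<close>
    obtain N where N: "1 / real (Suc N) < e / 2" using e nat_approx_posE by (metis half_gt_zero)
    have "\<forall>\<^sub>F n in sequentially. \<forall>i\<in>{..<N}. dist (apply_bcontfun (\<beta> (r n)) i) (l i) < e / 2"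
      using e by (intro eventually_ball_finite ballI tendstoD[OF limi]) auto
    then obtain M where M: "\<And>n i. n \<ge> M \<Longrightarrow> i < N \<Longrightarrow> dist (apply_bcontfun (\<beta> (r n)) i) (l i) < e / 2"
      unfolding eventually_sequentially by blast
    have "dist (\<beta> (r n)) \<alpha> < e" if "n \<ge> M" for n
    proof -
      have "dist (apply_bcontfun (\<beta> (r n)) i) (apply_bcontfun \<alpha> i) \<le> e / 2" for i
      proof (cases "i < N")
        case True
        then show ?thesis using M[OF that True] by (simp add: a)
      next
        case False
        have "1 / real (Suc i) \<le> 1 / real (Suc N)" using False by (intro divide_left_mono) auto
        then have "apply_bcontfun (\<beta> (r n)) i \<le> e / 2" "l i \<le> e / 2"
          using atom_weights_le_inverse[OF \<beta>, of "r n" i] atom_weights_le_inverse[OF \<alpha>, of i] N by (auto simp: a)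
        then show ?thesis using atom_weightsD(1)[OF \<beta>, of "r n" i] l0[of i]
          unfolding a dist_real_def by linarith
      qed
      then have "dist (\<beta> (r n)) \<alpha> \<le> e / 2" by (rule dist_bound)
      then show ?thesis using e by simp
    qed
    then show "\<exists>M. \<forall>n\<ge>M. dist ((\<beta> \<circ> r) n) \<alpha> < e" by auto
  qed
  then show "\<exists>l\<in>atom_weights. \<exists>r. strict_mono r \<and> (\<beta> \<circ> r) \<longlonglongrightarrow> l" using \<alpha> r by blast
qed

section \<open>Uniqueness of weak limits and closedness of the map\<close>

lemma weakly_converges_subseq:
  assumes "weakly_converges \<sigma> P" "strict_mono r"
  shows "weakly_converges (\<sigma> \<circ> r) P"
  unfolding weakly_converges_def
proof (intro conjI ballI)
  fix X assume "X \<in> P"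
  then obtain x where x: "\<forall>n. x n \<in> \<sigma> n" "(\<lambda>n. box_dist X (x n)) \<longlonglongrightarrow> 0"
    using assms(1) unfolding weakly_converges_def by blast
  then show "\<exists>x. (\<forall>n. x n \<in> (\<sigma> \<circ> r) n) \<and> (\<lambda>n. box_dist X (x n)) \<longlonglongrightarrow> 0"
    using LIMSEQ_subseq_LIMSEQ[OF x(2) assms(2)] by (intro exI[of _ "x \<circ> r"]) (auto simp: comp_def)
next
  fix X assume "X \<in> pm_classes - P"
  then have "0 < liminf (\<lambda>n. ereal (INF Y\<in>\<sigma> n. box_dist X Y))"
    using assms(1) unfolding weakly_converges_def by blast
  also have "\<dots> \<le> liminf ((\<lambda>n. ereal (INF Y\<in>\<sigma> n. box_dist X Y)) \<circ> r)"
    by (rule liminf_subseq_mono[OF assms(2)])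
  finally show "0 < liminf (\<lambda>n. ereal (INF Y\<in>(\<sigma> \<circ> r) n. box_dist X Y))" by (simp add: comp_def)
qed

text \<open>A member of \<open>P\<close> is approached by members of \<open>\<sigma> n\<close>;
  outside \<open>Q\<close> this would contradict the positive lower limit that convergence to
  \<open>Q\<close> requires. Exchanging \<open>P\<close> and \<open>Q\<close> gives
  uniqueness.\<close>

lemma weakly_converges_subset:
  assumes \<sigma>: "\<And>n. \<sigma> n \<subseteq> pm_classes" and P: "P \<subseteq> pm_classes"
    and wP: "weakly_converges \<sigma> P" and wQ: "weakly_converges \<sigma> Q"
  shows "P \<subseteq> Q"
proof (rule ccontr)
  assume "\<not> P \<subseteq> Q"
  then obtain X where X: "X \<in> P" "X \<notin> Q" by blast
  have XC: "X \<in> pm_classes" using X P by blast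
  obtain x where x: "\<And>n. x n \<in> \<sigma> n" "(\<lambda>n. box_dist X (x n)) \<longlonglongrightarrow> 0"
    using wP X(1) unfolding weakly_converges_def by blast
  have pos: "0 < liminf (\<lambda>n. ereal (INF Y\<in>\<sigma> n. box_dist X Y))"
    using wQ X(2) XC unfolding weakly_converges_def by blast
  have "(INF Y\<in>\<sigma> n. box_dist X Y) \<le> box_dist X (x n)" for n
  proof (rule cINF_lower[OF _ x(1)])
    show "bdd_below (box_dist X ` \<sigma> n)"
      by (rule bdd_belowI[of _ 0]) (use box_dist_nonneg[OF XC] \<sigma>[of n] in auto)
  qed
  then have "liminf (\<lambda>n. ereal (INF Y\<in>\<sigma> n. box_dist X Y)) \<le> liminf (\<lambda>n. ereal (box_dist X (x n)))"
    by (intro Liminf_mono always_eventually allI) simp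
  also have "\<dots> = 0"
  proof (rule lim_imp_Liminf[OF sequentially_bot])
    show "(\<lambda>n. ereal (box_dist X (x n))) \<longlonglongrightarrow> 0" using x(2) by (simp add: zero_ereal_def)
  qed
  finally show False using pos by simp
qed

text \<open>A sequence that enters the image infinitely often gives weights in \<open>C\<close>, and
  a subsequence of them converges in \<open>C\<close>. Its pyramids converge weakly both to a
  pyramid of the image and to \<open>P\<close>, so \<open>P\<close> belongs to the image.\<close>

lemma closedin_image_atom_pyramid:
  assumes C: "closedin (top_of_set atom_weights) C"
  shows "closedin weak_topology (atom_pyramid ` C)"
proof -
  have CV: "C \<subseteq> atom_weights" using closedin_subset[OF C] by simp
  have scC: "seq_compact C"
    using closedin_compact[OF _ C] seq_compact_atom_weights by (simp add: compact_eq_seq_compact_metric)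
  have "weak_open (pyramids - atom_pyramid ` C)"
    unfolding weak_open_def
  proof (intro conjI ballI allI impI)
    fix P \<sigma> assume P: "P \<in> pyramids - atom_pyramid ` C"
      and \<sigma>: "(\<forall>n. \<sigma> n \<in> pyramids) \<and> weakly_converges \<sigma> P"
    show "\<forall>\<^sub>F n in sequentially. \<sigma> n \<in> pyramids - atom_pyramid ` C"
    proof (rule ccontr)
      assume "\<not> ?thesis"
      then have "\<forall>N. \<exists>n\<ge>N. n \<in> {n. \<sigma> n \<in> atom_pyramid ` C}"
        using \<sigma> unfolding eventually_sequentially by blast
      then have inf: "infinite {n. \<sigma> n \<in> atom_pyramid ` C}" unfolding infinite_nat_iff_unbounded_le .
      define s where "s = enumerate {n. \<sigma> n \<in> atom_pyramid ` C}"
      have s: "strict_mono s" unfolding s_def using inf by (rule strict_mono_enumerate)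
      have "\<sigma> (s n) \<in> atom_pyramid ` C" for n
        using enumerate_in_set[OF inf, of n] by (simp add: s_def)
      then have "\<exists>\<beta>. \<beta> \<in> C \<and> \<sigma> (s n) = atom_pyramid \<beta>" for n by blast
      then obtain \<beta> where \<beta>: "\<And>n. \<beta> n \<in> C" "\<And>n. \<sigma> (s n) = atom_pyramid (\<beta> n)" by metis
      obtain \<alpha> r where \<alpha>: "\<alpha> \<in> C" and r: "strict_mono r" and lim: "(\<beta> \<circ> r) \<longlonglongrightarrow> \<alpha>"
        using scC \<beta>(1) unfolding seq_compact_def by metis
      have w: "weakly_converges (\<lambda>n. atom_pyramid ((\<beta> \<circ> r) n)) (atom_pyramid \<alpha>)"
        using \<alpha> \<beta>(1) CV by (intro atom_pyramid_weakly_converges lim) auto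
      have w': "weakly_converges (\<lambda>n. atom_pyramid ((\<beta> \<circ> r) n)) P"
        using weakly_converges_subseq[OF weakly_converges_subseq[OF _ s] r, of \<sigma> P] \<sigma> by (simp add: comp_def \<beta>(2))
      have cl: "atom_pyramid \<gamma> \<subseteq> pm_classes" for \<gamma> by (auto simp: atom_pyramid_def)
      have "P \<subseteq> pm_classes" using P by (auto simp: pyramids_def pyramid_def)
      then have "P = atom_pyramid \<alpha>"
        using weakly_converges_subset[OF cl _ w' w] weakly_converges_subset[OF cl cl w w'] by blast
      then show False using P \<alpha> by blast
    qed
  qed blast
  then have "openin weak_topology (topspace weak_topology - atom_pyramid ` C)"
    by (simp add: openin_weak_topology topspace_weak_topology)
  then show ?thesis
    using atom_pyramid_in_pyramids CV by (auto simp: closedin_def topspace_weak_topology)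
qed

lemma embedding_map_atom_pyramid:
  "embedding_map (top_of_set atom_weights) weak_topology atom_pyramid"
proof (rule injective_closed_imp_embedding_map)
  show "closed_map (top_of_set atom_weights) weak_topology atom_pyramid"
    using closedin_image_atom_pyramid by (simp add: closed_map_def)
qed (simp_all add: continuous_map_atom_pyramid inj_on_atom_pyramid)


section \<open>Brouwer's theorem on cubes of arbitrary dimension\<close>

text \<open>
  For types of class \<open>euclidean_space\<close> the dimension of Brouwer's fixed point theorem cannot be
  quantified over. In Kuhn's combinatorial lemma it is a parameter.
\<close>

definition unit_cube :: "nat \<Rightarrow> (nat \<Rightarrow> real) set" where
  "unit_cube n = {x. \<forall>i<n. 0 \<le> x i \<and> x i \<le> 1}"

text \<open>The label of a grid point in coordinate \<open>i\<close> records whether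
  \<open>F\<close> moves it up or down there. Kuhn's lemma provides a cell with both labels in every
  coordinate. The points \<open>r\<close> and \<open>s\<close> depend on the coordinate; a common
  fixed point appears only in the limit of finer grids.\<close>

lemma cube_approx_fixed_point:
  assumes F: "\<And>x i. x \<in> unit_cube n \<Longrightarrow> i < n \<Longrightarrow> 0 \<le> F x i \<and> F x i \<le> 1" and p: "p > 0"
  shows "\<exists>q. (\<forall>i. 0 \<le> q i \<and> q i \<le> 1) \<and> (\<forall>i<n. \<exists>r\<in>unit_cube n. \<exists>s\<in>unit_cube n.
    (\<forall>j<n. \<bar>r j - q j\<bar> \<le> 1 / real p) \<and> (\<forall>j<n. \<bar>s j - q j\<bar> \<le> 1 / real p) \<and> r i \<le> F r i \<and> F s i \<le> s i)"
proof -
  define pt where "pt x j = real (x j) / real p" for x :: "nat \<Rightarrow> nat" and j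
  \<comment> \<open>Where \<open>x i = p\<close>, label 1 is prescribed, even if \<open>F\<close>
    fixes the coordinate at 1. It remains correct there as \<open>F\<close> has values at most
    1.\<close>
  define label where "label x i = (if x i \<noteq> p \<and> pt x i \<le> F (pt x) i then 0 else 1 :: nat)" for x i
  have cube: "pt x \<in> unit_cube n" if "\<forall>i<n. x i \<le> p" for x
    using that p by (auto simp: unit_cube_def pt_def)
  obtain q where q: "\<forall>i<n. q i < p"
    and lab: "\<forall>i<n. \<exists>r s. (\<forall>j<n. q j \<le> r j \<and> r j \<le> q j + 1) \<and> (\<forall>j<n. q j \<le> s j \<and> s j \<le> q j + 1) \<and> label r i \<noteq> label s i"
  proof (rule kuhn_lemma[OF p, of n label])
    show "\<forall>x. (\<forall>i<n. x i \<le> p) \<longrightarrow> (\<forall>i<n. label x i = 0 \<or> label x i = 1)" by (simp add: label_def)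
    show "\<forall>x. (\<forall>i<n. x i \<le> p) \<longrightarrow> (\<forall>i<n. x i = 0 \<longrightarrow> label x i = 0)"
      using F[OF cube] p by (auto simp: label_def pt_def)
    show "\<forall>x. (\<forall>i<n. x i \<le> p) \<longrightarrow> (\<forall>i<n. x i = p \<longrightarrow> label x i = 1)" by (simp add: label_def)
  qed
  \<comment> \<open>Kuhn's lemma says nothing about coordinates from \<open>n\<close> on; setting
    them to 0 places the point in the compact infinite cube.\<close>
  define q' where "q' j = (if j < n then pt q j else 0)" for j
  have "\<exists>r\<in>unit_cube n. \<exists>s\<in>unit_cube n.
    (\<forall>j<n. \<bar>r j - q' j\<bar> \<le> 1 / real p) \<and> (\<forall>j<n. \<bar>s j - q' j\<bar> \<le> 1 / real p) \<and> r i \<le> F r i \<and> F s i \<le> s i"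
    if i: "i < n" for i
  proof -
    obtain r s where rs: "\<forall>j<n. q j \<le> r j \<and> r j \<le> q j + 1" "\<forall>j<n. q j \<le> s j \<and> s j \<le> q j + 1" "label r i \<noteq> label s i"
      using lab i by blast
    then obtain r s where rs: "\<forall>j<n. q j \<le> r j \<and> r j \<le> q j + 1" "\<forall>j<n. q j \<le> s j \<and> s j \<le> q j + 1"
      and l: "label r i = 0" "label s i = 1"
      unfolding label_def by (auto split: if_splits)
    have close: "\<bar>pt u j - q' j\<bar> \<le> 1 / real p" if "\<forall>j<n. q j \<le> u j \<and> u j \<le> q j + 1" "j < n" for u j
    proof -
      have "real (q j) \<le> real (u j)" "real (u j) \<le> real (q j) + 1" using that by (auto simp flip: of_nat_Suc)
      then have "\<bar>real (u j) - real (q j)\<bar> \<le> 1" by simp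
      then have "\<bar>real (u j) - real (q j)\<bar> / real p \<le> 1 / real p" by (rule divide_right_mono) simp
      then show ?thesis using that(2) by (simp add: pt_def q'_def diff_divide_distrib[symmetric])
    qed
    have le: "\<forall>j<n. u j \<le> p" if "\<forall>j<n. q j \<le> u j \<and> u j \<le> q j + 1" for u
      using q that by (metis Suc_eq_plus1 Suc_leI le_trans)
    have "pt r i \<le> F (pt r) i" using l(1) by (simp add: label_def split: if_splits)
    moreover have "F (pt s) i \<le> pt s i"
    proof (cases "s i = p")
      case True
      then show ?thesis using F[OF cube[OF le[OF rs(2)]] i] p by (simp add: pt_def)
    next
      case False
      then show ?thesis using l(2) by (simp add: label_def split: if_splits)
    qed
    ultimately show ?thesis
      using cube[OF le[OF rs(1)]] cube[OF le[OF rs(2)]] close[OF rs(1)] close[OF rs(2)] by blast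
  qed
  moreover have "0 \<le> q' i \<and> q' i \<le> 1" for i
    using q p by (auto simp: q'_def pt_def intro: less_imp_le)
  ultimately show ?thesis by blast
qed

text \<open>Points are sequences of which only the first \<open>n\<close> coordinates count, and the
  continuity assumption makes \<open>F\<close> depend on these alone. Along a convergent subsequence
  of approximate fixed points, \<open>r\<close> and \<open>s\<close> have the same limit
  \<open>x\<close>, and their inequalities squeeze \<open>F x i\<close> to
  \<open>x i\<close>.\<close>

lemma brouwer_unit_cube:
  fixes F :: "(nat \<Rightarrow> real) \<Rightarrow> nat \<Rightarrow> real"
  assumes F: "\<And>x i. x \<in> unit_cube n \<Longrightarrow> i < n \<Longrightarrow> 0 \<le> F x i \<and> F x i \<le> 1"
    and cont: "\<And>x u i. x \<in> unit_cube n \<Longrightarrow> (\<And>k. u k \<in> unit_cube n) \<Longrightarrow> (\<And>j. j < n \<Longrightarrow> (\<lambda>k. u k j) \<longlonglongrightarrow> x j) \<Longrightarrow>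
      i < n \<Longrightarrow> (\<lambda>k. F (u k) i) \<longlonglongrightarrow> F x i"
  shows "\<exists>x\<in>unit_cube n. \<forall>i<n. F x i = x i"
proof -
  have "\<exists>q. (\<forall>i. 0 \<le> q i \<and> q i \<le> 1) \<and> (\<forall>i<n. \<exists>r\<in>unit_cube n. \<exists>s\<in>unit_cube n.
    (\<forall>j<n. \<bar>r j - q j\<bar> \<le> 1 / real (Suc k)) \<and> (\<forall>j<n. \<bar>s j - q j\<bar> \<le> 1 / real (Suc k)) \<and> r i \<le> F r i \<and> F s i \<le> s i)" for k
    by (rule cube_approx_fixed_point[OF F]) auto
  then obtain q where q: "\<And>k i. 0 \<le> q k i \<and> q k i \<le> 1"
    and "\<And>k. \<forall>i<n. \<exists>r\<in>unit_cube n. \<exists>s\<in>unit_cube n.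
    (\<forall>j<n. \<bar>r j - q k j\<bar> \<le> 1 / real (Suc k)) \<and> (\<forall>j<n. \<bar>s j - q k j\<bar> \<le> 1 / real (Suc k)) \<and> r i \<le> F r i \<and> F s i \<le> s i"
    by metis
  then have "\<exists>r s. r \<in> unit_cube n \<and> s \<in> unit_cube n \<and>
    (\<forall>j<n. \<bar>r j - q k j\<bar> \<le> 1 / real (Suc k)) \<and> (\<forall>j<n. \<bar>s j - q k j\<bar> \<le> 1 / real (Suc k)) \<and>
    (i < n \<longrightarrow> r i \<le> F r i \<and> F s i \<le> s i)" for k i
  proof (cases "i < n")
    case False
    have "q k \<in> unit_cube n" using q by (simp add: unit_cube_def)
    then show ?thesis using False by (intro exI[of _ "q k"]) auto
  qed blast
  then obtain r s where rs: "\<And>k i. r k i \<in> unit_cube n" "\<And>k i. s k i \<in> unit_cube n"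
    "\<And>k i j. j < n \<Longrightarrow> \<bar>r k i j - q k j\<bar> \<le> 1 / real (Suc k)" "\<And>k i j. j < n \<Longrightarrow> \<bar>s k i j - q k j\<bar> \<le> 1 / real (Suc k)"
    "\<And>k i. i < n \<Longrightarrow> r k i i \<le> F (r k i) i" "\<And>k i. i < n \<Longrightarrow> F (s k i) i \<le> s k i i"
    by metis
  let ?K = "PiE UNIV (\<lambda>_ :: nat. {0..1 :: real})"
  have "q k \<in> ?K" for k using q by auto
  then obtain x \<rho> where x: "x \<in> ?K" and \<rho>: "strict_mono (\<rho> :: nat \<Rightarrow> nat)" and lim: "(q \<circ> \<rho>) \<longlonglongrightarrow> x"
    using seq_compact_unit_cube unfolding seq_compact_def by meson
  have limj: "(\<lambda>k. q (\<rho> k) j) \<longlonglongrightarrow> x j" for j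
    using continuous_on_tendsto_compose[OF continuous_on_product_coordinates lim] by (simp add: comp_def)
  have xc: "x \<in> unit_cube n" using x by (auto simp: unit_cube_def PiE_iff)
  have near: "(\<lambda>k. u (\<rho> k) j) \<longlonglongrightarrow> x j" if "\<And>k. \<bar>u k j - q k j\<bar> \<le> 1 / real (Suc k)" for u :: "nat \<Rightarrow> nat \<Rightarrow> real" and j
  proof -
    have "(\<lambda>k. u k j - q k j) \<longlonglongrightarrow> 0"
      by (rule Lim_null_comparison[OF _ LIMSEQ_inverse_real_of_nat]) (use that in \<open>simp add: inverse_eq_divide\<close>)
    then have "(\<lambda>k. u (\<rho> k) j - q (\<rho> k) j) \<longlonglongrightarrow> 0"
      using LIMSEQ_subseq_LIMSEQ[OF _ \<rho>] by (fastforce simp: comp_def)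
    from tendsto_add[OF this limj[of j]] show ?thesis by simp
  qed
  have "F x i = x i" if i: "i < n" for i
  proof (rule antisym)
    have lr: "(\<lambda>k. r (\<rho> k) i j) \<longlonglongrightarrow> x j" and ls: "(\<lambda>k. s (\<rho> k) i j) \<longlonglongrightarrow> x j" if "j < n" for j
      using near[of "\<lambda>k. r k i" j] near[of "\<lambda>k. s k i" j] rs(3,4) that by auto
    show "x i \<le> F x i"
      by (rule LIMSEQ_le[OF lr[OF i] cont[OF xc _ lr i]]) (use rs i in auto)
    show "F x i \<le> x i"
      by (rule LIMSEQ_le[OF cont[OF xc _ ls i] ls[OF i]]) (use rs i in auto)
  qed
  then show ?thesis using xc by blast
qed


section \<open>Simplices\<close>

definition bary_simplex :: "nat \<Rightarrow> (nat \<Rightarrow> real) set" where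
  "bary_simplex n = {y. (\<forall>i\<le>n. 0 \<le> y i) \<and> sum y {..n} = 1}"

text \<open>
  Normalising \<open>g\<close> gives a map of the simplex to itself that preserves its faces. Composed with a cyclic
  permutation of the vertices, it would have a fixed point with all coordinates 0 if some \<open>g y j\<close> vanished for every \<open>y\<close>.
\<close>

lemma simplex_face_map_positive:
  fixes g :: "(nat \<Rightarrow> real) \<Rightarrow> nat \<Rightarrow> real"
  assumes n: "n > 0"
    and nonneg: "\<And>y j. y \<in> bary_simplex n \<Longrightarrow> j \<le> n \<Longrightarrow> 0 \<le> g y j"
    and pos: "\<And>y. y \<in> bary_simplex n \<Longrightarrow> \<exists>j\<le>n. 0 < g y j"
    and face: "\<And>y j. y \<in> bary_simplex n \<Longrightarrow> j \<le> n \<Longrightarrow> y j = 0 \<Longrightarrow> g y j = 0"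
    and cont: "\<And>y u j. y \<in> bary_simplex n \<Longrightarrow> (\<And>k. u k \<in> bary_simplex n) \<Longrightarrow> (\<And>i. i \<le> n \<Longrightarrow> (\<lambda>k. u k i) \<longlonglongrightarrow> y i) \<Longrightarrow>
      j \<le> n \<Longrightarrow> (\<lambda>k. g (u k) j) \<longlonglongrightarrow> g y j"
  shows "\<exists>y\<in>bary_simplex n. \<forall>j\<le>n. 0 < g y j"
proof -
  \<comment> \<open>\<open>bary\<close> maps the cube to the simplex: a point with coordinate sum at
    most 1 receives the missing mass as last coordinate, any other point is scaled down to sum
    1.\<close>
  define M where "M x = max 1 (sum x {..<n})" for x :: "nat \<Rightarrow> real"
  define bary where "bary x i = (if i < n then x i / M x else 1 - sum x {..<n} / M x)" for x i
  have M1: "1 \<le> M x" "sum x {..<n} \<le> M x" for x by (auto simp: M_def)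
  have M0: "0 < M x" for x using M1(1)[of x] by linarith
  have bary: "bary x \<in> bary_simplex n" if "x \<in> unit_cube n" for x
  proof -
    have "sum (bary x) {..n} = sum (bary x) {..<n} + bary x n" by (simp add: lessThan_Suc_atMost[symmetric])
    also have "sum (bary x) {..<n} = sum x {..<n} / M x" by (simp add: bary_def sum_divide_distrib)
    finally have "sum (bary x) {..n} = 1" by (simp add: bary_def)
    moreover have "0 \<le> bary x i" if "i \<le> n" for i
      using \<open>x \<in> unit_cube n\<close> M0[of x] M1(2)[of x] by (auto simp: bary_def unit_cube_def)
    ultimately show ?thesis by (simp add: bary_simplex_def)
  qed
  define G where "G y = sum (g y) {..n}" for y
  have G: "0 < G y" if "y \<in> bary_simplex n" for y
    unfolding G_def using pos[OF that] nonneg[OF that] by (meson atMost_iff finite_atMost sum_pos2)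
  define prev where "prev i = (if i = 0 then n else i - 1)" for i :: nat
  have prev_le: "prev i \<le> n" if "i \<le> n" for i using that by (auto simp: prev_def)
  define F where "F x i = g (bary x) (prev i) / G (bary x)" for x i
  have "\<exists>x\<in>unit_cube n. \<forall>i<n. F x i = x i"
  proof (rule brouwer_unit_cube)
    fix x i assume x: "x \<in> unit_cube n" and i: "i < n"
    have p: "prev i \<le> n" using prev_le i by simp
    have "g (bary x) (prev i) \<le> G (bary x)"
      unfolding G_def using p nonneg[OF bary[OF x]] by (intro member_le_sum) auto
    then show "0 \<le> F x i \<and> F x i \<le> 1"
      using nonneg[OF bary[OF x] p] G[OF bary[OF x]] by (simp add: F_def)
  next
    fix x u i assume x: "x \<in> unit_cube n" and u: "\<And>k. u k \<in> unit_cube n"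
      and lim: "\<And>j. j < n \<Longrightarrow> (\<lambda>k. u k j) \<longlonglongrightarrow> x j" and i: "i < n"
    have sum: "(\<lambda>k. sum (u k) {..<n}) \<longlonglongrightarrow> sum x {..<n}" by (intro tendsto_sum lim) simp
    then have M: "(\<lambda>k. M (u k)) \<longlonglongrightarrow> M x" unfolding M_def by (intro tendsto_max tendsto_const)
    have "(\<lambda>k. bary (u k) j) \<longlonglongrightarrow> bary x j" for j
    proof (cases "j < n")
      case True
      have "(\<lambda>k. u k j / M (u k)) \<longlonglongrightarrow> x j / M x" by (intro tendsto_divide lim True M less_imp_neq[OF M0, symmetric])
      then show ?thesis using True by (simp add: bary_def)
    next
      case False
      have "(\<lambda>k. 1 - sum (u k) {..<n} / M (u k)) \<longlonglongrightarrow> 1 - sum x {..<n} / M x"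
        by (intro tendsto_diff tendsto_const tendsto_divide sum M less_imp_neq[OF M0, symmetric])
      then show ?thesis using False by (simp add: bary_def)
    qed
    then have g: "(\<lambda>k. g (bary (u k)) j) \<longlonglongrightarrow> g (bary x) j" if "j \<le> n" for j
      using that by (intro cont[of "bary x" "\<lambda>k. bary (u k)"] bary x u)
    have "(\<lambda>k. G (bary (u k))) \<longlonglongrightarrow> G (bary x)" unfolding G_def by (intro tendsto_sum g) simp
    then show "(\<lambda>k. F (u k) i) \<longlonglongrightarrow> F x i"
      unfolding F_def using prev_le i
      by (intro tendsto_divide g less_imp_neq[OF G, symmetric] bary x) auto
  qed
  then obtain x where x: "x \<in> unit_cube n" "\<And>i. i < n \<Longrightarrow> F x i = x i" by blast
  define y where "y = bary x"
  have y: "y \<in> bary_simplex n" using bary x by (simp add: y_def)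
  \<comment> \<open>As \<open>i\<close> runs through \<open>{..<n}\<close>, \<open>prev i\<close>
    takes all values up to \<open>n\<close> except \<open>n - 1\<close>.\<close>
  have sum_g: "(\<Sum>i<n. g y (prev i)) + g y (n - 1) = G y"
  proof -
    obtain m where m: "n = Suc m" using n gr0_conv_Suc by blast
    have "(\<Sum>i<n. g y (prev i)) = g y n + (\<Sum>i<m. g y i)"
      unfolding m by (subst sum.lessThan_Suc_shift) (simp add: prev_def m)
    then show ?thesis by (simp add: G_def m lessThan_Suc_atMost[symmetric] add.commute add.left_commute)
  qed
  have "sum x {..<n} = (\<Sum>i<n. g y (prev i) / G y)"
    by (rule sum.cong) (use x(2) in \<open>auto simp: F_def y_def\<close>)
  also have "\<dots> = (G y - g y (n - 1)) / G y" using sum_g by (simp add: sum_divide_distrib[symmetric] algebra_simps)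
  finally have sx: "sum x {..<n} = 1 - g y (n - 1) / G y" using G[OF y] by (simp add: diff_divide_distrib)
  \<comment> \<open>No scaling takes place at the fixed point of the cube map, so \<open>y\<close>
    is a fixed point of the permuted and normalised map on the simplex.\<close>
  then have "M x = 1" using nonneg[OF y, of "n - 1"] G[OF y] by (simp add: M_def)
  then have yi: "y i = g y (prev i) / G y" if "i \<le> n" for i
  proof (cases "i < n")
    case True
    then show ?thesis using x(2)[OF True] \<open>M x = 1\<close> by (simp add: y_def bary_def F_def)
  next
    case False
    then have "i = n" using that by simp
    then show ?thesis using sx \<open>M x = 1\<close> n by (simp add: y_def bary_def prev_def)
  qed
  have "0 < g y j" if j: "j \<le> n" for j
  proof (rule ccontr)
    assume "\<not> 0 < g y j"
    then have zero: "g y j = 0" using nonneg[OF y j] by simp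
    \<comment> \<open>If \<open>g y\<close> vanishes at the predecessor of \<open>i\<close>, then
      \<open>y i = 0\<close> by the fixed point equation, and the face condition gives
      \<open>g y i = 0\<close>. A single zero thus spreads around the cycle.\<close>
    have step: "g y i = 0" if "i \<le> n" "g y (prev i) = 0" for i
      using yi[OF that(1)] that face[OF y] by simp
    have up: "g y (j + k) = 0" if "j + k \<le> n" for k
      using that
    proof (induction k)
      case (Suc k)
      then show ?case using step[of "j + Suc k"] by (simp add: prev_def)
    qed (use zero in simp)
    have "g y n = 0" using up[of "n - j"] j by simp
    then have "g y 0 = 0" using step[of 0] by (simp add: prev_def)
    then have "g y k = 0" if "k \<le> n" for k
      using that
    proof (induction k)
      case (Suc k)
      then show ?case using step[of "Suc k"] by (simp add: prev_def)
    qed simp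
    then show False using pos[OF y] by auto
  qed
  then show ?thesis using y by blast
qed


section \<open>The dimension of the space of non-trivial pyramids\<close>

text \<open>
  The \<open>j\<close>-th barycentric coordinate is proportional to the difference of the entries \<open>j\<close> and \<open>j + 1\<close>.
\<close>

definition simplex_weights :: "nat \<Rightarrow> (nat \<Rightarrow> real) \<Rightarrow> nat \<Rightarrow>\<^sub>C real" where
  "simplex_weights N y = Bcontfun (\<lambda>k. sum y {k..N} / (real N + 2))"

lemma apply_simplex_weights:
  "apply_bcontfun (simplex_weights N y) k = sum y {k..N} / (real N + 2)"
proof -
  let ?f = "\<lambda>k. sum y {k..N} / (real N + 2)"
  have "\<bar>?f k\<bar> \<le> (\<Sum>j\<le>N. \<bar>y j\<bar>)" for k
  proof -
    have "\<bar>sum y {k..N}\<bar> \<le> (\<Sum>j\<in>{k..N}. \<bar>y j\<bar>)" by (rule sum_abs)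
    also have "\<dots> \<le> (\<Sum>j\<le>N. \<bar>y j\<bar>)" by (rule sum_mono2) auto
    finally have "\<bar>sum y {k..N}\<bar> / (real N + 2) \<le> (\<Sum>j\<le>N. \<bar>y j\<bar>) / 1"
      by (intro frac_le) (auto intro: sum_nonneg)
    then show ?thesis by (simp add: abs_divide)
  qed
  then have "?f \<in> bcontfun" by (intro bcontfun_normI[of _ "\<Sum>j\<le>N. \<bar>y j\<bar>"]) auto
  then show ?thesis by (simp add: simplex_weights_def Bcontfun_inverse)
qed

text \<open>The divisor \<open>N + 2\<close> keeps the first weight constant on the simplex and
  strictly between 0 and 1, as non-triviality demands, and bounds the sum of the at most
  \<open>N + 1\<close> positive weights by 1.\<close>

lemma simplex_weights_0:
  "y \<in> bary_simplex N \<Longrightarrow> apply_bcontfun (simplex_weights N y) 0 = 1 / (real N + 2)"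
  by (simp add: apply_simplex_weights bary_simplex_def atLeast0AtMost)

lemma simplex_weights_diff:
  assumes "j \<le> N"
  shows "apply_bcontfun (simplex_weights N y) j = apply_bcontfun (simplex_weights N y) (Suc j) + y j / (real N + 2)"
  using sum.atLeast_Suc_atMost[OF assms, of y] by (simp add: apply_simplex_weights add_divide_distrib)

lemma simplex_weights_in_atom_weights:
  assumes y: "y \<in> bary_simplex N"
  shows "simplex_weights N y \<in> atom_weights"
proof -
  let ?a = "apply_bcontfun (simplex_weights N y)"
  have y0: "0 \<le> y i" if "i \<le> N" for i using y that by (simp add: bary_simplex_def)
  have nonneg: "0 \<le> ?a i" for i
    unfolding apply_simplex_weights using y0 by (intro divide_nonneg_nonneg sum_nonneg) auto
  have zero: "?a i = 0" if "i \<notin> {..N}" for i using that by (simp add: apply_simplex_weights)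
  have step: "?a (Suc i) \<le> ?a i" for i
    using simplex_weights_diff[of i N y] y0[of i] zero[of i] zero[of "Suc i"] by (cases "i \<le> N") auto
  have le: "?a i \<le> 1 / (real N + 2)" for i
    using lift_Suc_antimono_le[of ?a 0 i] step simplex_weights_0[OF y] by simp
  have "summable ?a" by (rule summable_finite[of "{..N}"]) (use zero in auto)
  moreover have "suminf ?a \<le> 1"
  proof -
    have "suminf ?a = sum ?a {..N}" by (rule suminf_finite) (use zero in auto)
    also have "\<dots> \<le> (\<Sum>i\<le>N. 1 / (real N + 2))" by (intro sum_mono le)
    also have "\<dots> \<le> 1" by (simp add: field_simps)
    finally show ?thesis .
  qed
  ultimately show ?thesis using nonneg step by (simp add: atom_weights_def)
qed

lemma tendsto_simplex_weights:
  assumes "\<And>i. i \<le> N \<Longrightarrow> (\<lambda>k. u k i) \<longlonglongrightarrow> y i"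
  shows "(\<lambda>k. simplex_weights N (u k)) \<longlonglongrightarrow> simplex_weights N y"
proof (rule tendsto_dist_iff[THEN iffD2], rule tendsto_sandwich[OF _ _ tendsto_const])
  have "(\<lambda>k. \<Sum>j\<le>N. \<bar>u k j - y j\<bar>) \<longlonglongrightarrow> (\<Sum>j\<le>N. \<bar>y j - y j\<bar>)"
    using assms by (intro tendsto_intros) auto
  then show "(\<lambda>k. \<Sum>j\<le>N. \<bar>u k j - y j\<bar>) \<longlonglongrightarrow> 0" by simp
  have "dist (simplex_weights N (u k)) (simplex_weights N y) \<le> (\<Sum>j\<le>N. \<bar>u k j - y j\<bar>)" for k
  proof (rule dist_bound)
    fix i
    have "\<bar>sum (u k) {i..N} - sum y {i..N}\<bar> \<le> (\<Sum>j\<in>{i..N}. \<bar>u k j - y j\<bar>)"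
      by (simp add: sum_subtractf[symmetric])
    also have "\<dots> \<le> (\<Sum>j\<le>N. \<bar>u k j - y j\<bar>)" by (rule sum_mono2) auto
    finally have "\<bar>sum (u k) {i..N} - sum y {i..N}\<bar> / (real N + 2) \<le> (\<Sum>j\<le>N. \<bar>u k j - y j\<bar>) / 1"
      by (intro frac_le) (auto intro: sum_nonneg)
    then show "dist (apply_bcontfun (simplex_weights N (u k)) i) (apply_bcontfun (simplex_weights N y) i) \<le> (\<Sum>j\<le>N. \<bar>u k j - y j\<bar>)"
      by (simp add: apply_simplex_weights dist_real_def diff_divide_distrib[symmetric] abs_divide)
  qed
  then show "\<forall>\<^sub>F k in sequentially. dist (simplex_weights N (u k)) (simplex_weights N y) \<le> (\<Sum>j\<le>N. \<bar>u k j - y j\<bar>)"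
    by simp
qed simp

lemma continuous_on_eval_bcontfun:
  "continuous_on UNIV (\<lambda>\<alpha> :: 'a :: topological_space \<Rightarrow>\<^sub>C 'b :: metric_space. apply_bcontfun \<alpha> x)"
  by (rule continuous_on_iff[THEN iffD2]) (meson dist_bounded le_less_trans)

text \<open>Lebesgue's covering argument on a simplex with \<open>N + 1 = n + 2\<close> vertices.
  The cover omits one face at a time. The distances to the complements of the sets of a refinement
  vanish on the corresponding faces, so by \<open>simplex_face_map_positive\<close> they are
  positive at a common point, which then lies in \<open>n + 2\<close> members of the
  refinement.\<close>

lemma not_covering_dim_le_nontrivial_pyramids:
  "\<not> covering_dim_le (subtopology weak_topology nontrivial_pyramids) n"
proof
  let ?T = "subtopology weak_topology nontrivial_pyramids"
  assume dim: "covering_dim_le ?T n"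
  define N where "N = Suc n"
  define c where "c = 1 / (real N + 2)"
  have c: "0 < c" "c < 1" by (auto simp: c_def)
  have top: "topspace ?T = nontrivial_pyramids"
    by (auto simp: topspace_weak_topology nontrivial_pyramids_def)
  define S where "S = {\<alpha> \<in> atom_weights. apply_bcontfun \<alpha> 0 = c}"
  have S: "atom_pyramid \<alpha> \<in> nontrivial_pyramids" if "\<alpha> \<in> S" for \<alpha>
    using that c by (intro atom_pyramid_nontrivial) (auto simp: S_def)
  define A where "A = simplex_weights N"
  have AS: "A y \<in> S" if "y \<in> bary_simplex N" for y
    using simplex_weights_in_atom_weights[OF that] simplex_weights_0[OF that] by (simp add: A_def S_def c_def)
  \<comment> \<open>For \<open>j \<le> N\<close> this is the image of the face
    \<open>y j = 0\<close>, described by closed conditions on the weights.\<close>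
  define Z where "Z j = {\<alpha> \<in> S. apply_bcontfun \<alpha> (Suc N) = 0 \<and> apply_bcontfun \<alpha> j = apply_bcontfun \<alpha> (Suc j)}" for j
  have Z: "closedin (top_of_set atom_weights) (Z j)" for j
  proof -
    have "closed ({\<alpha> :: nat \<Rightarrow>\<^sub>C real. apply_bcontfun \<alpha> 0 = c} \<inter> {\<alpha>. apply_bcontfun \<alpha> (Suc N) = 0} \<inter>
        {\<alpha>. apply_bcontfun \<alpha> j = apply_bcontfun \<alpha> (Suc j)})"
      by (intro closed_Int closed_Collect_eq continuous_on_eval_bcontfun continuous_on_const)
    moreover have "Z j = atom_weights \<inter> ({\<alpha> :: nat \<Rightarrow>\<^sub>C real. apply_bcontfun \<alpha> 0 = c} \<inter>
        {\<alpha>. apply_bcontfun \<alpha> (Suc N) = 0} \<inter> {\<alpha>. apply_bcontfun \<alpha> j = apply_bcontfun \<alpha> (Suc j)})"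
      by (auto simp: Z_def S_def)
    ultimately show ?thesis unfolding closedin_closed by blast
  qed
  have AZ: "A y \<in> Z j" if "y \<in> bary_simplex N" "j \<le> N" "y j = 0" for y j
    using AS[OF that(1)] simplex_weights_diff[OF that(2), of y] that(3) by (simp add: Z_def A_def apply_simplex_weights)
  define U where "U j = nontrivial_pyramids - atom_pyramid ` Z j" for j
  have U: "openin ?T (U j)" for j
  proof -
    have "openin weak_topology (topspace weak_topology - atom_pyramid ` Z j)"
      using closedin_image_atom_pyramid[OF Z] by (simp add: closedin_def)
    moreover have "U j = (topspace weak_topology - atom_pyramid ` Z j) \<inter> nontrivial_pyramids"
      by (auto simp: U_def topspace_weak_topology nontrivial_pyramids_def)
    ultimately show ?thesis unfolding openin_subtopology by blast
  qed
  have cover: "\<Union>(U ` {..N}) = topspace ?T"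
  proof (intro equalityI subsetI)
    fix P assume P: "P \<in> topspace ?T"
    show "P \<in> \<Union>(U ` {..N})"
    proof (rule ccontr)
      assume "P \<notin> \<Union>(U ` {..N})"
      then have *: "P \<in> atom_pyramid ` Z j" if "j \<le> N" for j using P that unfolding top U_def by blast
      then obtain \<alpha> where \<alpha>: "\<alpha> \<in> Z 0" "P = atom_pyramid \<alpha>" by blast
      \<comment> \<open>Injectivity identifies the weights obtained for different \<open>j\<close>.
        A sequence common to all faces is constant up to \<open>Suc N\<close>, yet starts at
        \<open>c > 0\<close> and has entry 0 at \<open>Suc N\<close>.\<close>
      have "\<alpha> \<in> Z j" if j: "j \<le> N" for j
      proof -
        obtain \<beta> where \<beta>: "\<beta> \<in> Z j" "P = atom_pyramid \<beta>" using *[OF j] by blast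
        have "\<alpha> = \<beta>"
          using inj_onD[OF inj_on_atom_pyramid, of \<alpha> \<beta>] \<alpha> \<beta> by (auto simp: Z_def S_def)
        then show ?thesis using \<beta>(1) by simp
      qed
      then have eq: "apply_bcontfun \<alpha> j = apply_bcontfun \<alpha> (Suc j)" if "j \<le> N" for j
        using that by (simp add: Z_def)
      have "apply_bcontfun \<alpha> k = apply_bcontfun \<alpha> 0" if "k \<le> Suc N" for k
        using that
      proof (induction k)
        case (Suc k)
        then show ?case using eq[of k] by simp
      qed simp
      then have "apply_bcontfun \<alpha> (Suc N) = apply_bcontfun \<alpha> 0" by blast
      then show False using \<alpha>(1) c(1) unfolding Z_def S_def by force
    qed
  next
    fix P assume "P \<in> \<Union>(U ` {..N})"
    then show "P \<in> topspace ?T" unfolding top U_def by blast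
  qed
  have "finite (U ` {..N}) \<and> (\<forall>V\<in>U ` {..N}. openin ?T V) \<and> \<Union>(U ` {..N}) = topspace ?T"
    using U cover by simp
  from dim[unfolded covering_dim_le_def, THEN spec, THEN mp, OF this]
  obtain \<V> where cov: "\<forall>V\<in>\<V>. openin ?T V" "\<Union>\<V> = topspace ?T"
    "\<forall>V\<in>\<V>. \<exists>W\<in>U ` {..N}. V \<subseteq> W"
    "\<forall>P\<in>topspace ?T. finite {V\<in>\<V>. P \<in> V} \<and> card {V\<in>\<V>. P \<in> V} \<le> n + 1"
    by (elim exE conjE)
  note \<V> = cov(1)[rule_format] cov(2) cov(3)[rule_format] cov(4)[rule_format]
  have "\<exists>j. j \<le> N \<and> V \<subseteq> U j" if "V \<in> \<V>" for V using \<V>(3)[OF that] by auto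
  then obtain idx where idx: "\<And>V. V \<in> \<V> \<Longrightarrow> idx V \<le> N \<and> V \<subseteq> U (idx V)" by metis
  \<comment> \<open>The members of the refinement are grouped by the set \<open>U j\<close> assigned
    to them. Members from different groups are distinct, which gives the count at the end.\<close>
  define W where "W j = \<Union>{V\<in>\<V>. idx V = j}" for j
  have W: "openin ?T (W j)" for j unfolding W_def using \<V>(1) by (intro openin_Union) auto
  have WU: "W j \<subseteq> U j" for j using idx by (auto simp: W_def)
  define C where "C j = {\<alpha> \<in> S. atom_pyramid \<alpha> \<notin> W j}" for j
  define g where "g y j = infdist (A y) (C j)" for y j
  have AC: "A y \<in> C j" if y: "y \<in> bary_simplex N" "j \<le> N" "y j = 0" for y j
    using AS[OF y(1)] AZ[OF y] WU[of j] by (auto simp: C_def U_def)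
  \<comment> \<open>\<open>infdist\<close> to the empty set is 0, so positivity of \<open>g\<close>
    requires this; the vertex \<open>i \<noteq> j\<close> of the simplex lies on the face opposite
    to \<open>j\<close>.\<close>
  have C_ne: "C j \<noteq> {}" if "j \<le> N" for j
  proof -
    define i where "i = (if j = 0 then 1 else 0 :: nat)"
    have i: "i \<le> N" "i \<noteq> j" by (auto simp: i_def N_def)
    have "(\<lambda>k. if k = i then 1 else 0) \<in> bary_simplex N" using i(1) by (simp add: bary_simplex_def)
    then show ?thesis using AC[OF _ that] i(2) by force
  qed
  have "\<exists>y\<in>bary_simplex N. \<forall>j\<le>N. 0 < g y j"
  proof (rule simplex_face_map_positive)
    show "N > 0" by (simp add: N_def)
    show "0 \<le> g y j" for y j by (simp add: g_def infdist_nonneg)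
    show "g y j = 0" if "y \<in> bary_simplex N" "j \<le> N" "y j = 0" for y j
      using AC[OF that] by (simp add: g_def)
    show "(\<lambda>k. g (u k) j) \<longlonglongrightarrow> g y j" if "\<And>i. i \<le> N \<Longrightarrow> (\<lambda>k. u k i) \<longlonglongrightarrow> y i" for y u j
      unfolding g_def A_def using that by (intro tendsto_infdist tendsto_simplex_weights)
    fix y assume y: "y \<in> bary_simplex N"
    have "atom_pyramid (A y) \<in> topspace ?T" using S[OF AS[OF y]] by (simp only: top)
    then obtain V where V: "V \<in> \<V>" "atom_pyramid (A y) \<in> V" using \<V>(2) by blast
    define j where "j = idx V"
    have j: "j \<le> N" "atom_pyramid (A y) \<in> W j" using V idx by (auto simp: j_def W_def)
    \<comment> \<open>By continuity all weights in \<open>S\<close> within some \<open>e\<close> of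
      \<open>A y\<close> are mapped into \<open>W j\<close>, so \<open>C j\<close> stays at distance
      at least \<open>e\<close> from \<open>A y\<close>.\<close>
    obtain O' where O': "openin weak_topology O'" "W j = O' \<inter> nontrivial_pyramids"
      using W[of j] unfolding openin_subtopology by blast
    have "openin (top_of_set atom_weights) {\<alpha> \<in> topspace (top_of_set atom_weights). atom_pyramid \<alpha> \<in> O'}"
      using continuous_map_atom_pyramid O'(1) unfolding continuous_map_def by blast
    then obtain e where e: "e > 0" "\<And>\<beta>. \<beta> \<in> atom_weights \<Longrightarrow> dist \<beta> (A y) < e \<Longrightarrow> atom_pyramid \<beta> \<in> O'"
      using j(2) O'(2) AS[OF y] unfolding openin_euclidean_subtopology_iff S_def by auto
    have "e \<le> dist (A y) \<beta>" if "\<beta> \<in> C j" for \<beta>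
      using e(2)[of \<beta>] that S[of \<beta>] O'(2) by (force simp: C_def S_def dist_commute)
    then have "e \<le> g y j"
      unfolding g_def infdist_notempty[OF C_ne[OF j(1)]] by (intro cINF_greatest C_ne j)
    then show "\<exists>j\<le>N. 0 < g y j" using e(1) j(1) by force
  qed
  then obtain y where y: "y \<in> bary_simplex N" "\<And>j. j \<le> N \<Longrightarrow> 0 < g y j" by blast
  let ?P = "atom_pyramid (A y)"
  have "?P \<in> W j" if "j \<le> N" for j
  proof (rule ccontr)
    assume "?P \<notin> W j"
    then have "A y \<in> C j" using AS[OF y(1)] by (simp add: C_def)
    then show False using y(2)[OF that] by (simp add: g_def)
  qed
  then have "\<exists>V. V \<in> \<V> \<and> idx V = j \<and> ?P \<in> V" if "j \<le> N" for j
    using that by (auto simp: W_def)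
  then obtain V where V: "\<And>j. j \<le> N \<Longrightarrow> V j \<in> \<V> \<and> idx (V j) = j \<and> ?P \<in> V j" by metis
  have "inj_on V {..N}" by (rule inj_onI) (metis V atMost_iff)
  then have "card (V ` {..N}) = Suc N" by (simp add: card_image)
  moreover have fin: "finite {V\<in>\<V>. ?P \<in> V}" "card {V\<in>\<V>. ?P \<in> V} \<le> n + 1"
    using \<V>(4) S[OF AS[OF y(1)]] by (simp_all only: top)
  moreover have "card (V ` {..N}) \<le> card {V\<in>\<V>. ?P \<in> V}"
    using V by (intro card_mono fin) auto
  ultimately show False by (simp add: N_def)
qed

theorem theorem0p7:
  shows "embedding_map (top_of_set atom_weights) weak_topology atom_pyramid \<and>
         (\<forall>n. \<not> covering_dim_le (subtopology weak_topology nontrivial_pyramids) n)"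
  using embedding_map_atom_pyramid not_covering_dim_le_nontrivial_pyramids by blast

end
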